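(* Let $G$ be a countable infinite discrete group, $X$ a compact metrizable abelian group with normalized Haar measure $\nu$, and $\sigma: G\curvearrowright (X,\nu)$ an algebraic action which is weakly mixing. Assume moreover that the diagonal actions $\sigma^2:G\curvearrowright (X^2,\nu^2)$ and $\sigma^4:G\curvearrowright(X^4,\nu^4)$ are $\mathbb{T}$-cocycle superrigid, and that $H^2(G,\widehat X)$ is torsion free as an abelian group. Then the natural map $\Psi_2:H^2(G,\mathbb{T})\to H^2(G\curvearrowright X;\mathbb{T})$ is injective, and the map $$\Phi_2: H^2(G,\widehat{X})\to \frac{H^2(G\curvearrowright X;\mathbb{T})}{\Psi_2(H^2(G,\mathbb{T}))},\qquad \Phi_2([c])=[\tilde c]+\Psi_2(H^2(G,\mathbb{T})),$$ where $\tilde c(g,h,x)=c(g,h)(x)$, is a well-defined injective group homomorphism.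
   Context: An algebraic action of $G$ is a homomorphism $G\to \mathrm{Aut}(X)$ into the group of continuous automorphisms of a compact metrizable abelian group $X$; it preserves Haar measure. $\widehat X$ is the Pontryagin dual (continuous homomorphisms $X\to\mathbb{T}$), a left $\mathbb{Z}G$-module via $(g\chi)(x)=\chi(g^{-1}x)$. A p.m.p. action is weakly mixing if the diagonal action on the product of two copies is ergodic. A free, ergodic p.m.p. action $G\curvearrowright(Y,\eta)$ is $\mathbb{T}$-cocycle superrigid if every measurable $c:G\times Y\to\mathbb{T}$ satisfying $c(gh,y)=c(g,y)c(h,g^{-1}y)$ for all $g,h$ and a.e. $y$ is cohomologous to a homomorphism $\lambda:G\to\mathbb{T}$, i.e. there is measurable $b:Y\to\mathbb{T}$ with $c(g,y)=\lambda(g)b(y)b(g^{-1}y)^{-1}$ a.e. Group cohomology $H^n(G,M)$ uses inhomogeneous cochains with the standard coboundary; $\mathbb{T}$ has trivial $G$-action. For a p.m.p. action $G\curvearrowright(X,\mu)$, $H^2(G\curvearrowright X;\mathbb{T})$ is the group of measurable $c:G^2\times X\to\mathbb{T}$ with $c(h,k,g^{-1}x)c(gh,k,x)^{-1}c(g,hk,x)c(g,h,x)^{-1}=1$ for all $g,h,k$ and a.e. $x$, modulo those of the form $c(g,h,x)=b(g,x)b(h,g^{-1}x)b(gh,x)^{-1}$ for a measurable $b:G\times X\to\mathbb{T}$. The natural map $\Psi_2$ sends $[c]\in H^2(G,\mathbb{T})$ to the class of $(g,h,x)\mapsto c(g,h)$. *)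

theory Defs
  imports "HOL-Probability.Probability" "HOL-Algebra.Group"
begin

definition circle :: "complex set" where
  "circle = {z. cmod z = 1}"

(* The type 'x (with its metric topology) is a compact abelian topological group.
   A compact metrizable space is represented by a type of class metric_space. *)
definition compact_abelian_top_group :: "('x::{metric_space, ab_group_add}) itself \<Rightarrow> bool" where
  "compact_abelian_top_group _ \<longleftrightarrow>
     compact (UNIV :: 'x set) \<and>
     continuous_on UNIV (\<lambda>p::'x \<times> 'x. fst p + snd p) \<and>
     continuous_on UNIV (uminus :: 'x \<Rightarrow> 'x)"

definition haar_prob :: "('x::{metric_space, ab_group_add}) measure \<Rightarrow> bool" where
  "haar_prob \<nu> \<longleftrightarrow> sets \<nu> = sets borel \<and> prob_space \<nu> \<and>
     (\<forall>a. \<forall>A \<in> sets borel. emeasure \<nu> ((\<lambda>x. a + x) ` A) = emeasure \<nu> A)"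

definition pontryagin_dual :: "('x::{metric_space, ab_group_add} \<Rightarrow> complex) set" where
  "pontryagin_dual = {chi. continuous_on UNIV chi \<and> (\<forall>x. chi x \<in> circle) \<and>
                          (\<forall>a b. chi (a + b) = chi a * chi b)}"

definition algebraic_action ::
  "('g, 'b) monoid_scheme \<Rightarrow> ('g \<Rightarrow> 'x::{metric_space, ab_group_add} \<Rightarrow> 'x) \<Rightarrow> bool" where
  "algebraic_action G \<sigma> \<longleftrightarrow>
     (\<forall>g \<in> carrier G. bij (\<sigma> g) \<and> continuous_on UNIV (\<sigma> g) \<and>
                      (\<forall>a b. \<sigma> g (a + b) = \<sigma> g a + \<sigma> g b)) \<and>
     \<sigma> \<one>\<^bsub>G\<^esub> = id \<and>
     (\<forall>g \<in> carrier G. \<forall>h \<in> carrier G. \<sigma> (g \<otimes>\<^bsub>G\<^esub> h) = \<sigma> g \<circ> \<sigma> h)"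

definition pmp_action :: "('g, 'b) monoid_scheme \<Rightarrow> 'y measure \<Rightarrow> ('g \<Rightarrow> 'y \<Rightarrow> 'y) \<Rightarrow> bool" where
  "pmp_action G M \<tau> \<longleftrightarrow> prob_space M \<and>
     (\<forall>g \<in> carrier G. \<tau> g \<in> measurable M M \<and> distr M M (\<tau> g) = M) \<and>
     (\<forall>y \<in> space M. \<tau> \<one>\<^bsub>G\<^esub> y = y) \<and>
     (\<forall>g \<in> carrier G. \<forall>h \<in> carrier G. \<forall>y \<in> space M. \<tau> (g \<otimes>\<^bsub>G\<^esub> h) y = \<tau> g (\<tau> h y))"

definition ergodic_action :: "('g, 'b) monoid_scheme \<Rightarrow> 'y measure \<Rightarrow> ('g \<Rightarrow> 'y \<Rightarrow> 'y) \<Rightarrow> bool" where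
  "ergodic_action G M \<tau> \<longleftrightarrow> pmp_action G M \<tau> \<and>
     (\<forall>A \<in> sets M. (\<forall>g \<in> carrier G. \<tau> g -` A \<inter> space M = A) \<longrightarrow>
                   emeasure M A = 0 \<or> emeasure M A = 1)"

definition free_action :: "('g, 'b) monoid_scheme \<Rightarrow> 'y measure \<Rightarrow> ('g \<Rightarrow> 'y \<Rightarrow> 'y) \<Rightarrow> bool" where
  "free_action G M \<tau> \<longleftrightarrow>
     (\<forall>g \<in> carrier G. g \<noteq> \<one>\<^bsub>G\<^esub> \<longrightarrow> (AE y in M. \<tau> g y \<noteq> y))"

definition diag2 :: "('g \<Rightarrow> 'y \<Rightarrow> 'y) \<Rightarrow> 'g \<Rightarrow> 'y \<times> 'y \<Rightarrow> 'y \<times> 'y" where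
  "diag2 \<tau> g = (\<lambda>(y, z). (\<tau> g y, \<tau> g z))"

definition weakly_mixing :: "('g, 'b) monoid_scheme \<Rightarrow> 'y measure \<Rightarrow> ('g \<Rightarrow> 'y \<Rightarrow> 'y) \<Rightarrow> bool" where
  "weakly_mixing G M \<tau> \<longleftrightarrow> pmp_action G M \<tau> \<and> ergodic_action G (M \<Otimes>\<^sub>M M) (diag2 \<tau>)"

definition T_cocycle_superrigid ::
  "('g, 'b) monoid_scheme \<Rightarrow> 'y measure \<Rightarrow> ('g \<Rightarrow> 'y \<Rightarrow> 'y) \<Rightarrow> bool" where
  "T_cocycle_superrigid G M \<tau> \<longleftrightarrow> free_action G M \<tau> \<and> ergodic_action G M \<tau> \<and>
     (\<forall>c :: 'g \<Rightarrow> 'y \<Rightarrow> complex.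
        (\<forall>g \<in> carrier G. c g \<in> borel_measurable M \<and> (\<forall>y \<in> space M. c g y \<in> circle)) \<and>
        (\<forall>g \<in> carrier G. \<forall>h \<in> carrier G.
            AE y in M. c (g \<otimes>\<^bsub>G\<^esub> h) y = c g y * c h (\<tau> (inv\<^bsub>G\<^esub> g) y))
        \<longrightarrow>
        (\<exists>lam b. (\<forall>g \<in> carrier G. lam g \<in> circle) \<and>
               (\<forall>g \<in> carrier G. \<forall>h \<in> carrier G. lam (g \<otimes>\<^bsub>G\<^esub> h) = lam g * lam h) \<and>
               b \<in> borel_measurable M \<and> (\<forall>y \<in> space M. b y \<in> circle) \<and>
               (\<forall>g \<in> carrier G. AE y in M.
                   c g y = lam g * b y * inverse (b (\<tau> (inv\<^bsub>G\<^esub> g) y)))))"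

definition dual_act :: "('g, 'b) monoid_scheme \<Rightarrow> ('g \<Rightarrow> 'x \<Rightarrow> 'x) \<Rightarrow> 'g \<Rightarrow> ('x \<Rightarrow> complex) \<Rightarrow> ('x \<Rightarrow> complex)" where
  "dual_act G \<sigma> g chi = (\<lambda>x. chi (\<sigma> (inv\<^bsub>G\<^esub> g) x))"

definition Z2_dual :: "('g, 'b) monoid_scheme \<Rightarrow> ('g \<Rightarrow> 'x::{metric_space, ab_group_add} \<Rightarrow> 'x)
                       \<Rightarrow> ('g \<Rightarrow> 'g \<Rightarrow> 'x \<Rightarrow> complex) set" where
  "Z2_dual G \<sigma> = {c. (\<forall>g \<in> carrier G. \<forall>h \<in> carrier G. c g h \<in> pontryagin_dual) \<and>
     (\<forall>g \<in> carrier G. \<forall>h \<in> carrier G. \<forall>k \<in> carrier G. \<forall>x.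
        dual_act G \<sigma> g (c h k) x * inverse (c (g \<otimes>\<^bsub>G\<^esub> h) k x) *
        c g (h \<otimes>\<^bsub>G\<^esub> k) x * inverse (c g h x) = 1)}"

definition B2_dual :: "('g, 'b) monoid_scheme \<Rightarrow> ('g \<Rightarrow> 'x::{metric_space, ab_group_add} \<Rightarrow> 'x)
                       \<Rightarrow> ('g \<Rightarrow> 'g \<Rightarrow> 'x \<Rightarrow> complex) \<Rightarrow> bool" where
  "B2_dual G \<sigma> c \<longleftrightarrow> (\<exists>b. (\<forall>g \<in> carrier G. b g \<in> pontryagin_dual) \<and>
     (\<forall>g \<in> carrier G. \<forall>h \<in> carrier G. \<forall>x.
        c g h x = dual_act G \<sigma> g (b h) x * inverse (b (g \<otimes>\<^bsub>G\<^esub> h) x) * b g x))"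

definition Z2_T :: "('g, 'b) monoid_scheme \<Rightarrow> ('g \<Rightarrow> 'g \<Rightarrow> complex) set" where
  "Z2_T G = {d. (\<forall>g \<in> carrier G. \<forall>h \<in> carrier G. d g h \<in> circle) \<and>
     (\<forall>g \<in> carrier G. \<forall>h \<in> carrier G. \<forall>k \<in> carrier G.
        d h k * inverse (d (g \<otimes>\<^bsub>G\<^esub> h) k) * d g (h \<otimes>\<^bsub>G\<^esub> k) * inverse (d g h) = 1)}"

definition B2_T :: "('g, 'b) monoid_scheme \<Rightarrow> ('g \<Rightarrow> 'g \<Rightarrow> complex) \<Rightarrow> bool" where
  "B2_T G d \<longleftrightarrow> (\<exists>b. (\<forall>g \<in> carrier G. b g \<in> circle) \<and>
     (\<forall>g \<in> carrier G. \<forall>h \<in> carrier G. d g h = b h * inverse (b (g \<otimes>\<^bsub>G\<^esub> h)) * b g))"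

definition Z2_act :: "('g, 'b) monoid_scheme \<Rightarrow> 'y measure \<Rightarrow> ('g \<Rightarrow> 'y \<Rightarrow> 'y)
                      \<Rightarrow> ('g \<Rightarrow> 'g \<Rightarrow> 'y \<Rightarrow> complex) set" where
  "Z2_act G M \<tau> = {c. (\<forall>g \<in> carrier G. \<forall>h \<in> carrier G.
        c g h \<in> borel_measurable M \<and> (\<forall>y \<in> space M. c g h y \<in> circle)) \<and>
     (\<forall>g \<in> carrier G. \<forall>h \<in> carrier G. \<forall>k \<in> carrier G. AE y in M.
        c h k (\<tau> (inv\<^bsub>G\<^esub> g) y) * inverse (c (g \<otimes>\<^bsub>G\<^esub> h) k y) *
        c g (h \<otimes>\<^bsub>G\<^esub> k) y * inverse (c g h y) = 1)}"

definition B2_act :: "('g, 'b) monoid_scheme \<Rightarrow> 'y measure \<Rightarrow> ('g \<Rightarrow> 'y \<Rightarrow> 'y)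
                      \<Rightarrow> ('g \<Rightarrow> 'g \<Rightarrow> 'y \<Rightarrow> complex) \<Rightarrow> bool" where
  "B2_act G M \<tau> c \<longleftrightarrow> (\<exists>b :: 'g \<Rightarrow> 'y \<Rightarrow> complex.
     (\<forall>g \<in> carrier G. b g \<in> borel_measurable M \<and> (\<forall>y \<in> space M. b g y \<in> circle)) \<and>
     (\<forall>g \<in> carrier G. \<forall>h \<in> carrier G. AE y in M.
        c g h y = b g y * b h (\<tau> (inv\<^bsub>G\<^esub> g) y) * inverse (b (g \<otimes>\<^bsub>G\<^esub> h) y)))"

definition Psi2 :: "('g \<Rightarrow> 'g \<Rightarrow> complex) \<Rightarrow> ('g \<Rightarrow> 'g \<Rightarrow> 'y \<Rightarrow> complex)" where
  "Psi2 d = (\<lambda>g h x. d g h)"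

definition tilde2 :: "('g \<Rightarrow> 'g \<Rightarrow> 'x \<Rightarrow> complex) \<Rightarrow> ('g \<Rightarrow> 'g \<Rightarrow> 'x \<Rightarrow> complex)" where
  "tilde2 c = (\<lambda>g h x. c g h x)"

(* equality of classes in H^2(G\<curvearrowright>Y;T) / \<Psi>_2(H^2(G,T)):
   c and c' differ by a coboundary times an element of the image of \<Psi>_2 *)
definition eq_mod_Psi2 :: "('g, 'b) monoid_scheme \<Rightarrow> 'y measure \<Rightarrow> ('g \<Rightarrow> 'y \<Rightarrow> 'y)
          \<Rightarrow> ('g \<Rightarrow> 'g \<Rightarrow> 'y \<Rightarrow> complex) \<Rightarrow> ('g \<Rightarrow> 'g \<Rightarrow> 'y \<Rightarrow> complex) \<Rightarrow> bool" where
  "eq_mod_Psi2 G M \<tau> c c' \<longleftrightarrow> (\<exists>d \<in> Z2_T G.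
     B2_act G M \<tau> (\<lambda>g h y. c g h y / (c' g h y * Psi2 d g h y)))"

end

theory Submission
  imports Defs "Jordan_Normal_Form.Determinant"
begin

text \<open>Suppose \<open>c(g,h) = d(g,h) b(g,x) b(h,g\<^sup>-\<^sup>1x) / b(gh,x)\<close> with \<open>c\<close> character valued and \<open>d\<close>
  scalar. Then \<open>B(g,(x,y)) = b(g,x+y) / (b(g,x) b(g,y))\<close> has coboundary \<open>d\<close> on \<open>X\<^sup>2\<close>, so
  \<open>B(g,w) / B(g,w')\<close> is a 1-cocycle on \<open>X\<^sup>4\<close>. Superrigidity and ergodicity of powers give
  \<open>B(g,w) = \<rho>(g) \<phi>(w) / \<phi>(g\<^sup>-\<^sup>1w)\<close> with \<open>d\<close> the coboundary of \<open>\<rho>\<close>; the same argument on \<open>X\<close> shows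
  that \<open>\<Psi>\<^sub>2\<close> is injective. Replacing \<open>b\<close> by \<open>b \<rho>\<close> removes \<open>d\<close>, and then \<open>b(g,-)\<close> fails to be
  multiplicative only by \<open>\<phi>(x,y) / \<phi>(g\<^sup>-\<^sup>1x,g\<^sup>-\<^sup>1y)\<close>. By ergodicity on \<open>X\<^sup>3\<close>, \<open>\<phi>\<close> is a measurable
  2-cocycle of the group \<open>X\<close> up to a constant. A finite-dimensional projective representation of \<open>X\<close> with
  multiplier \<open>\<phi>\<close>, cut out of \<open>L\<^sup>2(X)\<close> by a spectral projection of an intertwining integral operator,
  has a determinant \<open>D\<close> that trivialises some power \<open>\<phi>\<^sup>n\<close>. Correcting \<open>b\<^sup>n\<close> by \<open>D\<close> gives almost
  everywhere multiplicative functions, i.e. characters with coboundary \<open>c\<^sup>n\<close>, and torsion freeness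
  finishes the proof.\<close>

text \<open>The scalar \<open>d\<close> keeps \<open>B\<close> from being a 1-cocycle. Comparing two
  copies of \<open>B\<close> cancels \<open>d\<close>, and this doubling is why X^2 enters for
  scalar classes and X^4 for character valued ones. The real obstacle is that the multiplier
  \<open>\<phi>\<close> need not be a coboundary on X: already the group of order four and exponent
  two has a nontrivial one. An n-dimensional projective representation only controls
  \<open>\<phi>\<close> to the power n, since a scalar enters the determinant n times; this is the
  origin of the exponent and the point where torsion freeness is spent. Finite dimension comes from
  X having finite measure: a bounded kernel is then Hilbert-Schmidt, and a projection with bounded
  kernel has finite trace. The scalar \<open>C\<close> left over by ergodicity is harmless. It
  cancels when the intertwiner is multiplied by its adjoint, and what survives in
  \<open>\<phi> w ^ n\<close> is a constant that cancels between w and its translate. Since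
  \<open>\<phi>\<close> is known only almost everywhere, exact statements are recovered at the end
  from the rigidity of characters under translation.\<close>

lemma borel_measurable_cnj [measurable]: "cnj \<in> borel_measurable borel"
  by (intro borel_measurable_continuous_onI continuous_intros)

text \<open>The sets over which \<open>f\<close> integrates to zero form a Dynkin system, the
  vanishing total integral taking care of complements. Applied to rectangles in
  \<open>kernel_zero\<close> and to closed sets in \<open>exists_continuous_test\<close>.\<close>

lemma (in sigma_finite_measure) AE_zero_of_generator:
  fixes f :: "'a \<Rightarrow> complex"
  assumes f: "integrable M f"
    and G: "Int_stable G" "G \<subseteq> Pow (space M)" "sets M = sigma_sets (space M) G"
    and zero: "\<And>A. A \<in> G \<Longrightarrow> (LINT x:A|M. f x) = 0" "integral\<^sup>L M f = 0"
  shows "AE x in M. f x = 0"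
proof (rule density_zero[OF f])
  fix A assume "A \<in> sets M"
  then have "A \<in> sigma_sets (space M) G" using G by simp
  with G(1,2) show "(LINT x:A|M. f x) = 0"
  proof (induct rule: sigma_sets_induct_disjoint)
    case (basic A) then show ?case using zero by simp
  next
    case empty then show ?case by (simp add: set_lebesgue_integral_def)
  next
    case (compl A)
    then have A: "A \<in> sets M" using G by simp
    have "(LINT x:space M|M. f x) = (LINT x:(A \<union> (space M - A))|M. f x)"
      using sets.sets_into_space[OF A] by (simp add: Un_absorb1)
    also have "\<dots> = (LINT x:A|M. f x) + (LINT x:space M - A|M. f x)"
      using A f by (intro set_integral_Un) (auto simp: set_integrable_def intro: integrable_mult_indicator)
    finally show ?case using compl zero set_integral_space[OF f] by simp
  next
    case (union A)
    then have A: "\<And>i. A i \<in> sets M" using G by auto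
    have "(LINT x:(\<Union>i. A i)|M. f x) = (\<Sum>i. (LINT x:(A i)|M. f x))"
      using A union f by (intro lebesgue_integral_countable_add)
        (auto simp: set_integrable_def disjoint_family_on_def intro!: integrable_mult_indicator)
    then show ?case using union by simp
  qed
qed

text \<open>In operator terms, T vanishes as soon as the product of T with its adjoint does. Testing
  that product against the indicator of a set \<open>C\<close> yields a squared norm, so
  \<open>T\<close> integrates to zero over every rectangle.\<close>

lemma (in pair_prob_space) kernel_zero:
  fixes T :: "'a \<times> 'b \<Rightarrow> complex"
  assumes T[measurable]: "T \<in> borel_measurable (M1 \<Otimes>\<^sub>M M2)" and B: "\<And>w. norm (T w) \<le> B"
    and zero: "AE w in M1 \<Otimes>\<^sub>M M1. (\<integral>z. T (fst w, z) * cnj (T (snd w, z)) \<partial>M2) = 0"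
  shows "AE w in M1 \<Otimes>\<^sub>M M2. T w = 0"
proof -
  interpret Q: pair_prob_space M1 M1 ..
  interpret R: pair_prob_space "M1 \<Otimes>\<^sub>M M1" M2 ..
  have B0: "0 \<le> B" using B[of undefined] norm_ge_zero order_trans by blast
  have intT: "integrable (M1 \<Otimes>\<^sub>M M2) T"
    by (rule P.integrable_const_bound[where B=B]) (use B in auto)
  have rect: "(LINT w:C \<times> D|M1 \<Otimes>\<^sub>M M2. T w) = 0" if C[measurable]: "C \<in> sets M1" and D[measurable]: "D \<in> sets M2" for C D
  proof -
    define S where "S z = (\<integral>x. indicator C x *\<^sub>R T (x, z) \<partial>M1)" for z
    have [measurable]: "S \<in> borel_measurable M2" unfolding S_def by measurable
    have nS: "norm (S z) \<le> B" if "z \<in> space M2" for z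
    proof -
      have "norm (S z) \<le> (\<integral>x. norm (indicator C x *\<^sub>R T (x, z)) \<partial>M1)" unfolding S_def
        by (rule integral_norm_bound)
      also have "\<dots> \<le> (\<integral>x. B \<partial>M1)"
        using that B0 B by (intro integral_mono M1.integrable_const_bound[where B=B])
          (auto split: split_indicator)
      finally show ?thesis by (simp add: M1.prob_space)
    qed
    have eqS: "S z * cnj (S z) = (\<integral>w. indicator (C \<times> C) w *\<^sub>R (T (fst w, z) * cnj (T (snd w, z))) \<partial>(M1 \<Otimes>\<^sub>M M1))"
      if z: "z \<in> space M2" for z
    proof -
      have [measurable]: "(\<lambda>x. T (x, z)) \<in> borel_measurable M1"
        using z by measurable
      have [measurable]: "(\<lambda>w. T (fst w, z)) \<in> borel_measurable (M1 \<Otimes>\<^sub>M M1)"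
        using measurable_compose[OF measurable_fst \<open>(\<lambda>x. T (x, z)) \<in> _\<close>] .
      have [measurable]: "(\<lambda>w. T (snd w, z)) \<in> borel_measurable (M1 \<Otimes>\<^sub>M M1)"
        using measurable_compose[OF measurable_snd \<open>(\<lambda>x. T (x, z)) \<in> _\<close>] .
      have m: "(\<lambda>w. indicator (C \<times> C) w *\<^sub>R (T (fst w, z) * cnj (T (snd w, z)))) \<in> borel_measurable (M1 \<Otimes>\<^sub>M M1)"
        by (intro borel_measurable_scaleR borel_measurable_times borel_measurable_indicator measurable_compose[OF _ borel_measurable_cnj] pair_measureI C) fact+
      have "integrable (M1 \<Otimes>\<^sub>M M1) (\<lambda>w. indicator (C \<times> C) w *\<^sub>R (T (fst w, z) * cnj (T (snd w, z))))"
        by (rule Q.P.integrable_const_bound[where B="B * B"])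
           (auto simp: norm_mult B B0 intro!: mult_mono m split: split_indicator)
      then have "(\<integral>w. indicator (C \<times> C) w *\<^sub>R (T (fst w, z) * cnj (T (snd w, z))) \<partial>(M1 \<Otimes>\<^sub>M M1))
        = (\<integral>x. (\<integral>y. (indicator C x *\<^sub>R T (x, z)) * cnj (indicator C y *\<^sub>R T (y, z)) \<partial>M1) \<partial>M1)"
        by (subst Q.integral_fst'[symmetric], assumption)
          (intro Bochner_Integration.integral_cong refl, simp add: indicator_times scaleR_conv_of_real)
      also have "\<dots> = S z * cnj (S z)"
        unfolding S_def by (simp only: integral_mult_right_zero integral_mult_left_zero Bochner_Integration.integral_cnj)
      finally show ?thesis by simp
    qed
    \<comment> \<open>Fubini turns the squared norm of \<open>S\<close> into an integral over
      \<open>C \<times> C\<close> of the kernel assumed to vanish.\<close>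
    have "(\<integral>z. S z * cnj (S z) \<partial>M2) = (\<integral>z. (\<integral>w. indicator (C \<times> C) w *\<^sub>R (T (fst w, z) * cnj (T (snd w, z))) \<partial>(M1 \<Otimes>\<^sub>M M1)) \<partial>M2)"
      using eqS by (intro Bochner_Integration.integral_cong) auto
    also have "\<dots> = (\<integral>w. (\<integral>z. indicator (C \<times> C) w *\<^sub>R (T (fst w, z) * cnj (T (snd w, z))) \<partial>M2) \<partial>(M1 \<Otimes>\<^sub>M M1))"
      by (rule R.Fubini_integral, rule R.P.integrable_const_bound[where B="B * B"])
         (auto simp: norm_mult B B0 split_beta' intro!: mult_mono split: split_indicator)
    also have "\<dots> = 0"
      using zero by (intro integral_eq_zero_AE) auto
    finally have "(\<integral>z. complex_of_real ((norm (S z))\<^sup>2) \<partial>M2) = 0"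
      by (simp only: of_real_power complex_norm_square[symmetric])
    then have "(\<integral>z. (norm (S z))\<^sup>2 \<partial>M2) = 0"
      unfolding integral_complex_of_real by simp
    moreover have "integrable M2 (\<lambda>z. (norm (S z))\<^sup>2)"
      by (rule M2.integrable_const_bound[where B="B\<^sup>2"]) (auto intro!: power_mono nS)
    ultimately have S0: "AE z in M2. S z = 0"
      by (subst (asm) integral_nonneg_eq_0_iff_AE) auto
    have i: "integrable (M1 \<Otimes>\<^sub>M M2) (\<lambda>(x,z). indicator D z *\<^sub>R (indicator C x *\<^sub>R T (x, z)))"
      by (rule P.integrable_const_bound[where B=B]) (use B B0 in \<open>auto split: split_indicator\<close>)
    have "(LINT w:C \<times> D|M1 \<Otimes>\<^sub>M M2. T w) = (\<integral>(x,z). indicator D z *\<^sub>R (indicator C x *\<^sub>R T (x, z)) \<partial>(M1 \<Otimes>\<^sub>M M2))"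
      unfolding set_lebesgue_integral_def by (rule Bochner_Integration.integral_cong) (auto simp: indicator_def)
    also have "\<dots> = (\<integral>z. (\<integral>x. indicator D z *\<^sub>R (indicator C x *\<^sub>R T (x, z)) \<partial>M1) \<partial>M2)"
      using integral_snd[OF i] by simp
    also have "\<dots> = (\<integral>z. indicator D z *\<^sub>R S z \<partial>M2)"
      unfolding S_def by (simp only: integral_scaleR_right)
    also have "\<dots> = 0" using S0 by (intro integral_eq_zero_AE) auto
    finally show ?thesis .
  qed
  show ?thesis
  proof (rule P.AE_zero_of_generator[OF intT Int_stable_pair_measure_generator[of M1 M2]])
    show "{a \<times> b |a b. a \<in> sets M1 \<and> b \<in> sets M2} \<subseteq> Pow (space (M1 \<Otimes>\<^sub>M M2))"
      using pair_measure_closed[of M1 M2] by (simp add: space_pair_measure)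
    show "sets (M1 \<Otimes>\<^sub>M M2) = sigma_sets (space (M1 \<Otimes>\<^sub>M M2)) {a \<times> b |a b. a \<in> sets M1 \<and> b \<in> sets M2}"
      by (simp add: sets_pair_measure space_pair_measure)
    show "integral\<^sup>L (M1 \<Otimes>\<^sub>M M2) T = 0"
      using rect[of "space M1" "space M2"] set_integral_space[OF intT] by (simp add: space_pair_measure)
  qed (use rect in auto)
qed

section \<open>Kernels on a probability space\<close>

text \<open>The squared norm of \<open>f - t * g\<close> is a nonnegative quadratic polynomial in
  \<open>t\<close>; its value at \<open>t = C / B\<close> is the inequality.\<close>

lemma Cauchy_Schwarz_integral:
  fixes f g :: "'a \<Rightarrow> real"
  assumes f: "integrable M (\<lambda>x. (f x)\<^sup>2)" and g: "integrable M (\<lambda>x. (g x)\<^sup>2)"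
    and fg: "integrable M (\<lambda>x. f x * g x)"
  shows "(\<integral>x. f x * g x \<partial>M)\<^sup>2 \<le> (\<integral>x. (f x)\<^sup>2 \<partial>M) * (\<integral>x. (g x)\<^sup>2 \<partial>M)"
proof -
  define A where "A = (\<integral>x. (f x)\<^sup>2 \<partial>M)"
  define B where "B = (\<integral>x. (g x)\<^sup>2 \<partial>M)"
  define C where "C = (\<integral>x. f x * g x \<partial>M)"
  have "A - 2 * t * C + t\<^sup>2 * B \<ge> 0" for t
  proof -
    have "0 \<le> (\<integral>x. (f x - t * g x)\<^sup>2 \<partial>M)" by simp
    also have "\<dots> = (\<integral>x. (f x)\<^sup>2 - 2 * t * (f x * g x) + t\<^sup>2 * (g x)\<^sup>2 \<partial>M)"
      by (simp add: power2_eq_square algebra_simps)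
    also have "\<dots> = A - 2 * t * C + t\<^sup>2 * B"
      unfolding A_def B_def C_def using f g fg by simp
    finally show ?thesis .
  qed
  note * = this
  have B: "B \<ge> 0" "A \<ge> 0" by (simp_all add: B_def A_def)
  show ?thesis
  proof (cases "B = 0")
    case True
    have "C = 0"
    proof (rule ccontr)
      \<comment> \<open>With \<open>B = 0\<close> the polynomial is affine in \<open>t\<close>, and
        the chosen \<open>t\<close> gives it the negative value \<open>- A - 2\<close>.\<close>
      assume "C \<noteq> 0"
      have "A - 2 * ((A + 1) / C) * C \<ge> 0" using *[of "(A + 1) / C"] True by simp
      then show False using \<open>C \<noteq> 0\<close> B by simp
    qed
    then show ?thesis using B by (simp add: C_def[symmetric] A_def[symmetric] B_def[symmetric])
  next
    case False
    then have "B > 0" using B by simp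
    then have "A - C\<^sup>2 / B \<ge> 0" using *[of "C / B"]
      by (simp add: power2_eq_square field_simps)
    then show ?thesis using \<open>B > 0\<close> by (simp add: C_def[symmetric] A_def[symmetric] B_def[symmetric] field_simps)
  qed
qed

text \<open>Kernels are functions bounded at every point, not classes modulo null sets, because they
  are later restricted to diagonals and to single rows and columns.\<close>

definition bounded_kernel :: "'a measure \<Rightarrow> ('a \<times> 'a \<Rightarrow> complex) \<Rightarrow> real \<Rightarrow> bool" where
  "bounded_kernel M K B \<longleftrightarrow> K \<in> borel_measurable (M \<Otimes>\<^sub>M M) \<and> (\<forall>w. norm (K w) \<le> B)"

definition kcomp :: "'a measure \<Rightarrow> ('a \<times> 'a \<Rightarrow> complex) \<Rightarrow> ('a \<times> 'a \<Rightarrow> complex) \<Rightarrow> 'a \<times> 'a \<Rightarrow> complex" where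
  "kcomp M K L = (\<lambda>w. \<integral>z. K (fst w, z) * L (z, snd w) \<partial>M)"

definition hermitian :: "('a \<times> 'a \<Rightarrow> complex) \<Rightarrow> bool" where
  "hermitian K \<longleftrightarrow> (\<forall>x t. K (t, x) = cnj (K (x, t)))"

text \<open>The diagonal may be a null set, so this is no invariant of the almost everywhere class.
  It is meaningful for compositions and for kernels that satisfy \<open>kcomp M p p = p\<close> at
  every point.\<close>

definition ktrace :: "'a measure \<Rightarrow> ('a \<times> 'a \<Rightarrow> complex) \<Rightarrow> complex" where
  "ktrace M K = (\<integral>x. K (x, x) \<partial>M)"

text \<open>Powers are shifted: \<open>kpow M K n\<close> is the \<open>(n+1)\<close>-fold product of \<open>K\<close>.\<close>
primrec kpow :: "'a measure \<Rightarrow> ('a \<times> 'a \<Rightarrow> complex) \<Rightarrow> nat \<Rightarrow> 'a \<times> 'a \<Rightarrow> complex" where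
  "kpow M K 0 = K"
| "kpow M K (Suc n) = kcomp M K (kpow M K n)"

text \<open>The square of the Hilbert-Schmidt norm of the integral operator with kernel
  \<open>K\<close>.\<close>

definition hs :: "'a measure \<Rightarrow> ('a \<times> 'a \<Rightarrow> complex) \<Rightarrow> real" where
  "hs M K = (\<integral>w. (norm (K w))\<^sup>2 \<partial>(M \<Otimes>\<^sub>M M))"

locale kernel_space = prob_space M for M :: "'a measure" +
  assumes space_UNIV: "space M = UNIV"
begin

sublocale Q: pair_prob_space M M ..

lemma bounded_kernelD:
  assumes "bounded_kernel M K B"
  shows "K \<in> borel_measurable (M \<Otimes>\<^sub>M M)" "norm (K w) \<le> B" "0 \<le> B"
  using assms norm_ge_zero[of "K undefined"] order_trans unfolding bounded_kernel_def by blast+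

lemma section_measurable:
  assumes "K \<in> borel_measurable (M \<Otimes>\<^sub>M M)"
  shows "(\<lambda>z. K (x, z)) \<in> borel_measurable M" "(\<lambda>z. K (z, x)) \<in> borel_measurable M"
    "(\<lambda>z. K (z, z)) \<in> borel_measurable M"
  using space_UNIV by (auto intro!: measurable_compose[OF _ assms] measurable_Pair measurable_ident_sets[OF refl])

lemma bounded_integrable:
  fixes f :: "'a \<Rightarrow> complex"
  assumes "f \<in> borel_measurable M" "\<And>x. norm (f x) \<le> B"
  shows "integrable M f"
  using assms by (intro integrable_const_bound[where B=B]) auto

lemma bounded_integrable2:
  fixes f :: "'a \<times> 'a \<Rightarrow> complex"
  assumes "f \<in> borel_measurable (M \<Otimes>\<^sub>M M)" "\<And>x. norm (f x) \<le> B"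
  shows "integrable (M \<Otimes>\<^sub>M M) f"
  using assms by (intro Q.P.integrable_const_bound[where B=B]) auto

lemma kcomp_bounded:
  assumes K: "bounded_kernel M K B" and L: "bounded_kernel M L C"
  shows "bounded_kernel M (kcomp M K L) (B * C)"
proof -
  note [measurable] = bounded_kernelD(1)[OF K] bounded_kernelD(1)[OF L]
  have "norm (kcomp M K L w) \<le> B * C" for w
  proof -
    have "norm (kcomp M K L w) \<le> (\<integral>z. norm (K (fst w, z) * L (z, snd w)) \<partial>M)"
      unfolding kcomp_def by (rule integral_norm_bound)
    also have "\<dots> \<le> (\<integral>z. B * C \<partial>M)"
      using bounded_kernelD[OF K] bounded_kernelD[OF L]
      by (intro integral_mono integrable_const_bound[where B="B * C"])
        (auto simp: norm_mult space_UNIV section_measurable intro!: mult_mono borel_measurable_norm borel_measurable_times)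
    finally show ?thesis by (simp add: prob_space)
  qed
  then show ?thesis unfolding bounded_kernel_def by (simp add: kcomp_def)
qed

lemma kcomp_integrable:
  assumes K: "bounded_kernel M K B" and L: "bounded_kernel M L C"
  shows "integrable M (\<lambda>z. K (x, z) * L (z, t))"
  using bounded_kernelD[OF K] bounded_kernelD[OF L]
  by (intro bounded_integrable[where B="B * C"])
     (auto simp: norm_mult section_measurable intro!: mult_mono borel_measurable_times)

text \<open>Equality holds at every point because Fubini is applied with the outer variables
  \<open>x\<close> and \<open>t\<close> frozen.\<close>

lemma kcomp_assoc:
  assumes K: "bounded_kernel M K B" and L: "bounded_kernel M L C" and N: "bounded_kernel M N D"
  shows "kcomp M (kcomp M K L) N = kcomp M K (kcomp M L N)"
proof
  fix w :: "'a \<times> 'a"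
  obtain x t where w: "w = (x, t)" by force
  note m = bounded_kernelD(1)[OF K] bounded_kernelD(1)[OF L] bounded_kernelD(1)[OF N]
  note [measurable] = m section_measurable[OF m(1)] section_measurable[OF m(2)] section_measurable[OF m(3)]
  have i: "integrable (M \<Otimes>\<^sub>M M) (\<lambda>(y, z). K (x, z) * L (z, y) * N (y, t))"
    by (rule bounded_integrable2[where B="B * C * D"])
       (auto simp: norm_mult split_beta' bounded_kernelD[OF K] bounded_kernelD[OF L] bounded_kernelD[OF N]
         intro!: mult_mono mult_nonneg_nonneg bounded_kernelD(3)[OF K] bounded_kernelD(3)[OF L])
  have "kcomp M (kcomp M K L) N w = (\<integral>y. (\<integral>z. K (x, z) * L (z, y) * N (y, t) \<partial>M) \<partial>M)"
    unfolding kcomp_def w fst_conv snd_conv integral_mult_left_zero ..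
  also have "\<dots> = (\<integral>z. (\<integral>y. K (x, z) * L (z, y) * N (y, t) \<partial>M) \<partial>M)"
    using Q.Fubini_integral[OF i] by simp
  also have "\<dots> = kcomp M K (kcomp M L N) w"
    unfolding kcomp_def w fst_conv snd_conv mult.assoc integral_mult_right_zero ..
  finally show "kcomp M (kcomp M K L) N w = kcomp M K (kcomp M L N) w" .
qed

lemma kpow_bounded:
  assumes "bounded_kernel M K B"
  shows "bounded_kernel M (kpow M K n) (B ^ Suc n)"
proof (induct n)
  case 0 then show ?case using assms by simp
next
  case (Suc n) then show ?case using kcomp_bounded[OF assms Suc] by simp
qed

lemma kcomp_kpow:
  assumes K: "bounded_kernel M K B"
  shows "kcomp M (kpow M K i) (kpow M K j) = kpow M K (Suc (i + j))"
proof (induct i)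
  case 0 then show ?case by simp
next
  case (Suc i)
  then show ?case using kcomp_assoc[OF K kpow_bounded[OF K, of i] kpow_bounded[OF K, of j]] by simp
qed

lemma hermitianD: "hermitian K \<Longrightarrow> cnj (K (x, t)) = K (t, x)"
  unfolding hermitian_def by (metis complex_cnj_cancel_iff)

lemma hermitian_kcomp:
  assumes "hermitian K" "hermitian L" "kcomp M K L = kcomp M L K"
  shows "hermitian (kcomp M K L)"
  unfolding hermitian_def
proof (intro allI)
  fix x t
  have "cnj (kcomp M L K (x, t)) = (\<integral>z. K (t, z) * L (z, x) \<partial>M)"
    unfolding kcomp_def fst_conv snd_conv Bochner_Integration.integral_cnj[symmetric] complex_cnj_mult
      hermitianD[OF assms(1)] hermitianD[OF assms(2)] by (rule Bochner_Integration.integral_cong) auto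
  then show "kcomp M K L (t, x) = cnj (kcomp M K L (x, t))" unfolding assms(3)[symmetric] by (simp add: kcomp_def)
qed

lemma hermitian_kpow:
  assumes K: "bounded_kernel M K B" "hermitian K"
  shows "hermitian (kpow M K n)"
proof (induct n)
  case 0 then show ?case using K by simp
next
  case (Suc n)
  show ?case using hermitian_kcomp[OF K(2) Suc] kcomp_kpow[OF K(1), of 0 n] kcomp_kpow[OF K(1), of n 0] by simp
qed

section \<open>Trace and Hilbert-Schmidt norm\<close>

text \<open>Hermitian symmetry makes the trace of a product an inner product. Consequently the inner
  product of two powers of one Hermitian kernel depends only on the sum of the exponents.\<close>

lemma ktrace_kcomp:
  assumes K: "bounded_kernel M K B" and L: "bounded_kernel M L C" "hermitian L"
  shows "ktrace M (kcomp M K L) = (\<integral>w. K w * cnj (L w) \<partial>(M \<Otimes>\<^sub>M M))"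
proof -
  note [measurable] = bounded_kernelD(1)[OF K] bounded_kernelD(1)[OF L(1)]
  have i: "integrable (M \<Otimes>\<^sub>M M) (\<lambda>w. K w * cnj (L w))"
    by (rule bounded_integrable2[where B="B * C"])
       (auto simp: norm_mult bounded_kernelD[OF K] bounded_kernelD[OF L(1)] intro!: mult_mono)
  have "ktrace M (kcomp M K L) = (\<integral>x. (\<integral>z. K (x, z) * cnj (L (x, z)) \<partial>M) \<partial>M)"
    unfolding ktrace_def kcomp_def hermitianD[OF L(2)] by simp
  also have "\<dots> = (\<integral>w. K w * cnj (L w) \<partial>(M \<Otimes>\<^sub>M M))"
    using Q.integral_fst'[OF i] by simp
  finally show ?thesis .
qed

lemma hs_eq: "(\<integral>w. K w * cnj (K w) \<partial>(M \<Otimes>\<^sub>M M)) = complex_of_real (hs M K)"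
  unfolding hs_def integral_complex_of_real[symmetric] complex_norm_square ..

lemma hs_nonneg: "0 \<le> hs M K" by (simp add: hs_def)

lemma norm_sq_integrable:
  assumes K: "bounded_kernel M K B"
  shows "integrable (M \<Otimes>\<^sub>M M) (\<lambda>w. (norm (K w))\<^sup>2)"
proof -
  note [measurable] = bounded_kernelD(1)[OF K]
  show ?thesis
    by (rule Q.P.integrable_const_bound[where B="B\<^sup>2"]) (auto intro!: power_mono bounded_kernelD[OF K])
qed

lemma hs_ip_bound:
  assumes K: "bounded_kernel M K B" and L: "bounded_kernel M L C"
  shows "(norm (\<integral>w. K w * cnj (L w) \<partial>(M \<Otimes>\<^sub>M M)))\<^sup>2 \<le> hs M K * hs M L"
proof -
  note [measurable] = bounded_kernelD(1)[OF K] bounded_kernelD(1)[OF L]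
  have i: "integrable (M \<Otimes>\<^sub>M M) (\<lambda>w. norm (K w) * norm (L w))"
    by (rule Q.P.integrable_const_bound[where B="B * C"])
       (auto simp: bounded_kernelD[OF K] bounded_kernelD[OF L] intro!: mult_mono)
  have "norm (\<integral>w. K w * cnj (L w) \<partial>(M \<Otimes>\<^sub>M M)) \<le> (\<integral>w. norm (K w * cnj (L w)) \<partial>(M \<Otimes>\<^sub>M M))"
    by (rule integral_norm_bound)
  also have "\<dots> = (\<integral>w. norm (K w) * norm (L w) \<partial>(M \<Otimes>\<^sub>M M))" by (simp add: norm_mult)
  finally have "(norm (\<integral>w. K w * cnj (L w) \<partial>(M \<Otimes>\<^sub>M M)))\<^sup>2 \<le> (\<integral>w. norm (K w) * norm (L w) \<partial>(M \<Otimes>\<^sub>M M))\<^sup>2"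
    by (intro power_mono) auto
  also have "\<dots> \<le> hs M K * hs M L"
    unfolding hs_def by (intro Cauchy_Schwarz_integral norm_sq_integrable[OF K] norm_sq_integrable[OF L] i)
  finally show ?thesis .
qed

text \<open>Cauchy-Schwarz in the middle variable bounds a squared entry by a row norm times a
  column norm, \<open>F x * H t\<close>, and the integral of this product factorises.\<close>

lemma hs_kcomp_le:
  assumes K: "bounded_kernel M K B" and L: "bounded_kernel M L C"
  shows "hs M (kcomp M K L) \<le> hs M K * hs M L"
proof -
  note m = bounded_kernelD(1)[OF K] bounded_kernelD(1)[OF L]
  note [measurable] = m section_measurable[OF m(1)] section_measurable[OF m(2)]
  define F where "F x = (\<integral>z. (norm (K (x, z)))\<^sup>2 \<partial>M)" for x
  define H where "H t = (\<integral>z. (norm (L (z, t)))\<^sup>2 \<partial>M)" for t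
  have [measurable]: "F \<in> borel_measurable M" "H \<in> borel_measurable M" unfolding F_def H_def by measurable
  have iK: "integrable M (\<lambda>z. (norm (K (x, z)))\<^sup>2)" for x
    by (rule integrable_const_bound[where B="B\<^sup>2"]) (auto intro!: power_mono bounded_kernelD[OF K])
  have iL: "integrable M (\<lambda>z. (norm (L (z, t)))\<^sup>2)" for t
    by (rule integrable_const_bound[where B="C\<^sup>2"]) (auto intro!: power_mono bounded_kernelD[OF L])
  have pt: "(norm (kcomp M K L (x, t)))\<^sup>2 \<le> F x * H t" for x t
  proof -
    have i: "integrable M (\<lambda>z. norm (K (x, z)) * norm (L (z, t)))"
      by (rule integrable_const_bound[where B="B * C"])
         (auto simp: bounded_kernelD[OF K] bounded_kernelD[OF L] intro!: mult_mono)
    have "norm (kcomp M K L (x, t)) \<le> (\<integral>z. norm (K (x, z) * L (z, t)) \<partial>M)"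
      unfolding kcomp_def fst_conv snd_conv by (rule integral_norm_bound)
    also have "\<dots> = (\<integral>z. norm (K (x, z)) * norm (L (z, t)) \<partial>M)" by (simp add: norm_mult)
    finally have "(norm (kcomp M K L (x, t)))\<^sup>2 \<le> (\<integral>z. norm (K (x, z)) * norm (L (z, t)) \<partial>M)\<^sup>2"
      by (intro power_mono) auto
    also have "\<dots> \<le> F x * H t"
      unfolding F_def H_def by (intro Cauchy_Schwarz_integral iK iL i)
    finally show ?thesis .
  qed
  have bF: "norm (F x) \<le> B\<^sup>2" for x
  proof -
    have "F x \<le> (\<integral>z. B\<^sup>2 \<partial>M)" unfolding F_def
      by (intro integral_mono iK) (auto intro!: power_mono bounded_kernelD[OF K])
    moreover have "0 \<le> F x" by (simp add: F_def)
    ultimately show ?thesis by (simp add: prob_space)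
  qed
  have bH: "norm (H x) \<le> C\<^sup>2" for x
  proof -
    have "H x \<le> (\<integral>z. C\<^sup>2 \<partial>M)" unfolding H_def
      by (intro integral_mono iL) (auto intro!: power_mono bounded_kernelD[OF L])
    moreover have "0 \<le> H x" by (simp add: H_def)
    ultimately show ?thesis by (simp add: prob_space)
  qed
  have i: "integrable (M \<Otimes>\<^sub>M M) (\<lambda>w. F (fst w) * H (snd w))"
    by (rule Q.P.integrable_const_bound[where B="B\<^sup>2 * C\<^sup>2"])
       (use bF bH in \<open>auto simp: abs_mult intro!: mult_mono\<close>)
  have "hs M (kcomp M K L) \<le> (\<integral>w. F (fst w) * H (snd w) \<partial>(M \<Otimes>\<^sub>M M))"
    unfolding hs_def using pt by (intro integral_mono norm_sq_integrable[OF kcomp_bounded[OF K L]] i) auto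
  also have "\<dots> = (\<integral>x. (\<integral>t. F x * H t \<partial>M) \<partial>M)"
    using Q.integral_fst'[OF i] by simp
  also have "\<dots> = (\<integral>x. F x \<partial>M) * (\<integral>t. H t \<partial>M)" by simp
  also have "(\<integral>x. F x \<partial>M) = hs M K"
    unfolding F_def hs_def using Q.integral_fst'[OF norm_sq_integrable[OF K]] by simp
  also have "(\<integral>t. H t \<partial>M) = hs M L"
    unfolding H_def hs_def using Q.integral_snd[of "\<lambda>x y. (norm (L (x, y)))\<^sup>2"] norm_sq_integrable[OF L] by (simp add: split_beta')
  finally show ?thesis .
qed

lemma adjoint_bounded:
  assumes T: "bounded_kernel M T B"
  shows "bounded_kernel M (\<lambda>w. cnj (T (snd w, fst w))) B"
proof -
  note [measurable] = bounded_kernelD(1)[OF T]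
  show ?thesis unfolding bounded_kernel_def by (auto simp: bounded_kernelD[OF T])
qed

lemma hermitian_kcomp_adjoint: "hermitian (kcomp M T (\<lambda>w. cnj (T (snd w, fst w))))"
  unfolding hermitian_def kcomp_def Bochner_Integration.integral_cnj[symmetric]
  by (auto intro!: Bochner_Integration.integral_cong)

text \<open>Rests on \<open>kernel_zero\<close>; it ensures that power iteration starts from a
  nonzero Hermitian kernel.\<close>

lemma hs_kcomp_adjoint_pos:
  assumes T: "bounded_kernel M T B" and pos: "hs M T > 0"
  shows "hs M (kcomp M T (\<lambda>w. cnj (T (snd w, fst w)))) > 0"
proof (rule ccontr)
  let ?K = "kcomp M T (\<lambda>w. cnj (T (snd w, fst w)))"
  assume "\<not> ?thesis"
  then have "hs M ?K = 0" using hs_nonneg[of ?K] by linarith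
  then have "AE w in M \<Otimes>\<^sub>M M. ?K w = 0"
    unfolding hs_def using norm_sq_integrable[OF kcomp_bounded[OF T adjoint_bounded[OF T]]]
    by (subst (asm) integral_nonneg_eq_0_iff_AE) auto
  then have "AE w in M \<Otimes>\<^sub>M M. (\<integral>z. T (fst w, z) * cnj (T (snd w, z)) \<partial>M) = 0"
    by (simp add: kcomp_def)
  from Q.kernel_zero[OF bounded_kernelD(1)[OF T] bounded_kernelD(2)[OF T] this]
  have "hs M T = 0" unfolding hs_def by (intro integral_eq_zero_AE) auto
  then show False using pos by simp
qed

lemma hs_kcomp_self_pos:
  assumes K: "bounded_kernel M K B" "hermitian K" and pos: "hs M K > 0"
  shows "hs M (kcomp M K K) > 0"
  using hs_kcomp_adjoint_pos[OF K(1) pos] by (simp add: hermitianD[OF K(2)])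

lemma kcomp_scale:
  "kcomp M (\<lambda>w. c * K w) (\<lambda>w. d * L w) = (\<lambda>w. c * d * kcomp M K L w)"
proof
  fix w
  have "kcomp M (\<lambda>w. c * K w) (\<lambda>w. d * L w) w = (\<integral>z. (c * d) * (K (fst w, z) * L (z, snd w)) \<partial>M)"
    unfolding kcomp_def by (rule Bochner_Integration.integral_cong) (auto simp: mult_ac)
  also have "\<dots> = c * d * kcomp M K L w" unfolding kcomp_def by (rule integral_mult_right_zero)
  finally show "kcomp M (\<lambda>w. c * K w) (\<lambda>w. d * L w) w = c * d * kcomp M K L w" .
qed

text \<open>An entry of K D K is the inner product of \<open>D\<close> with a rank-one kernel
  bounded by \<open>B\<^sup>2\<close>. Smallness in mean square thus becomes uniform smallness after
  sandwiching.\<close>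

lemma kcomp_sandwich_bound:
  assumes K: "bounded_kernel M K B" and D: "bounded_kernel M D C"
  shows "norm (kcomp M (kcomp M K D) K w) \<le> B\<^sup>2 * sqrt (hs M D)"
proof -
  obtain x t where w: "w = (x, t)" by force
  note m = bounded_kernelD(1)[OF K] bounded_kernelD(1)[OF D]
  note [measurable] = m section_measurable[OF m(1)] section_measurable[OF m(2)]
  define E where "E v = cnj (K (x, fst v) * K (snd v, t))" for v
  have E: "bounded_kernel M E (B\<^sup>2)"
    unfolding bounded_kernel_def E_def
    by (auto simp: norm_mult power2_eq_square bounded_kernelD[OF K] intro!: mult_mono)
  have i: "integrable (M \<Otimes>\<^sub>M M) (\<lambda>(z, y). K (x, z) * D (z, y) * K (y, t))"
    by (rule bounded_integrable2[where B="B * C * B"])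
       (auto simp: norm_mult split_beta' bounded_kernelD[OF K] bounded_kernelD[OF D]
         intro!: mult_mono mult_nonneg_nonneg bounded_kernelD(3)[OF K] bounded_kernelD(3)[OF D])
  have "kcomp M (kcomp M K D) K w = (\<integral>y. (\<integral>z. K (x, z) * D (z, y) * K (y, t) \<partial>M) \<partial>M)"
    unfolding kcomp_def w fst_conv snd_conv integral_mult_left_zero ..
  also have "\<dots> = (\<integral>v. D v * cnj (E v) \<partial>(M \<Otimes>\<^sub>M M))"
    using Q.integral_snd[OF i] by (simp add: E_def split_beta' mult_ac)
  finally have "(norm (kcomp M (kcomp M K D) K w))\<^sup>2 \<le> hs M D * hs M E"
    using hs_ip_bound[OF D E] by simp
  have E2: "(norm (E v))\<^sup>2 \<le> (B\<^sup>2)\<^sup>2" for v by (intro power_mono bounded_kernelD[OF E]) auto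
  note \<open>(norm (kcomp M (kcomp M K D) K w))\<^sup>2 \<le> hs M D * hs M E\<close>
  also have "hs M E \<le> (\<integral>w. (B\<^sup>2)\<^sup>2 \<partial>(M \<Otimes>\<^sub>M M))"
    unfolding hs_def by (intro integral_mono norm_sq_integrable[OF E] Q.P.integrable_const E2)
  also have "\<dots> = (B\<^sup>2)\<^sup>2" by (simp add: Q.P.prob_space)
  finally have "(norm (kcomp M (kcomp M K D) K w))\<^sup>2 \<le> hs M D * (B\<^sup>2)\<^sup>2"
    by (simp add: hs_nonneg mult_left_mono)
  also have "\<dots> = (B\<^sup>2 * sqrt (hs M D))\<^sup>2" by (simp add: power_mult_distrib hs_nonneg)
  finally show ?thesis by (rule power2_le_imp_le) (simp add: hs_nonneg)
qed

lemma hs_diff: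
  assumes K: "bounded_kernel M K B" and L: "bounded_kernel M L C"
    and ip: "(\<integral>w. K w * cnj (L w) \<partial>(M \<Otimes>\<^sub>M M)) = complex_of_real r"
  shows "hs M (\<lambda>w. K w - L w) = hs M K + hs M L - 2 * r"
proof -
  note [measurable] = bounded_kernelD(1)[OF K] bounded_kernelD(1)[OF L]
  have i: "integrable (M \<Otimes>\<^sub>M M) (\<lambda>w. K w * cnj (L w))"
    by (rule bounded_integrable2[where B="B * C"])
       (auto simp: norm_mult bounded_kernelD[OF K] bounded_kernelD[OF L] intro!: mult_mono)
  have "(norm (K w - L w))\<^sup>2 = (norm (K w))\<^sup>2 + (norm (L w))\<^sup>2 - 2 * Re (K w * cnj (L w))" for w
    unfolding cmod_power2 by (simp add: power2_eq_square algebra_simps)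
  then have "hs M (\<lambda>w. K w - L w) = (\<integral>w. (norm (K w))\<^sup>2 + (norm (L w))\<^sup>2 - 2 * Re (K w * cnj (L w)) \<partial>(M \<Otimes>\<^sub>M M))"
    unfolding hs_def by simp
  also have "\<dots> = hs M K + hs M L - 2 * Re (\<integral>w. K w * cnj (L w) \<partial>(M \<Otimes>\<^sub>M M))"
    unfolding hs_def using norm_sq_integrable[OF K] norm_sq_integrable[OF L] i
    by (subst Bochner_Integration.integral_diff) (auto simp del: Re_complex_of_real times_complex.sel)
  finally show ?thesis by (simp add: ip)
qed

text \<open>Power iteration: with \<open>s\<close> the limit of the ratios \<open>hs (K^(n+1)) / hs (K^n)\<close>, the kernels
  \<open>K^(2n) / s^n\<close> form a Cauchy sequence in mean square, hence, after sandwiching with \<open>K\<close>, uniformly;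
  the limit is the projection onto the eigenspaces of extremal absolute value.\<close>

theorem spectral_projection:
  assumes K: "bounded_kernel M K B" "hermitian K" and pos: "hs M K > 0"
  shows "\<exists>p C a m. bounded_kernel M p C \<and> hermitian p \<and> kcomp M p p = p \<and> hs M p > 0 \<and>
    (\<forall>w. (\<lambda>n::nat. complex_of_real (a n) * kpow M K (m n) w) \<longlonglongrightarrow> p w)"
proof -
  \<comment> \<open>In terms of the eigenvalues of \<open>K\<close>, \<open>al n\<close> is the sum
    of their powers of order 2n + 2, so its consecutive ratios tend to the largest squared
    eigenvalue.\<close>
  define al where "al n = hs M (kpow M K n)" for n
  note kb = kpow_bounded[OF K(1)]
  note kh = hermitian_kpow[OF K]
  note m = bounded_kernelD(1)[OF kb]
  have ip: "(\<integral>w. kpow M K i w * cnj (kpow M K j w) \<partial>(M \<Otimes>\<^sub>M M)) = ktrace M (kpow M K (Suc (i + j)))" for i j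
    using ktrace_kcomp[OF kb kb kh, of i j] kcomp_kpow[OF K(1), of i j] by simp
  have al_trace: "complex_of_real (al n) = ktrace M (kpow M K (Suc (n + n)))" for n
    using hs_eq[of "kpow M K n"] ip[of n n] by (simp add: al_def)
  have ip_al: "(\<integral>w. kpow M K i w * cnj (kpow M K j w) \<partial>(M \<Otimes>\<^sub>M M)) = complex_of_real (al n)" if "i + j = n + n" for i j n
    using ip[of i j] al_trace[of n] that by simp
  \<comment> \<open>Cauchy-Schwarz for the powers with shifted exponents \<open>n\<close> and
    \<open>n + 2\<close>, whose inner product is \<open>al (Suc n)\<close>.\<close>
  have logconv: "(al (Suc n))\<^sup>2 \<le> al n * al (Suc (Suc n))" for n
    using hs_ip_bound[OF kb kb, of n "Suc (Suc n)"] ip_al[of n "Suc (Suc n)" "Suc n"] by (simp add: al_def)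
  have submult: "al (Suc (n + m)) \<le> al n * al m" for n m
    using hs_kcomp_le[OF kb kb, of n m] kcomp_kpow[OF K(1), of n m] by (simp add: al_def)
  have "al n > 0 \<and> al (Suc n) > 0" for n
  proof (induct n)
    case 0 show ?case using pos hs_kcomp_self_pos[OF K pos] by (simp add: al_def)
  next
    case (Suc n)
    then have "0 < al n * al (Suc (Suc n))" using logconv[of n] by (meson less_le_trans zero_less_power)
    with Suc show ?case by (simp add: zero_less_mult_iff)
  qed
  then have alpos: "al n > 0" for n by blast
  define rho where "rho n = al (Suc n) / al n" for n
  have rho_pos: "rho n > 0" for n by (simp add: rho_def alpos)
  have al_Suc: "al (Suc n) = rho n * al n" for n using alpos[of n] by (simp add: rho_def)
  have incs: "incseq rho"
  proof (rule incseq_SucI)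
    fix n show "rho n \<le> rho (Suc n)"
      using logconv[of n] alpos[of n] alpos[of "Suc n"] by (simp add: rho_def divide_simps power2_eq_square mult_ac)
  qed
  have "rho n \<le> al 0" for n
    using submult[of 0 n] alpos[of n] by (simp add: rho_def divide_simps)
  then obtain s where s: "rho \<longlonglongrightarrow> s" "\<And>i. rho i \<le> s" using incseq_convergent[OF incs] by blast
  have spos: "s > 0" using rho_pos[of 0] s(2)[of 0] by linarith
  \<comment> \<open>Increasing ratios give
    \<open>al m * rho m ^ Suc n \<le> al (Suc (m + n))\<close>, and submultiplicativity bounds the
    right side by \<open>al m * al n\<close>. Cancel \<open>al m\<close> and let \<open>m\<close>
    grow. This bound is what prevents the limit kernel from being zero.\<close>
  have al_ge: "al n \<ge> s ^ Suc n" for n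
  proof -
    have grow: "al m * rho m ^ k \<le> al (m + k)" for m k
    proof (induct k)
      case (Suc k)
      have "al m * rho m ^ Suc k \<le> al (m + k) * rho m" using mult_right_mono[OF Suc, of "rho m"] rho_pos[of m] by (simp add: mult_ac)
      also have "\<dots> \<le> al (m + k) * rho (m + k)"
        using incs alpos[of "m + k"] by (intro mult_left_mono) (auto simp: incseq_def)
      finally show ?case by (simp add: al_Suc mult_ac)
    qed simp
    have "rho m ^ Suc n \<le> al n" for m
    proof -
      have "al m * rho m ^ Suc n \<le> al m * al n"
        using grow[of m "Suc n"] submult[of m n] by (simp add: add.commute)
      then show ?thesis using alpos[of m] by (simp del: power_Suc)
    qed
    then show ?thesis using LIMSEQ_le_const2[OF tendsto_power[OF s(1), of "Suc n"]] by blast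
  qed
  \<comment> \<open>Normalised to be decreasing and at least 1; its limit counts the eigenvalues of
    maximal absolute value.\<close>
  define be where "be n = al n / s ^ Suc n" for n
  have be1: "be n \<ge> 1" for n using al_ge[of n] spos by (simp add: be_def)
  have decs: "decseq be"
  proof (rule decseq_SucI)
    fix n
    have "al (Suc n) \<le> s * al n" using al_Suc[of n] s(2)[of n] alpos[of n] by simp
    then show "be (Suc n) \<le> be n" using spos by (simp add: be_def divide_simps mult_ac)
  qed
  obtain b where b: "be \<longlonglongrightarrow> b" "\<And>i. b \<le> be i" using decseq_convergent[OF decs, of 1] be1 by blast
  \<comment> \<open>This is the power of order n + 1 of K^2 / s. Even powers send both possible
    signs of an extremal eigenvalue to 1.\<close>
  define R where "R n w = complex_of_real (1 / s ^ Suc n) * kpow M K (Suc (n + n)) w" for n w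
  have Rb: "bounded_kernel M (R n) (B ^ Suc (Suc (n + n)) / s ^ Suc n)" for n
  proof -
    note [measurable] = m
    show ?thesis
      using bounded_kernelD(2)[OF kb, of "Suc (n + n)"] spos unfolding bounded_kernel_def R_def
      by (auto simp: norm_mult norm_divide norm_power divide_right_mono simp del: power_Suc kpow.simps)
  qed
  have Rh: "hermitian (R n)" for n
    unfolding hermitian_def[of "R n"] R_def by (simp add: hermitianD[OF kh] del: kpow.simps)
  have RR: "kcomp M (R n) (R m) = R (Suc (n + m))" for n m
  proof -
    have "kcomp M (R n) (R m) = (\<lambda>w. complex_of_real (1 / s ^ Suc n) * complex_of_real (1 / s ^ Suc m) * kpow M K (Suc (Suc (n + n) + Suc (m + m))) w)"
      unfolding R_def kcomp_scale kcomp_kpow[OF K(1)] ..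
    also have "\<dots> = R (Suc (n + m))"
      using spos by (simp add: fun_eq_iff R_def field_simps power_add)
    finally show ?thesis .
  qed
  have Rip: "(\<integral>w. R n w * cnj (R m w) \<partial>(M \<Otimes>\<^sub>M M)) = complex_of_real (be (Suc (n + m)))" for n m
  proof -
    have "(\<integral>w. R n w * cnj (R m w) \<partial>(M \<Otimes>\<^sub>M M))
      = (\<integral>w. complex_of_real (1 / s ^ Suc n * (1 / s ^ Suc m)) * (kpow M K (Suc (n + n)) w * cnj (kpow M K (Suc (m + m)) w)) \<partial>(M \<Otimes>\<^sub>M M))"
      unfolding R_def by (rule Bochner_Integration.integral_cong) (auto simp: mult_ac)
    also have "\<dots> = complex_of_real (1 / s ^ Suc n * (1 / s ^ Suc m)) * complex_of_real (al (Suc (n + m)))"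
      unfolding integral_mult_right_zero by (subst ip_al[of _ _ "Suc (n + m)"]) auto
    also have "\<dots> = complex_of_real (be (Suc (n + m)))"
      using spos by (simp add: be_def field_simps power_add)
    finally show ?thesis .
  qed
  have hsR: "hs M (R n) = be (Suc (n + n))" for n
    using hs_eq[of "R n"] unfolding Rip of_real_eq_iff by simp
  \<comment> \<open>One factor \<open>K\<close> is peeled off on each side so that
    \<open>kcomp_sandwich_bound\<close> applies to differences of the \<open>R n\<close>.\<close>
  have Rstep: "R (Suc n) w = complex_of_real (1 / s) * kcomp M (kcomp M K (R n)) K w" for n w
  proof -
    have "kcomp M K (R n) = (\<lambda>w. complex_of_real (1 / s ^ Suc n) * kpow M K (Suc (Suc (n + n))) w)"
      using kcomp_scale[of 1 K "complex_of_real (1 / s ^ Suc n)" "kpow M K (Suc (n + n))"]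
      by (simp add: R_def[abs_def])
    then have "kcomp M (kcomp M K (R n)) K = (\<lambda>w. complex_of_real (1 / s ^ Suc n) * kpow M K (Suc (Suc (Suc (n + n)))) w)"
      using kcomp_scale[of "complex_of_real (1 / s ^ Suc n)" "kpow M K (Suc (Suc (n + n)))" 1 K]
        kcomp_kpow[OF K(1), of "Suc (Suc (n + n))" 0] by simp
    then show ?thesis by (simp add: R_def)
  qed
  define c where "c = B\<^sup>2 / s"
  have cpos: "c \<ge> 0" using spos by (simp add: c_def)
  have Rdist: "norm (R (Suc n) w - R (Suc k) w) \<le> c * sqrt (2 * (be N - b))" if "N \<le> n" "N \<le> k" for n k N w
  proof -
    define D where "D = (\<lambda>w. R n w - R k w)"
    note [measurable] = bounded_kernelD(1)[OF Rb]
    have D: "bounded_kernel M D (B ^ Suc (Suc (n + n)) / s ^ Suc n + B ^ Suc (Suc (k + k)) / s ^ Suc k)"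
      unfolding bounded_kernel_def D_def
      by (auto intro!: order_trans[OF norm_triangle_ineq4] add_mono bounded_kernelD(2)[OF Rb] simp del: power_Suc)
    have "kcomp M (kcomp M K D) K w = kcomp M (kcomp M K (R n)) K w - kcomp M (kcomp M K (R k)) K w"
    proof -
      have e: "kcomp M K D = (\<lambda>w. kcomp M K (R n) w - kcomp M K (R k) w)"
        unfolding kcomp_def D_def right_diff_distrib
        by (intro ext Bochner_Integration.integral_diff kcomp_integrable[OF K(1) Rb])
      show ?thesis
        unfolding e unfolding kcomp_def[of M _ K] left_diff_distrib
        by (intro Bochner_Integration.integral_diff kcomp_integrable[OF kcomp_bounded[OF K(1) Rb] K(1)])
    qed
    then have "norm (R (Suc n) w - R (Suc k) w) = (1 / s) * norm (kcomp M (kcomp M K D) K w)"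
      using spos unfolding Rstep right_diff_distrib[symmetric] by (simp add: norm_mult norm_divide)
    also have "\<dots> \<le> (1 / s) * (B\<^sup>2 * sqrt (hs M D))"
      using spos by (intro mult_left_mono kcomp_sandwich_bound[OF K(1) D]) auto
    \<comment> \<open>The squared distance is expressed by values of \<open>be\<close> alone, so
      convergence of \<open>be\<close> makes the sequence Cauchy, uniformly in
      \<open>w\<close>.\<close>
    also have "hs M D = be (Suc (n + n)) + be (Suc (k + k)) - 2 * be (Suc (n + k))"
      unfolding D_def by (subst hs_diff[OF Rb Rb Rip]) (simp add: hsR)
    also have "(1 / s) * (B\<^sup>2 * sqrt (be (Suc (n + n)) + be (Suc (k + k)) - 2 * be (Suc (n + k)))) = c * sqrt (be (Suc (n + n)) + be (Suc (k + k)) - 2 * be (Suc (n + k)))"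
      by (simp add: c_def)
    also have "\<dots> \<le> c * sqrt (2 * (be N - b))"
    proof (intro mult_left_mono cpos real_sqrt_le_mono)
      have "be (Suc (n + n)) \<le> be N" "be (Suc (k + k)) \<le> be N"
        using decs that by (auto simp: decseq_def)
      then show "be (Suc (n + n)) + be (Suc (k + k)) - 2 * be (Suc (n + k)) \<le> 2 * (be N - b)"
        using b(2)[of "Suc (n + k)"] by simp
    qed
    finally show ?thesis .
  qed
  have Rbd: "norm (R (Suc n) w) \<le> c * sqrt (be 0)" for n w
  proof -
    have "norm (R (Suc n) w) = (1 / s) * norm (kcomp M (kcomp M K (R n)) K w)"
      using spos unfolding Rstep by (simp add: norm_mult norm_divide)
    also have "\<dots> \<le> (1 / s) * (B\<^sup>2 * sqrt (hs M (R n)))"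
      using spos by (intro mult_left_mono kcomp_sandwich_bound[OF K(1) Rb]) auto
    also have "\<dots> = c * sqrt (be (Suc (n + n)))" by (simp add: c_def hsR)
    also have "\<dots> \<le> c * sqrt (be 0)"
      using decs by (intro mult_left_mono cpos real_sqrt_le_mono) (auto simp: decseq_def)
    finally show ?thesis .
  qed
  have "(\<lambda>N. c * sqrt (2 * (be N - b))) \<longlonglongrightarrow> c * sqrt (2 * (b - b))"
    by (intro tendsto_intros b(1))
  then have lim0: "(\<lambda>N. c * sqrt (2 * (be N - b))) \<longlonglongrightarrow> 0" by simp
  have Cau: "Cauchy (\<lambda>n. R (Suc n) w)" for w
  proof (rule metric_CauchyI)
    fix e :: real assume "e > 0"
    then obtain N where N: "c * sqrt (2 * (be N - b)) < e"
      using order_tendstoD(2)[OF lim0] by (auto simp: eventually_sequentially)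
    show "\<exists>N. \<forall>n\<ge>N. \<forall>k\<ge>N. dist (R (Suc n) w) (R (Suc k) w) < e"
      unfolding dist_norm using Rdist N by (intro exI[of _ N]) (meson le_less_trans)
  qed
  define p where "p w = lim (\<lambda>n. R (Suc n) w)" for w
  have Rp: "(\<lambda>n. R (Suc n) w) \<longlonglongrightarrow> p w" for w
    using Cau[of w] unfolding p_def by (simp add: Cauchy_convergent_iff convergent_LIMSEQ_iff)
  have pb: "bounded_kernel M p (c * sqrt (be 0))"
    unfolding bounded_kernel_def
  proof (intro conjI allI)
    show "p \<in> borel_measurable (M \<Otimes>\<^sub>M M)"
      by (rule borel_measurable_LIMSEQ_metric[OF bounded_kernelD(1)[OF Rb] Rp])
    show "norm (p w) \<le> c * sqrt (be 0)" for w
      by (rule LIMSEQ_le_const2[OF tendsto_norm[OF Rp]]) (use Rbd in blast)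
  qed
  have ph: "hermitian p" unfolding hermitian_def
  proof (intro allI)
    fix x t
    have "(\<lambda>n. R (Suc n) (t, x)) \<longlonglongrightarrow> cnj (p (x, t))"
      using tendsto_cnj[OF Rp[of "(x, t)"]] by (simp add: hermitianD[OF Rh])
    then show "p (t, x) = cnj (p (x, t))" using Rp LIMSEQ_unique by blast
  qed
  \<comment> \<open>The square of \<open>R (Suc n)\<close> is again a term of the sequence, at index
    2n + 3, so the squares converge to \<open>p\<close> as well as to
    \<open>kcomp M p p\<close>.\<close>
  have pp: "kcomp M p p = p"
  proof
    fix w
    have "(\<lambda>n. kcomp M (R (Suc n)) (R (Suc n)) w) \<longlonglongrightarrow> kcomp M p p w"
      unfolding kcomp_def
    proof (rule integral_dominated_convergence[where w="\<lambda>_. (c * sqrt (be 0)) * (c * sqrt (be 0))"])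
      note [measurable] = section_measurable[OF bounded_kernelD(1)[OF pb]] section_measurable[OF bounded_kernelD(1)[OF Rb]]
      show "(\<lambda>z. p (fst w, z) * p (z, snd w)) \<in> borel_measurable M" by measurable
      show "(\<lambda>z. R (Suc n) (fst w, z) * R (Suc n) (z, snd w)) \<in> borel_measurable M" for n by measurable
      show "AE z in M. (\<lambda>n. R (Suc n) (fst w, z) * R (Suc n) (z, snd w)) \<longlonglongrightarrow> p (fst w, z) * p (z, snd w)"
        by (intro AE_I2 tendsto_mult Rp)
      show "AE z in M. norm (R (Suc n) (fst w, z) * R (Suc n) (z, snd w)) \<le> (c * sqrt (be 0)) * (c * sqrt (be 0))" for n
        using Rbd norm_ge_zero[of "R (Suc n) undefined"] order_trans[OF norm_ge_zero Rbd]
        by (intro AE_I2) (auto simp: norm_mult intro!: mult_mono)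
    qed simp
    then have "(\<lambda>n. R (Suc (Suc n + Suc n)) w) \<longlonglongrightarrow> kcomp M p p w" unfolding RR .
    moreover have "(\<lambda>n. R (Suc (Suc n + Suc n)) w) \<longlonglongrightarrow> p w"
      using LIMSEQ_subseq_LIMSEQ[OF Rp[of w], of "\<lambda>n. Suc n + Suc n"] by (simp add: strict_mono_def o_def)
    ultimately show "kcomp M p p w = p w" by (rule LIMSEQ_unique)
  qed
  have "(\<lambda>n. hs M (R (Suc n))) \<longlonglongrightarrow> hs M p"
    unfolding hs_def
  proof (rule integral_dominated_convergence[where w="\<lambda>_. (c * sqrt (be 0))\<^sup>2"])
    note [measurable] = bounded_kernelD(1)[OF pb] bounded_kernelD(1)[OF Rb]
    show "(\<lambda>w. (norm (p w))\<^sup>2) \<in> borel_measurable (M \<Otimes>\<^sub>M M)" by measurable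
    show "(\<lambda>w. (norm (R (Suc n) w))\<^sup>2) \<in> borel_measurable (M \<Otimes>\<^sub>M M)" for n by measurable
    show "AE w in M \<Otimes>\<^sub>M M. (\<lambda>n. (norm (R (Suc n) w))\<^sup>2) \<longlonglongrightarrow> (norm (p w))\<^sup>2"
      by (intro AE_I2 tendsto_intros Rp)
    show "AE w in M \<Otimes>\<^sub>M M. norm ((norm (R (Suc n) w))\<^sup>2) \<le> (c * sqrt (be 0))\<^sup>2" for n
      using Rbd by (intro AE_I2) (auto intro!: power_mono)
  qed simp
  then have "1 \<le> hs M p"
    by (rule LIMSEQ_le_const) (use be1 hsR in auto)
  then have hp: "hs M p > 0" by simp
  have lim: "(\<lambda>n. complex_of_real (1 / s ^ Suc (Suc n)) * kpow M K (Suc (Suc n + Suc n)) w) \<longlonglongrightarrow> p w" for w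
    using Rp[of w] unfolding R_def .
  show ?thesis
    by (intro exI[of _ p] exI[of _ "c * sqrt (be 0)"] exI[of _ "\<lambda>n. 1 / s ^ Suc (Suc n)"] exI[of _ "\<lambda>n. Suc (Suc n + Suc n)"]
      conjI allI pb ph pp hp lim)
qed

text \<open>Induction on an integer above the trace. Splitting off one normalised column lowers the
  trace by 1, while the trace of a Hermitian idempotent equals its \<open>hs\<close> and is
  nonnegative, so the process stops.\<close>

lemma idempotent_finite_rank:
  assumes p: "bounded_kernel M p C" "hermitian p" "kcomp M p p = p"
  shows "\<exists>(n::nat) e. (\<forall>i<n. e i \<in> borel_measurable M \<and> (\<exists>B. \<forall>x. norm (e i x) \<le> B)) \<and>
    (\<forall>i<n. \<forall>j<n. (\<integral>x. e i x * cnj (e j x) \<partial>M) = (if i = j then 1 else 0)) \<and>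
    (\<forall>i<n. \<forall>x. (\<integral>t. p (x, t) * e i t \<partial>M) = e i x) \<and>
    (\<forall>x t. p (x, t) = (\<Sum>i<n. e i x * cnj (e i t)))"
proof -
  have "\<exists>(n::nat) e. (\<forall>i<n. e i \<in> borel_measurable M \<and> (\<exists>B. \<forall>x. norm (e i x) \<le> B)) \<and>
    (\<forall>i<n. \<forall>j<n. (\<integral>x. e i x * cnj (e j x) \<partial>M) = (if i = j then 1 else 0)) \<and>
    (\<forall>i<n. \<forall>x. (\<integral>t. p (x, t) * e i t \<partial>M) = e i x) \<and>
    (\<forall>x t. p (x, t) = (\<Sum>i<n. e i x * cnj (e i t)))"
    if "bounded_kernel M p C" "hermitian p" "kcomp M p p = p" "Re (ktrace M p) < real N" for N p C
    using that
  proof (induct N arbitrary: p C)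
    case (0 p C)
    have "ktrace M p = complex_of_real (hs M p)"
      using ktrace_kcomp[OF 0(1) 0(1,2)] hs_eq[of p] 0(3) by simp
    then show ?case using 0(4) hs_nonneg[of p] by simp
  next
    case (Suc N p C)
    note pb = Suc(2) and ph = Suc(3) and pp = Suc(4)
    note [measurable] = bounded_kernelD(1)[OF pb] section_measurable[OF bounded_kernelD(1)[OF pb]]
    have pp': "(\<integral>z. p (x, z) * p (z, t) \<partial>M) = p (x, t)" for x t
      using fun_cong[OF pp, of "(x, t)"] by (simp add: kcomp_def)
    \<comment> \<open>A diagonal entry is the squared norm of a row; a vanishing diagonal therefore
      forces \<open>p\<close> to vanish at every point.\<close>
    have pdiag: "p (t, t) = complex_of_real (\<integral>z. (norm (p (t, z)))\<^sup>2 \<partial>M)" for t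
      unfolding pp'[of t t, symmetric] integral_complex_of_real[symmetric] complex_norm_square hermitianD[OF ph] ..
    show ?case
    proof (cases "\<exists>t. p (t, t) \<noteq> 0")
      case False
      have "p (x, t) = 0" for x t
      proof -
        have "(\<integral>z. (norm (p (x, z)))\<^sup>2 \<partial>M) = 0" using False pdiag[of x] by simp
        moreover have "integrable M (\<lambda>z. (norm (p (x, z)))\<^sup>2)"
          by (rule integrable_const_bound[where B="C\<^sup>2"]) (auto intro!: power_mono bounded_kernelD[OF pb])
        ultimately have "AE z in M. p (x, z) = 0"
          by (subst (asm) integral_nonneg_eq_0_iff_AE) auto
        then have "(\<integral>z. p (x, z) * p (z, t) \<partial>M) = 0" by (intro integral_eq_zero_AE) auto
        then show ?thesis by (simp add: pp')
      qed
      then have "\<forall>x t. p (x, t) = 0" by blast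
      then show ?thesis by - (intro exI[of _ "0::nat"] exI[of _ "(\<lambda>_ _. 0) :: nat \<Rightarrow> 'a \<Rightarrow> complex"], simp)
    next
      case True
      then obtain t0 where t0: "p (t0, t0) \<noteq> 0" by blast
      define q where "q = (\<integral>z. (norm (p (t0, z)))\<^sup>2 \<partial>M)"
      have q: "p (t0, t0) = complex_of_real q" unfolding q_def by (rule pdiag)
      have "q \<ge> 0" unfolding q_def by simp
      with q t0 have qpos: "q > 0" by (cases "q = 0") auto
      \<comment> \<open>Columns of an idempotent lie in its range, and the squared norm of this one
        is \<open>p (t0, t0)\<close>, which is \<open>q\<close>.\<close>
      define f where "f x = p (x, t0) / complex_of_real (sqrt q)" for x
      define F where "F = C / sqrt q"
      have [measurable]: "f \<in> borel_measurable M" unfolding f_def by measurable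
      have fF: "norm (f x) \<le> F" for x
        using qpos by (simp add: f_def F_def norm_divide divide_right_mono bounded_kernelD[OF pb])
      have F0: "0 \<le> F" using fF norm_ge_zero order_trans by blast
      have pf: "(\<integral>z. p (x, z) * f z \<partial>M) = f x" for x
        unfolding f_def times_divide_eq_right integral_divide_zero pp' ..
      have fp: "(\<integral>z. cnj (f z) * p (z, y) \<partial>M) = cnj (f y)" for y
        unfolding pf[of y, symmetric] Bochner_Integration.integral_cnj[symmetric] complex_cnj_mult hermitianD[OF ph]
        by (rule Bochner_Integration.integral_cong) (simp_all add: mult.commute)
      have ff: "(\<integral>x. f x * cnj (f x) \<partial>M) = 1"
      proof -
        have "(\<integral>x. f x * cnj (f x) \<partial>M) = (\<integral>x. p (t0, x) * p (x, t0) / complex_of_real q \<partial>M)"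
          using qpos unfolding f_def
          by (intro Bochner_Integration.integral_cong) (auto simp: hermitianD[OF ph] of_real_mult[symmetric] simp del: of_real_mult)
        also have "\<dots> = 1" unfolding integral_divide_zero pp' using q t0 by simp
        finally show ?thesis .
      qed
      define p' where "p' w = p w - f (fst w) * cnj (f (snd w))" for w
      have p'b: "bounded_kernel M p' (C + F * F)"
        unfolding bounded_kernel_def p'_def
        by (auto simp: norm_mult fF F0 intro!: order_trans[OF norm_triangle_ineq4] add_mono mult_mono bounded_kernelD(2)[OF pb])
      have p'h: "hermitian p'" unfolding hermitian_def[of p'] p'_def by (simp add: hermitianD[OF ph])
      have i1: "integrable M (\<lambda>z. p (x, z) * p (z, y))" for x y by (rule kcomp_integrable[OF pb pb])
      have i2: "integrable M (\<lambda>z. p (x, z) * f z)" for x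
        by (rule bounded_integrable[where B="C * F"])
           (auto simp: norm_mult fF bounded_kernelD[OF pb] intro!: mult_mono)
      have i3: "integrable M (\<lambda>z. cnj (f z) * p (z, y))" for y
        by (rule bounded_integrable[where B="F * C"])
           (auto simp: norm_mult fF F0 bounded_kernelD[OF pb] intro!: mult_mono)
      have i4: "integrable M (\<lambda>z. f z * cnj (f z))"
        by (rule bounded_integrable[where B="F * F"]) (auto simp: norm_mult fF F0 intro!: mult_mono)
      have p'f: "(\<integral>z. p' (x, z) * f z \<partial>M) = 0" for x
      proof -
        have "(\<integral>z. p' (x, z) * f z \<partial>M) = (\<integral>z. p (x, z) * f z - f x * (f z * cnj (f z)) \<partial>M)"
          unfolding p'_def by (simp add: algebra_simps)
        also have "\<dots> = f x - f x * 1"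
          using i2 i4 by (simp add: pf ff)
        finally show ?thesis by simp
      qed
      have p'p': "kcomp M p' p' = p'"
      proof
        fix w :: "'a \<times> 'a"
        obtain x y where w: "w = (x, y)" by force
        have "kcomp M p' p' w = (\<integral>z. p (x, z) * p (z, y) - f x * (cnj (f z) * p (z, y)) - p' (x, z) * f z * cnj (f y) \<partial>M)"
          unfolding kcomp_def w p'_def by (simp add: algebra_simps)
        also have "\<dots> = p (x, y) - f x * cnj (f y) - (\<integral>z. p' (x, z) * f z * cnj (f y) \<partial>M)"
        proof -
          have "integrable M (\<lambda>z. p' (x, z) * f z)"
          proof -
            have "(\<lambda>z. p' (x, z) * f z) = (\<lambda>z. p (x, z) * f z - f x * (f z * cnj (f z)))"
              unfolding p'_def by (simp add: algebra_simps)
            then show ?thesis using i2 i4 by simp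
          qed
          then show ?thesis using i1 i3 by (simp add: pp' fp)
        qed
        also have "\<dots> = p' w" unfolding integral_mult_left_zero p'f by (simp add: w p'_def)
        finally show "kcomp M p' p' w = p' w" .
      qed
      have "ktrace M p' = ktrace M p - 1"
      proof -
        have "integrable M (\<lambda>x. p (x, x))"
          by (rule bounded_integrable[where B=C]) (auto simp: bounded_kernelD[OF pb])
        then show ?thesis unfolding ktrace_def p'_def using i4 by (simp add: ff)
      qed
      then have "Re (ktrace M p') < real N" using Suc(5) by simp
      from Suc(1)[OF p'b p'h p'p' this] obtain n :: nat and e where
        e: "\<forall>i<n. e i \<in> borel_measurable M \<and> (\<exists>B. \<forall>x. norm (e i x) \<le> B)"
        and orth: "\<forall>i<n. \<forall>j<n. (\<integral>x. e i x * cnj (e j x) \<partial>M) = (if i = j then 1 else 0)"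
        and p'e: "\<forall>i<n. \<forall>x. (\<integral>t. p' (x, t) * e i t \<partial>M) = e i x"
        and sum: "\<forall>x t. p' (x, t) = (\<Sum>i<n. e i x * cnj (e i t))"
        by (elim exE conjE) (rule that)
      note e = e[rule_format] and orth = orth[rule_format] and p'e = p'e[rule_format] and sum = sum[rule_format]
      \<comment> \<open>Each \<open>e i\<close> lies in the range of \<open>p'\<close>, and that
        range is orthogonal to \<open>f\<close> because \<open>p'\<close> is Hermitian and
        annihilates \<open>f\<close>.\<close>
      have fe: "(\<integral>x. cnj (f x) * e i x \<partial>M) = 0" if i: "i < n" for i
      proof -
        obtain B where B: "\<And>x. norm (e i x) \<le> B" using e[OF i] by blast
        have B0: "0 \<le> B" using B norm_ge_zero order_trans by blast
        note [measurable] = e[OF i, THEN conjunct1] bounded_kernelD(1)[OF p'b]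
        have I: "integrable (M \<Otimes>\<^sub>M M) (\<lambda>(x, t). cnj (f x) * p' (x, t) * e i t)"
          by (rule bounded_integrable2[where B="F * (C + F * F) * B"])
             (auto simp: norm_mult split_beta' fF F0 B B0 bounded_kernelD[OF p'b] intro!: mult_mono mult_nonneg_nonneg bounded_kernelD(3)[OF p'b])
        have z: "(\<integral>x. cnj (f x) * p' (x, t) \<partial>M) = 0" for t
        proof -
          have "(\<integral>x. cnj (f x) * p' (x, t) \<partial>M) = cnj (\<integral>x. p' (t, x) * f x \<partial>M)"
            unfolding Bochner_Integration.integral_cnj[symmetric] complex_cnj_mult hermitianD[OF p'h] by (rule Bochner_Integration.integral_cong) (simp_all add: mult.commute)
          then show ?thesis by (simp add: p'f)
        qed
        have "(\<integral>x. cnj (f x) * e i x \<partial>M) = (\<integral>x. (\<integral>t. cnj (f x) * p' (x, t) * e i t \<partial>M) \<partial>M)"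
          unfolding mult.assoc integral_mult_right_zero p'e[OF i] ..
        also have "\<dots> = (\<integral>t. (\<integral>x. cnj (f x) * p' (x, t) * e i t \<partial>M) \<partial>M)"
          using Q.Fubini_integral[of "\<lambda>x t. cnj (f x) * p' (x, t) * e i t"] I by simp
        also have "\<dots> = 0" unfolding integral_mult_left_zero z by simp
        finally show ?thesis .
      qed
      have ef: "(\<integral>x. e i x * cnj (f x) \<partial>M) = 0" "(\<integral>x. f x * cnj (e i x) \<partial>M) = 0" if i: "i < n" for i
      proof -
        show "(\<integral>x. e i x * cnj (f x) \<partial>M) = 0" using fe[OF i] by (simp add: mult.commute[of "e i _"])
        have "(\<integral>x. f x * cnj (e i x) \<partial>M) = cnj (\<integral>x. cnj (f x) * e i x \<partial>M)"
          unfolding Bochner_Integration.integral_cnj[symmetric] by simp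
        then show "(\<integral>x. f x * cnj (e i x) \<partial>M) = 0" using fe[OF i] by simp
      qed
      define g where "g i = (if i < n then e i else f)" for i
      have pe: "(\<integral>t. p (x, t) * e i t \<partial>M) = e i x" if i: "i < n" for i x
      proof -
        obtain B where B: "\<And>x. norm (e i x) \<le> B" using e[OF i] by blast
        have B0: "0 \<le> B" using B norm_ge_zero order_trans by blast
        note [measurable] = e[OF i, THEN conjunct1] section_measurable[OF bounded_kernelD(1)[OF p'b]]
        have j1: "integrable M (\<lambda>t. p' (x, t) * e i t)"
          by (rule bounded_integrable[where B="(C + F * F) * B"])
             (auto simp: norm_mult B bounded_kernelD[OF p'b] intro!: mult_mono bounded_kernelD(3)[OF p'b])
        have j2: "integrable M (\<lambda>t. cnj (f t) * e i t)"
          by (rule bounded_integrable[where B="F * B"]) (auto simp: norm_mult B fF F0 intro!: mult_mono)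
        have "(\<integral>t. p (x, t) * e i t \<partial>M) = (\<integral>t. p' (x, t) * e i t + f x * (cnj (f t) * e i t) \<partial>M)"
          unfolding p'_def by (simp add: algebra_simps)
        also have "\<dots> = e i x" using j1 j2 by (simp add: p'e[OF i] fe[OF i])
        finally show ?thesis .
      qed
      show ?thesis
      proof (intro exI[of _ "Suc n"] exI[of _ g] conjI allI impI)
        fix i assume "i < Suc n"
        show "g i \<in> borel_measurable M" using e by (simp add: g_def)
        show "\<exists>B. \<forall>x. norm (g i x) \<le> B" using e fF by (auto simp: g_def)
        show "(\<integral>t. p (x, t) * g i t \<partial>M) = g i x" for x using pe pf by (simp add: g_def)
        show "(\<integral>x. g i x * cnj (g j x) \<partial>M) = (if i = j then 1 else 0)" if "j < Suc n" for j
          using that \<open>i < Suc n\<close> orth ef ff by (auto simp: g_def)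
      next
        fix x t
        have "p (x, t) = p' (x, t) + f x * cnj (f t)" by (simp add: p'_def)
        also have "\<dots> = (\<Sum>i<Suc n. g i x * cnj (g i t))" by (simp add: sum g_def)
        finally show "p (x, t) = (\<Sum>i<Suc n. g i x * cnj (g i t))" .
      qed
    qed
  qed
  moreover obtain N where "Re (ktrace M p) < real N" using reals_Archimedean2 by blast
  ultimately show ?thesis using p by blast
qed

end

section \<open>Ergodicity of products and untwisting\<close>

definition measure_preserving_map :: "'a measure \<Rightarrow> 'b measure \<Rightarrow> ('a \<Rightarrow> 'b) \<Rightarrow> bool" where
  "measure_preserving_map M N f \<longleftrightarrow> f \<in> measurable M N \<and> distr M N f = N"

lemma mp_measurable: "measure_preserving_map M N f \<Longrightarrow> f \<in> measurable M N"
  by (simp add: measure_preserving_map_def)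

lemma mp_AE: "measure_preserving_map M N f \<Longrightarrow> AE y in N. P y \<Longrightarrow> AE x in M. P (f x)"
  unfolding measure_preserving_map_def by (metis AE_distrD)

lemma mp_integral:
  fixes g :: "'b \<Rightarrow> 'c :: {banach, second_countable_topology}"
  assumes "measure_preserving_map M N f" "g \<in> borel_measurable N"
  shows "(\<integral>x. g (f x) \<partial>M) = (\<integral>y. g y \<partial>N)"
  using assms integral_distr[of f M N g] by (simp add: measure_preserving_map_def)

lemma mp_comp:
  assumes "measure_preserving_map M N f" "measure_preserving_map N L g"
  shows "measure_preserving_map M L (\<lambda>x. g (f x))"
  using assms distr_distr[of g N L f M] unfolding measure_preserving_map_def
  by (auto simp: o_def intro: measurable_compose)

lemma mp_id: "measure_preserving_map M M (\<lambda>x. x)"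
  unfolding measure_preserving_map_def by (simp add: distr_id[unfolded id_def])

lemma mp_fst: "prob_space N \<Longrightarrow> measure_preserving_map (M \<Otimes>\<^sub>M N) M fst"
  unfolding measure_preserving_map_def using prob_space.distr_pair_fst by auto

lemma mp_prod:
  assumes "prob_space N'" "measure_preserving_map M M' f" "measure_preserving_map N N' g"
  shows "measure_preserving_map (M \<Otimes>\<^sub>M N) (M' \<Otimes>\<^sub>M N') (\<lambda>w. (f (fst w), g (snd w)))"
proof -
  interpret N': prob_space N' by fact
  have "sigma_finite_measure (distr N N' g)" using assms N'.sigma_finite_measure_axioms by (simp add: measure_preserving_map_def)
  from pair_measure_distr[OF _ _ this, of f M M'] assms show ?thesis
    unfolding measure_preserving_map_def
    by (simp add: split_beta' measurable_Pair measurable_compose[OF measurable_fst] measurable_compose[OF measurable_snd])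
qed

lemma mp_swap:
  assumes "prob_space M" "prob_space N"
  shows "measure_preserving_map (M \<Otimes>\<^sub>M N) (N \<Otimes>\<^sub>M M) (\<lambda>w. (snd w, fst w))"
proof -
  interpret M: prob_space M by fact
  interpret N: prob_space N by fact
  interpret pair_prob_space N M ..
  show ?thesis using distr_pair_swap unfolding measure_preserving_map_def by (simp add: split_beta')
qed

lemma mp_snd:
  assumes "prob_space M" "prob_space N"
  shows "measure_preserving_map (M \<Otimes>\<^sub>M N) N snd"
  using mp_comp[OF mp_swap[OF assms] mp_fst[OF assms(1)]] by simp

lemma (in prob_space) AE_exists:
  assumes "AE x in M. P x" shows "\<exists>x\<in>space M. P x"
  using eventually_happens'[OF ae_filter_bot AE_conjI[OF AE_space assms]] by blast

lemma (in pair_prob_space) integral_times_bounded: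
  fixes f :: "'a \<Rightarrow> complex" and g :: "'b \<Rightarrow> complex"
  assumes [measurable]: "f \<in> borel_measurable M1" "g \<in> borel_measurable M2"
    and "\<And>x. x \<in> space M1 \<Longrightarrow> norm (f x) \<le> B" "\<And>x. x \<in> space M2 \<Longrightarrow> norm (g x) \<le> C"
  shows "(\<integral>w. f (fst w) * g (snd w) \<partial>(M1 \<Otimes>\<^sub>M M2)) = (\<integral>x. f x \<partial>M1) * (\<integral>y. g y \<partial>M2)"
proof -
  have "0 \<le> B" using assms(3) M1.not_empty norm_ge_zero order_trans by blast
  then have "integrable (M1 \<Otimes>\<^sub>M M2) (\<lambda>w. f (fst w) * g (snd w))"
    using assms by (intro P.integrable_const_bound[where B="B * C"]) (auto simp: norm_mult space_pair_measure intro!: mult_mono)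
  from integral_fst'[OF this] show ?thesis by simp
qed

lemma pmp_mp: "pmp_action G M \<tau> \<Longrightarrow> g \<in> carrier G \<Longrightarrow> measure_preserving_map M M (\<tau> g)"
  unfolding pmp_action_def measure_preserving_map_def by blast

text \<open>Unlike in \<open>diag2\<close> the two factors may carry different actions, so triple
  and quadruple products arise by iteration.\<close>

definition prod_act :: "('g \<Rightarrow> 'y \<Rightarrow> 'y) \<Rightarrow> ('g \<Rightarrow> 'z \<Rightarrow> 'z) \<Rightarrow> 'g \<Rightarrow> 'y \<times> 'z \<Rightarrow> 'y \<times> 'z" where
  "prod_act \<tau> \<tau>' g = (\<lambda>w. (\<tau> g (fst w), \<tau>' g (snd w)))"

lemma diag2_eq: "diag2 \<tau> = prod_act \<tau> \<tau>"
  by (simp add: diag2_def prod_act_def fun_eq_iff)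

lemma pmp_prod:
  assumes "pmp_action G M \<tau>" "pmp_action G N \<tau>'"
  shows "pmp_action G (M \<Otimes>\<^sub>M N) (prod_act \<tau> \<tau>')"
proof -
  interpret M: prob_space M using assms(1) by (simp add: pmp_action_def)
  interpret N: prob_space N using assms(2) by (simp add: pmp_action_def)
  interpret pair_prob_space M N ..
  have "measure_preserving_map (M \<Otimes>\<^sub>M N) (M \<Otimes>\<^sub>M N) (prod_act \<tau> \<tau>' g)" if "g \<in> carrier G" for g
    unfolding prod_act_def by (intro mp_prod N.prob_space_axioms pmp_mp[OF assms(1) that] pmp_mp[OF assms(2) that])
  then show ?thesis
    using assms P.prob_space_axioms
    unfolding pmp_action_def measure_preserving_map_def by (auto simp: prod_act_def space_pair_measure)
qed

lemma ergodic_pmp: "ergodic_action G M \<tau> \<Longrightarrow> pmp_action G M \<tau>"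
  by (simp add: ergodic_action_def)

text \<open>\<open>ergodic_action\<close> speaks of strictly invariant sets, so the sublevel set of
  \<open>f\<close> at its mean is replaced by the points whose whole orbit lies in it; countability
  of the group makes the change null. A function lying almost everywhere on one side of its mean is
  equal to it.\<close>

lemma ergodic_invariant_real:
  fixes f :: "'y \<Rightarrow> real"
  assumes G: "group G" "countable (carrier G)" and erg: "ergodic_action G M \<tau>"
    and f[measurable]: "f \<in> borel_measurable M" and B: "\<And>y. y \<in> space M \<Longrightarrow> \<bar>f y\<bar> \<le> B"
    and inv: "\<And>g. g \<in> carrier G \<Longrightarrow> AE y in M. f (\<tau> g y) = f y"
  shows "AE y in M. f y = (\<integral>y. f y \<partial>M)"
proof -
  interpret G: group G by fact
  have pmp: "pmp_action G M \<tau>" using erg by (rule ergodic_pmp)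
  interpret prob_space M using pmp by (simp add: pmp_action_def)
  have \<tau>[measurable]: "\<And>g. g \<in> carrier G \<Longrightarrow> \<tau> g \<in> measurable M M"
    and mult: "\<And>g h y. \<lbrakk>g \<in> carrier G; h \<in> carrier G; y \<in> space M\<rbrakk> \<Longrightarrow> \<tau> (g \<otimes>\<^bsub>G\<^esub> h) y = \<tau> g (\<tau> h y)"
    using pmp unfolding pmp_action_def by auto
  define m where "m = (\<integral>y. f y \<partial>M)"
  define A' where "A' = {y \<in> space M. \<forall>g\<in>carrier G. f (\<tau> g y) \<le> m}"
  have A'[measurable]: "A' \<in> sets M"
  proof -
    have "A' = (\<Inter>g\<in>carrier G. {y \<in> space M. f (\<tau> g y) \<le> m})"
      using G.one_closed by (auto simp: A'_def)
    also have "\<dots> \<in> sets M"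
    proof (rule sets.countable_INT'[OF G(2)])
      show "(\<lambda>g. {y \<in> space M. f (\<tau> g y) \<le> m}) ` carrier G \<subseteq> sets M"
      proof safe
        fix g assume g: "g \<in> carrier G"
        note [measurable] = \<tau>[OF g]
        show "{y \<in> space M. f (\<tau> g y) \<le> m} \<in> sets M" by measurable
      qed
    qed (use G.one_closed in blast)
    finally show ?thesis .
  qed
  have inv': "\<tau> g -` A' \<inter> space M = A'" if g: "g \<in> carrier G" for g
  proof (intro equalityI subsetI)
    fix y assume "y \<in> \<tau> g -` A' \<inter> space M"
    then have y: "y \<in> space M" "\<And>h. h \<in> carrier G \<Longrightarrow> f (\<tau> h (\<tau> g y)) \<le> m" by (auto simp: A'_def)
    have "f (\<tau> h y) \<le> m" if h: "h \<in> carrier G" for h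
      using y(2)[of "h \<otimes>\<^bsub>G\<^esub> inv\<^bsub>G\<^esub> g"] mult[of "h \<otimes>\<^bsub>G\<^esub> inv\<^bsub>G\<^esub> g" g y] y(1) g h by (simp add: G.m_assoc)
    then show "y \<in> A'" using y by (simp add: A'_def)
  next
    fix y assume "y \<in> A'"
    then show "y \<in> \<tau> g -` A' \<inter> space M"
      using mult[of _ g y] g measurable_space[OF \<tau>[OF g]] by (auto simp: A'_def simp flip: mult)
  qed
  then have cases: "emeasure M A' = 0 \<or> emeasure M A' = 1"
    using erg A' unfolding ergodic_action_def by blast
  have "AE y in M. \<forall>g\<in>carrier G. f (\<tau> g y) = f y"
    using inv G(2) by (subst AE_ball_countable) auto
  then have AA': "AE y in M. y \<in> A' \<longleftrightarrow> f y \<le> m"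
    by (rule AE_mp) (use G.one_closed in \<open>auto intro!: AE_I2 simp: A'_def\<close>)
  have int: "integrable M f" using B by (intro integrable_const_bound[where B=B]) auto
  show ?thesis
  proof (cases "emeasure M A' = 0")
    case True
    then have "AE y in M. y \<notin> A'" using A' by (simp add: AE_iff_null_sets null_sets_def flip: AE_iff_null_sets)
    with AA' have ge: "AE y in M. 0 \<le> f y - m" by eventually_elim auto
    have "(\<integral>y. f y - m \<partial>M) = 0" using int by (simp add: m_def prob_space)
    then have "AE y in M. f y - m = 0" using int ge by (subst (asm) integral_nonneg_eq_0_iff_AE) auto
    then show ?thesis by (simp add: m_def)
  next
    case False
    with cases have "prob A' = 1" by (simp add: measure_def)
    then have "AE y in M. y \<in> A'" using prob_eq_1[OF A'] by simp
    with AA' have ge: "AE y in M. 0 \<le> m - f y" by eventually_elim auto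
    have "(\<integral>y. m - f y \<partial>M) = 0" using int by (simp add: m_def prob_space)
    then have "AE y in M. m - f y = 0" using int ge by (subst (asm) integral_nonneg_eq_0_iff_AE) auto
    then show ?thesis by (auto simp: m_def elim!: eventually_mono)
  qed
qed

lemma ergodic_invariant_complex:
  fixes f :: "'y \<Rightarrow> complex"
  assumes G: "group G" "countable (carrier G)" and erg: "ergodic_action G M \<tau>"
    and f[measurable]: "f \<in> borel_measurable M" and B: "\<And>y. y \<in> space M \<Longrightarrow> norm (f y) \<le> B"
    and inv: "\<And>g. g \<in> carrier G \<Longrightarrow> AE y in M. f (\<tau> g y) = f y"
  shows "AE y in M. f y = (\<integral>y. f y \<partial>M)"
proof -
  interpret prob_space M using erg by (simp add: pmp_action_def ergodic_action_def)
  have int: "integrable M f" using B by (intro integrable_const_bound[where B=B]) auto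
  have "AE y in M. Re (f y) = (\<integral>y. Re (f y) \<partial>M)"
  proof (rule ergodic_invariant_real[OF G erg])
    show "AE y in M. Re (f (\<tau> g y)) = Re (f y)" if "g \<in> carrier G" for g using inv[OF that] by eventually_elim simp
  qed (use B abs_Re_le_cmod order_trans in \<open>auto, blast\<close>)
  moreover have "AE y in M. Im (f y) = (\<integral>y. Im (f y) \<partial>M)"
  proof (rule ergodic_invariant_real[OF G erg])
    show "AE y in M. Im (f (\<tau> g y)) = Im (f y)" if "g \<in> carrier G" for g using inv[OF that] by eventually_elim simp
  qed (use B abs_Im_le_cmod order_trans in \<open>auto, blast\<close>)
  ultimately show ?thesis
    by eventually_elim (use int in \<open>simp add: complex_eq_iff\<close>)
qed

text \<open>The centred indicator \<open>T\<close> of an invariant set yields an invariant kernel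
  \<open>K\<close> on the doubled first factor, hence a constant. That constant is the squared norm
  of the marginal \<open>S\<close>, which is an invariant function on \<open>N\<close> of mean zero
  and so vanishes. Then \<open>kernel_zero\<close> applies to \<open>T\<close>.\<close>

lemma ergodic_prod:
  assumes G: "group G" "countable (carrier G)" and M: "pmp_action G M \<tau>"
    and MM: "ergodic_action G (M \<Otimes>\<^sub>M M) (prod_act \<tau> \<tau>)" and N: "ergodic_action G N \<tau>'"
  shows "ergodic_action G (M \<Otimes>\<^sub>M N) (prod_act \<tau> \<tau>')"
  unfolding ergodic_action_def
proof (intro conjI ballI impI)
  show pmp: "pmp_action G (M \<Otimes>\<^sub>M N) (prod_act \<tau> \<tau>')" using M ergodic_pmp[OF N] by (rule pmp_prod)
  interpret M: prob_space M using M by (simp add: pmp_action_def)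
  interpret N: prob_space N using ergodic_pmp[OF N] by (simp add: pmp_action_def)
  interpret pair_prob_space M N ..
  interpret MM: pair_prob_space M M ..
  interpret MMN: pair_prob_space "M \<Otimes>\<^sub>M M" N ..
  fix A assume A[measurable]: "A \<in> sets (M \<Otimes>\<^sub>M N)"
    and inv: "\<forall>g\<in>carrier G. prod_act \<tau> \<tau>' g -` A \<inter> space (M \<Otimes>\<^sub>M N) = A"
  have mpM: "\<And>g. g \<in> carrier G \<Longrightarrow> measure_preserving_map M M (\<tau> g)" using M by (rule pmp_mp)
  have mpN: "\<And>g. g \<in> carrier G \<Longrightarrow> measure_preserving_map N N (\<tau>' g)" using ergodic_pmp[OF N] by (rule pmp_mp)
  define c where "c = P.prob A"
  define T where "T w = complex_of_real (indicator A w - c)" for w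
  have [measurable]: "T \<in> borel_measurable (M \<Otimes>\<^sub>M N)" unfolding T_def by measurable
  have Tb: "norm (T w) \<le> 1" for w
  proof -
    have "0 \<le> c" "c \<le> 1" by (simp_all add: c_def)
    then show ?thesis unfolding T_def norm_of_real by (simp split: split_indicator)
  qed
  have Tinv: "T (\<tau> g y, \<tau>' g z) = T (y, z)" if "g \<in> carrier G" "y \<in> space M" "z \<in> space N" for g y z
  proof -
    have "prod_act \<tau> \<tau>' g -` A \<inter> space (M \<Otimes>\<^sub>M N) = A" using inv that(1) by blast
    moreover have "(y, z) \<in> prod_act \<tau> \<tau>' g -` A \<inter> space (M \<Otimes>\<^sub>M N) \<longleftrightarrow> (\<tau> g y, \<tau>' g z) \<in> A"
      using that by (simp add: prod_act_def space_pair_measure)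
    ultimately have "(y, z) \<in> A \<longleftrightarrow> (\<tau> g y, \<tau>' g z) \<in> A" by simp
    then show ?thesis by (simp add: T_def indicator_def)
  qed
  define S where "S z = (\<integral>y. T (y, z) \<partial>M)" for z
  have [measurable]: "S \<in> borel_measurable N" unfolding S_def by measurable
  have Sb: "norm (S z) \<le> 1" for z
  proof (cases "z \<in> space N")
    case True
    have "norm (S z) \<le> (\<integral>y. norm (T (y, z)) \<partial>M)" unfolding S_def by (rule integral_norm_bound)
    also have "\<dots> \<le> (\<integral>y. 1 \<partial>M)"
      using Tb True by (intro integral_mono M.integrable_const_bound[where B=1]) auto
    finally show ?thesis by (simp add: M.prob_space)
  next
    case False
    have "norm (S z) \<le> (\<integral>y. norm (T (y, z)) \<partial>M)" unfolding S_def by (rule integral_norm_bound)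
    also have "\<dots> \<le> 1"
    proof (cases "integrable M (\<lambda>y. norm (T (y, z)))")
      case True
      then have "(\<integral>y. norm (T (y, z)) \<partial>M) \<le> (\<integral>y. 1 \<partial>M)" using Tb by (intro integral_mono) auto
      then show ?thesis by (simp add: M.prob_space)
    qed (simp add: not_integrable_integral_eq)
    finally show ?thesis .
  qed
  have "AE z in N. S z = (\<integral>z. S z \<partial>N)"
  proof (rule ergodic_invariant_complex[OF G N])
    fix g assume g: "g \<in> carrier G"
    note [measurable] = mp_measurable[OF mpN[OF g]]
    have "S (\<tau>' g z) = S z" if z: "z \<in> space N" for z
    proof -
      have "\<tau>' g z \<in> space N" using measurable_space[OF mp_measurable[OF mpN[OF g]] z] .
      then have "(\<lambda>y. T (y, \<tau>' g z)) \<in> borel_measurable M" by measurable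
      from mp_integral[OF mpM[OF g] this] have "S (\<tau>' g z) = (\<integral>y. T (\<tau> g y, \<tau>' g z) \<partial>M)"
        by (simp add: S_def)
      also have "\<dots> = S z" unfolding S_def
        using g z by (intro Bochner_Integration.integral_cong) (auto simp: Tinv)
      finally show ?thesis .
    qed
    then show "AE z in N. S (\<tau>' g z) = S z" by (intro AE_I2)
  qed (auto intro: Sb)
  moreover have "(\<integral>z. S z \<partial>N) = 0"
  proof -
    have "integrable (M \<Otimes>\<^sub>M N) T" by (rule P.integrable_const_bound[where B=1]) (use Tb in auto)
    then have "(\<integral>z. S z \<partial>N) = (\<integral>w. T w \<partial>(M \<Otimes>\<^sub>M N))"
      unfolding S_def using integral_snd[of "\<lambda>x y. T (x, y)"] by simp
    also have "\<dots> = complex_of_real (\<integral>w. indicator A w - c \<partial>(M \<Otimes>\<^sub>M N))"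
      unfolding T_def by (rule integral_complex_of_real)
    also have "\<dots> = 0"
      by (subst Bochner_Integration.integral_diff) (auto simp: c_def P.prob_space less_top[symmetric])
    finally show ?thesis .
  qed
  ultimately have S0: "AE z in N. S z = 0" by simp
  define K where "K w = (\<integral>z. T (fst w, z) * cnj (T (snd w, z)) \<partial>N)" for w
  have [measurable]: "K \<in> borel_measurable (M \<Otimes>\<^sub>M M)" unfolding K_def by measurable
  have Kb: "norm (K w) \<le> 1" if "w \<in> space (M \<Otimes>\<^sub>M M)" for w
  proof -
    have w: "fst w \<in> space M" "snd w \<in> space M" using that by (auto simp: space_pair_measure)
    have "norm (K w) \<le> (\<integral>z. norm (T (fst w, z) * cnj (T (snd w, z))) \<partial>N)" unfolding K_def by (rule integral_norm_bound)
    also have "\<dots> \<le> (\<integral>z. 1 \<partial>N)"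
      using Tb w by (intro integral_mono N.integrable_const_bound[where B=1]) (auto simp: norm_mult mult_le_one)
    finally show ?thesis by (simp add: N.prob_space)
  qed
  have "AE w in M \<Otimes>\<^sub>M M. K w = (\<integral>w. K w \<partial>(M \<Otimes>\<^sub>M M))"
  proof (rule ergodic_invariant_complex[OF G MM _ Kb])
    fix g assume g: "g \<in> carrier G"
    have "K (prod_act \<tau> \<tau> g w) = K w" if "w \<in> space (M \<Otimes>\<^sub>M M)" for w
    proof -
      have w: "fst w \<in> space M" "snd w \<in> space M" using that by (auto simp: space_pair_measure)
      have w': "\<tau> g (fst w) \<in> space M" "\<tau> g (snd w) \<in> space M"
        using w measurable_space[OF mp_measurable[OF mpM[OF g]]] by auto
      then have "(\<lambda>z. T (\<tau> g (fst w), z) * cnj (T (\<tau> g (snd w), z))) \<in> borel_measurable N" by measurable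
      from mp_integral[OF mpN[OF g] this]
      have "K (prod_act \<tau> \<tau> g w) = (\<integral>z. T (\<tau> g (fst w), \<tau>' g z) * cnj (T (\<tau> g (snd w), \<tau>' g z)) \<partial>N)"
        by (simp add: K_def prod_act_def)
      also have "\<dots> = K w" unfolding K_def
        using g w by (intro Bochner_Integration.integral_cong) (auto simp: Tinv)
      finally show ?thesis .
    qed
    then show "AE w in M \<Otimes>\<^sub>M M. K (prod_act \<tau> \<tau> g w) = K w" by (intro AE_I2)
  qed auto
  moreover have "(\<integral>w. K w \<partial>(M \<Otimes>\<^sub>M M)) = 0"
  proof -
    have "(\<integral>w. K w \<partial>(M \<Otimes>\<^sub>M M)) = (\<integral>z. (\<integral>w. T (fst w, z) * cnj (T (snd w, z)) \<partial>(M \<Otimes>\<^sub>M M)) \<partial>N)"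
      unfolding K_def
      by (rule MMN.Fubini_integral[symmetric], rule MMN.P.integrable_const_bound[where B=1])
         (auto simp: norm_mult split_beta' mult_le_one Tb)
    also have "\<dots> = (\<integral>z. S z * cnj (S z) \<partial>N)"
    proof (rule Bochner_Integration.integral_cong[OF refl])
      fix z assume z: "z \<in> space N"
      show "(\<integral>w. T (fst w, z) * cnj (T (snd w, z)) \<partial>(M \<Otimes>\<^sub>M M)) = S z * cnj (S z)"
        using MM.integral_times_bounded[of "\<lambda>y. T (y, z)" "\<lambda>y. cnj (T (y, z))" 1 1] z Tb by (simp add: S_def)
    qed
    also have "\<dots> = 0" using S0 by (intro integral_eq_zero_AE) auto
    finally show ?thesis .
  qed
  ultimately have "AE w in M \<Otimes>\<^sub>M M. (\<integral>z. T (fst w, z) * cnj (T (snd w, z)) \<partial>N) = 0" by (simp add: K_def)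
  from kernel_zero[OF _ Tb this] have "AE w in M \<Otimes>\<^sub>M N. T w = 0" by simp
  from P.AE_exists[OF this] obtain w where "T w = 0" by blast
  \<comment> \<open>\<open>T\<close> takes only the values \<open>1 - c\<close> and
    \<open>- c\<close>, so a single zero decides the measure of \<open>A\<close>.\<close>
  then have "c = 0 \<or> c = 1" by (cases "w \<in> A") (auto simp: T_def)
  then show "emeasure (M \<Otimes>\<^sub>M N) A = 0 \<or> emeasure (M \<Otimes>\<^sub>M N) A = 1"
    by (auto simp: c_def P.emeasure_eq_measure)
qed

section \<open>Splitting off a scalar coboundary\<close>

lemma circle_simps:
  "z \<in> circle \<Longrightarrow> z \<noteq> 0" "z \<in> circle \<Longrightarrow> norm z = 1"
  "z \<in> circle \<Longrightarrow> w \<in> circle \<Longrightarrow> z * w \<in> circle"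
  "z \<in> circle \<Longrightarrow> inverse z \<in> circle" "z \<in> circle \<Longrightarrow> w \<in> circle \<Longrightarrow> z / w \<in> circle"
  "z \<in> circle \<Longrightarrow> cnj z \<in> circle" "z \<in> circle \<Longrightarrow> z ^ n \<in> circle" "1 \<in> circle"
  by (auto simp: circle_def norm_mult norm_inverse norm_divide norm_power)

lemma circle_cnj: "z \<in> circle \<Longrightarrow> cnj z = inverse z"
  by (simp add: circle_def inverse_eq_divide divide_conv_cnj)

lemma quotient_split:
  fixes a b l u v u' v' :: complex
  assumes "a * inverse b = l * (u * v) * inverse (u' * v')"
    and nz: "b \<noteq> 0" "l \<noteq> 0" "u \<noteq> 0" "v \<noteq> 0" "u' \<noteq> 0" "v' \<noteq> 0"
  shows "b = a * u' * inverse l * inverse u * inverse v * inverse (inverse v')"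
proof -
  have "a * (u' * v') = (a * inverse b) * b * (u' * v')" using nz by simp
  also have "\<dots> = l * (u * v) * b * (inverse (u' * v') * (u' * v'))" unfolding assms(1) by (simp only: mult_ac)
  also have "\<dots> = l * (u * v) * b"
    using left_inverse[of "u' * v'"] nz by (simp del: inverse_mult_distrib)
  finally have "a * (u' * v') = l * (u * v) * b" .
  then have "a * u' * inverse l * inverse u * inverse v * inverse (inverse v') = (l * inverse l) * (u * inverse u) * (v * inverse v) * b"
    by (simp add: mult_ac)
  then show ?thesis using nz by simp
qed

text \<open>With \<open>b\<close> the transfer function on \<open>M \<times> M\<close> of the cocycle \<open>B g x / B g y\<close>, the cross ratio
  \<open>b(x,y) b(z,w) / (b(x,w) b(z,y))\<close> is invariant on \<open>M^4\<close>, hence constant, so \<open>b\<close> splits as a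
  product \<open>u(x) v(y)\<close>.\<close>

theorem untwist:
  assumes G: "group G" "countable (carrier G)" and M: "pmp_action G M \<tau>"
    and sr: "T_cocycle_superrigid G (M \<Otimes>\<^sub>M M) (diag2 \<tau>)"
    and B: "\<And>g. g \<in> carrier G \<Longrightarrow> B g \<in> borel_measurable M"
      "\<And>g y. g \<in> carrier G \<Longrightarrow> y \<in> space M \<Longrightarrow> B g y \<in> circle"
    and d: "\<And>g h. g \<in> carrier G \<Longrightarrow> h \<in> carrier G \<Longrightarrow>
      AE y in M. d g h = B g y * B h (\<tau> (inv\<^bsub>G\<^esub> g) y) * inverse (B (g \<otimes>\<^bsub>G\<^esub> h) y)"
  obtains \<rho> \<phi> where "\<And>g. g \<in> carrier G \<Longrightarrow> \<rho> g \<in> circle" "\<phi> \<in> borel_measurable M"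
    "\<And>y. y \<in> space M \<Longrightarrow> \<phi> y \<in> circle"
    "\<And>g. g \<in> carrier G \<Longrightarrow> AE y in M. B g y = \<rho> g * \<phi> y * inverse (\<phi> (\<tau> (inv\<^bsub>G\<^esub> g) y))"
    "\<And>g h. g \<in> carrier G \<Longrightarrow> h \<in> carrier G \<Longrightarrow> d g h = \<rho> g * \<rho> h * inverse (\<rho> (g \<otimes>\<^bsub>G\<^esub> h))"
proof -
  interpret G: group G by fact
  interpret M: prob_space M using M by (simp add: pmp_action_def)
  interpret MM: pair_prob_space M M ..
  interpret M3: pair_prob_space M "M \<Otimes>\<^sub>M M" ..
  interpret M4: pair_prob_space M "M \<Otimes>\<^sub>M (M \<Otimes>\<^sub>M M)" ..
  note pm = M.prob_space_axioms MM.P.prob_space_axioms M3.P.prob_space_axioms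
  have mpt: "\<And>g. g \<in> carrier G \<Longrightarrow> measure_preserving_map M M (\<tau> g)" using M by (rule pmp_mp)
  have sp: "\<And>g y. g \<in> carrier G \<Longrightarrow> y \<in> space M \<Longrightarrow> \<tau> g y \<in> space M"
    using measurable_space[OF mp_measurable[OF mpt]] .
  have tau_mult: "\<And>g h y. \<lbrakk>g \<in> carrier G; h \<in> carrier G; y \<in> space M\<rbrakk> \<Longrightarrow> \<tau> (g \<otimes>\<^bsub>G\<^esub> h) y = \<tau> g (\<tau> h y)"
    using M unfolding pmp_action_def by auto
  have erg: "ergodic_action G (M \<Otimes>\<^sub>M M) (prod_act \<tau> \<tau>)"
    using sr unfolding T_cocycle_superrigid_def diag2_eq by blast
  \<comment> \<open>Superrigidity provides ergodicity for two copies; four copies are reached by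
    adding one factor at a time.\<close>
  have erg4: "ergodic_action G (M \<Otimes>\<^sub>M (M \<Otimes>\<^sub>M (M \<Otimes>\<^sub>M M))) (prod_act \<tau> (prod_act \<tau> (prod_act \<tau> \<tau>)))"
    by (intro ergodic_prod[OF G M erg] erg)
  \<comment> \<open>The scalar \<open>d\<close> is the same in both coordinates and cancels in the
    quotient, which is therefore a genuine 1-cocycle.\<close>
  define c where "c g w = B g (fst w) * inverse (B g (snd w))" for g w
  have c1: "c g \<in> borel_measurable (M \<Otimes>\<^sub>M M) \<and> (\<forall>w\<in>space (M \<Otimes>\<^sub>M M). c g w \<in> circle)" if g: "g \<in> carrier G" for g
  proof -
    note [measurable] = B(1)[OF g]
    show ?thesis using B(2)[OF g] unfolding c_def by (auto simp: space_pair_measure circle_simps)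
  qed
  have c2: "AE w in M \<Otimes>\<^sub>M M. c (g \<otimes>\<^bsub>G\<^esub> h) w = c g w * c h (diag2 \<tau> (inv\<^bsub>G\<^esub> g) w)"
    if g: "g \<in> carrier G" and h: "h \<in> carrier G" for g h
    using mp_AE[OF mp_fst[OF pm(1)] d[OF g h]] mp_AE[OF mp_snd[OF pm(1) pm(1)] d[OF g h]] AE_space
  proof eventually_elim
    case (elim w)
    have sw: "fst w \<in> space M" "snd w \<in> space M" using elim(3) by (auto simp: space_pair_measure)
    have nz: "B g (fst w) \<noteq> 0" "B g (snd w) \<noteq> 0" "B (g \<otimes>\<^bsub>G\<^esub> h) (fst w) \<noteq> 0" "B (g \<otimes>\<^bsub>G\<^esub> h) (snd w) \<noteq> 0"
      "B h (\<tau> (inv\<^bsub>G\<^esub> g) (fst w)) \<noteq> 0" "B h (\<tau> (inv\<^bsub>G\<^esub> g) (snd w)) \<noteq> 0"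
      using sw g h sp B(2) circle_simps(1) by auto
    define a1 a2 a3 b1 b2 b3 where "a1 = B g (fst w)" "a2 = B h (\<tau> (inv\<^bsub>G\<^esub> g) (fst w))" "a3 = B (g \<otimes>\<^bsub>G\<^esub> h) (fst w)"
      "b1 = B g (snd w)" "b2 = B h (\<tau> (inv\<^bsub>G\<^esub> g) (snd w))" "b3 = B (g \<otimes>\<^bsub>G\<^esub> h) (snd w)"
    note defs = this[symmetric]
    have "a1 * a2 * b3 = b1 * b2 * a3"
      using elim(1,2) nz unfolding defs by (simp add: divide_simps mult_ac)
    then show ?case using nz unfolding c_def diag2_eq prod_act_def fst_conv snd_conv defs by (simp add: divide_simps mult_ac)
  qed
  obtain lam b where lam: "\<And>g. g \<in> carrier G \<Longrightarrow> lam g \<in> circle"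
    and b[measurable]: "b \<in> borel_measurable (M \<Otimes>\<^sub>M M)" and bc: "\<And>w. w \<in> space (M \<Otimes>\<^sub>M M) \<Longrightarrow> b w \<in> circle"
    and cb: "\<And>g. g \<in> carrier G \<Longrightarrow> AE w in M \<Otimes>\<^sub>M M. c g w = lam g * b w * inverse (b (diag2 \<tau> (inv\<^bsub>G\<^esub> g) w))"
  proof -
    have "(\<forall>g\<in>carrier G. c g \<in> borel_measurable (M \<Otimes>\<^sub>M M) \<and> (\<forall>y\<in>space (M \<Otimes>\<^sub>M M). c g y \<in> circle)) \<and>
      (\<forall>g\<in>carrier G. \<forall>h\<in>carrier G. AE y in M \<Otimes>\<^sub>M M. c (g \<otimes>\<^bsub>G\<^esub> h) y = c g y * c h (diag2 \<tau> (inv\<^bsub>G\<^esub> g) y))"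
      using c1 c2 by simp
    from mp[OF spec[OF sr[unfolded T_cocycle_superrigid_def, THEN conjunct2, THEN conjunct2], of c] this]
    show thesis by (elim exE conjE) (rule that, auto)
  qed
  have bc': "b (x, y) \<in> circle" if "x \<in> space M" "y \<in> space M" for x y using bc that by (simp add: space_pair_measure)
  define F where "F q = (let z = fst q; w = fst (snd q); x = fst (snd (snd q)); y = snd (snd (snd q)) in
    b (x, y) * b (z, w) * inverse (b (x, w)) * inverse (b (z, y)))" for q
  let ?Q = "M \<Otimes>\<^sub>M (M \<Otimes>\<^sub>M (M \<Otimes>\<^sub>M M))"
  have Fm: "F \<in> borel_measurable ?Q" unfolding F_def Let_def by measurable
  have Fc: "F q \<in> circle" if "q \<in> space ?Q" for q
    using that unfolding F_def Let_def by (auto simp: space_pair_measure intro!: circle_simps bc')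
  have Finv: "AE q in ?Q. F (prod_act \<tau> (prod_act \<tau> (prod_act \<tau> \<tau>)) g q) = F q" if g: "g \<in> carrier G" for g
  proof -
    have g': "inv\<^bsub>G\<^esub> g \<in> carrier G" using g by simp
    \<comment> \<open>The transfer equation shifts by the inverse of the group element, so it is
      used at the inverse of \<open>g\<close> to describe a shift by \<open>g\<close>. In the cross
      ratio the factors \<open>lam\<close> and \<open>B\<close> then occur equally often above and
      below.\<close>
    have P: "AE w in M \<Otimes>\<^sub>M M. c (inv\<^bsub>G\<^esub> g) w * b (\<tau> g (fst w), \<tau> g (snd w)) = lam (inv\<^bsub>G\<^esub> g) * b w"
      using cb[OF g'] AE_space
    proof eventually_elim
      case (elim w)
      then have "b (\<tau> g (fst w), \<tau> g (snd w)) \<noteq> 0" using bc' sp[OF g] circle_simps(1) by (auto simp: space_pair_measure)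
      then show ?case using elim(1) g by (simp add: diag2_eq prod_act_def)
    qed
    have m1: "measure_preserving_map ?Q (M \<Otimes>\<^sub>M M) (\<lambda>q. (fst (snd (snd q)), snd (snd (snd q))))"
      using mp_comp[OF mp_comp[OF mp_snd[OF pm(1) pm(3)] mp_snd[OF pm(1) pm(2)]] mp_id] by simp
    have m2: "measure_preserving_map ?Q (M \<Otimes>\<^sub>M M) (\<lambda>q. (fst q, fst (snd q)))"
      by (rule mp_prod[OF pm(1) mp_id mp_fst[OF pm(2)]])
    have m3: "measure_preserving_map ?Q (M \<Otimes>\<^sub>M M) (\<lambda>q. (fst q, snd (snd (snd q))))"
      by (rule mp_prod[OF pm(1) mp_id mp_comp[OF mp_snd[OF pm(1) pm(2)] mp_snd[OF pm(1) pm(1)]]])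
    have m4: "measure_preserving_map ?Q (M \<Otimes>\<^sub>M M) (\<lambda>q. (fst (snd (snd q)), fst (snd q)))"
      using mp_comp[OF mp_snd[OF pm(1) pm(3)] mp_comp[OF mp_prod[OF pm(1) mp_id mp_fst[OF pm(1)]] mp_swap[OF pm(1) pm(1)]]] by simp
    show ?thesis using mp_AE[OF m1 P] mp_AE[OF m2 P] mp_AE[OF m3 P] mp_AE[OF m4 P] AE_space
    proof eventually_elim
      case (elim q)
      define z w x y where "z = fst q" and "w = fst (snd q)" and "x = fst (snd (snd q))" and "y = snd (snd (snd q))"
      note defs = z_def[symmetric] w_def[symmetric] x_def[symmetric] y_def[symmetric]
      have s: "z \<in> space M" "w \<in> space M" "x \<in> space M" "y \<in> space M"
        using elim(5) by (auto simp: space_pair_measure z_def w_def x_def y_def)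
      let ?B = "B (inv\<^bsub>G\<^esub> g)"
      let ?l = "lam (inv\<^bsub>G\<^esub> g)"
      have nz: "?B z \<noteq> 0" "?B w \<noteq> 0" "?B x \<noteq> 0" "?B y \<noteq> 0" "?l \<noteq> 0"
        using s B(2)[OF g'] lam[OF g'] circle_simps(1) by blast+
      have nzb: "b (x, y) \<noteq> 0" "b (z, w) \<noteq> 0" "b (x, w) \<noteq> 0" "b (z, y) \<noteq> 0"
        using s bc' circle_simps(1) by blast+
      have e: "b (\<tau> g x, \<tau> g y) = ?l * b (x, y) * ?B y / ?B x" "b (\<tau> g z, \<tau> g w) = ?l * b (z, w) * ?B w / ?B z"
        "b (\<tau> g z, \<tau> g y) = ?l * b (z, y) * ?B y / ?B z" "b (\<tau> g x, \<tau> g w) = ?l * b (x, w) * ?B w / ?B x"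
        using elim(1-4) nz unfolding c_def fst_conv snd_conv defs by (simp_all add: field_simps)
      show ?case
        unfolding F_def Let_def prod_act_def fst_conv snd_conv defs e using nz nzb by (simp add: field_simps)
    qed
  qed
  define C where "C = (\<integral>q. F q \<partial>?Q)"
  have FC: "AE q in ?Q. F q = C"
    unfolding C_def by (rule ergodic_invariant_complex[OF G erg4 Fm _ Finv, of 1]) (use Fc circle_simps(2) in auto)
  obtain q0 where "q0 \<in> space ?Q" "F q0 = C" using M4.P.AE_exists[OF FC] by blast
  then have Cc: "C \<in> circle" using Fc by blast
  \<comment> \<open>Freezing first \<open>z\<close> and then \<open>w\<close> at good values leaves
    an identity in \<open>x\<close> and \<open>y\<close> that displays \<open>b\<close> as a
    product.\<close>
  obtain z where z: "z \<in> space M" "AE r in M \<Otimes>\<^sub>M (M \<Otimes>\<^sub>M M). F (z, r) = C"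
    using M.AE_exists[OF M4.AE_pair[OF FC]] by blast
  obtain w where w: "w \<in> space M" "AE v in M \<Otimes>\<^sub>M M. F (z, (w, v)) = C"
    using M.AE_exists[OF M3.AE_pair[OF z(2)]] by blast
  define u where "u x = C * b (x, w) * inverse (b (z, w))" for x
  define v where "v y = b (z, y)" for y
  have vm[measurable]: "v \<in> borel_measurable M" unfolding v_def using z by measurable
  have vc: "y \<in> space M \<Longrightarrow> v y \<in> circle" for y unfolding v_def using z bc' by blast
  have uc: "x \<in> space M \<Longrightarrow> u x \<in> circle" for x unfolding u_def using z w Cc by (intro circle_simps bc') auto
  have split: "AE r in M \<Otimes>\<^sub>M M. b r = u (fst r) * v (snd r)"
    using w(2) AE_space
  proof eventually_elim
    case (elim r)
    then have "fst r \<in> space M" "snd r \<in> space M" by (auto simp: space_pair_measure)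
    then have nz: "b (z, w) \<noteq> 0" "b (fst r, w) \<noteq> 0" "b (z, snd r) \<noteq> 0" using bc' z w circle_simps(1) by blast+
    have "C = b r * b (z, w) * inverse (b (fst r, w)) * inverse (b (z, snd r))"
      using elim(1) by (simp add: F_def)
    then have "u (fst r) * v (snd r) = b r * (b (z, w) * inverse (b (z, w))) * (inverse (b (fst r, w)) * b (fst r, w)) * (inverse (b (z, snd r)) * b (z, snd r))"
      unfolding u_def v_def by (simp only: mult_ac)
    then show ?case using nz by simp
  qed
  \<comment> \<open>The variables are separated by freezing one good \<open>x\<close>: all that
    depends on it is collected in a number, which becomes the value of \<open>\<rho>\<close> at
    \<open>g\<close>.\<close>
  have "\<exists>r. r \<in> circle \<and> (AE y in M. B g y = r * inverse (v y) * inverse (inverse (v (\<tau> (inv\<^bsub>G\<^esub> g) y))))"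
    if g: "g \<in> carrier G" for g
  proof -
    have g': "inv\<^bsub>G\<^esub> g \<in> carrier G" using g by simp
    have "AE r in M \<Otimes>\<^sub>M M. B g (fst r) * inverse (B g (snd r)) =
       lam g * (u (fst r) * v (snd r)) * inverse (u (\<tau> (inv\<^bsub>G\<^esub> g) (fst r)) * v (\<tau> (inv\<^bsub>G\<^esub> g) (snd r)))"
      using cb[OF g] split mp_AE[OF mp_prod[OF pm(1) mpt[OF g'] mpt[OF g']] split]
      by eventually_elim (simp add: c_def diag2_eq prod_act_def)
    from M.AE_exists[OF MM.AE_pair[OF this]] obtain x where x: "x \<in> space M"
      and ae: "AE y in M. B g x * inverse (B g y) =
       lam g * (u x * v y) * inverse (u (\<tau> (inv\<^bsub>G\<^esub> g) x) * v (\<tau> (inv\<^bsub>G\<^esub> g) y))" by auto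
    define r where "r = B g x * u (\<tau> (inv\<^bsub>G\<^esub> g) x) * inverse (lam g) * inverse (u x)"
    have "r \<in> circle" unfolding r_def using x g g' by (intro circle_simps B uc sp lam)
    moreover have "AE y in M. B g y = r * inverse (v y) * inverse (inverse (v (\<tau> (inv\<^bsub>G\<^esub> g) y)))"
      using ae AE_space
    proof eventually_elim
      case (elim y)
      have "B g x \<noteq> 0" "B g y \<noteq> 0" "lam g \<noteq> 0" "u x \<noteq> 0" "v y \<noteq> 0" "u (\<tau> (inv\<^bsub>G\<^esub> g) x) \<noteq> 0" "v (\<tau> (inv\<^bsub>G\<^esub> g) y) \<noteq> 0"
        using elim(2) x g g' by (auto intro!: circle_simps(1) B(2) lam uc vc sp)
      then show ?case unfolding r_def by (intro quotient_split[OF elim(1)])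
    qed
    ultimately show ?thesis by blast
  qed
  then obtain \<rho> where \<rho>: "\<And>g. g \<in> carrier G \<Longrightarrow> \<rho> g \<in> circle"
    "\<And>g. g \<in> carrier G \<Longrightarrow> AE y in M. B g y = \<rho> g * inverse (v y) * inverse (inverse (v (\<tau> (inv\<^bsub>G\<^esub> g) y)))"
    by metis
  \<comment> \<open>The factors of \<open>v\<close> telescope, and an identity between constants
    that holds almost everywhere holds outright.\<close>
  have dd: "d g h = \<rho> g * \<rho> h * inverse (\<rho> (g \<otimes>\<^bsub>G\<^esub> h))" if g: "g \<in> carrier G" and h: "h \<in> carrier G" for g h
  proof -
    have g': "inv\<^bsub>G\<^esub> g \<in> carrier G" and h': "inv\<^bsub>G\<^esub> h \<in> carrier G" and gh: "g \<otimes>\<^bsub>G\<^esub> h \<in> carrier G" using g h by auto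
    have "AE y in M. d g h = \<rho> g * \<rho> h * inverse (\<rho> (g \<otimes>\<^bsub>G\<^esub> h))"
      using d[OF g h] \<rho>(2)[OF g] \<rho>(2)[OF gh] mp_AE[OF mpt[OF g'] \<rho>(2)[OF h]] AE_space
    proof eventually_elim
      case (elim y)
      have "\<tau> (inv\<^bsub>G\<^esub> (g \<otimes>\<^bsub>G\<^esub> h)) y = \<tau> (inv\<^bsub>G\<^esub> h) (\<tau> (inv\<^bsub>G\<^esub> g) y)"
        using g h elim(5) by (simp add: G.inv_mult_group tau_mult)
      moreover have "v y \<noteq> 0" "v (\<tau> (inv\<^bsub>G\<^esub> g) y) \<noteq> 0" "v (\<tau> (inv\<^bsub>G\<^esub> h) (\<tau> (inv\<^bsub>G\<^esub> g) y)) \<noteq> 0" "\<rho> (g \<otimes>\<^bsub>G\<^esub> h) \<noteq> 0"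
        using g' h' elim(5) gh by (auto intro!: circle_simps(1) \<rho>(1) vc sp)
      ultimately show ?case unfolding elim(1) elim(2-4) by (simp add: field_simps)
    qed
    then show ?thesis using M.AE_exists by blast
  qed
  show ?thesis
    by (rule that[of \<rho> "\<lambda>y. inverse (v y)"]) (use \<rho> dd vc in \<open>auto intro: circle_simps\<close>)
qed

section \<open>Twisted invariance of kernels\<close>

text \<open>Fubini over the first coordinate: each fibre is moved by a measure preserving map. Meant
  for shears such as \<open>(x, y) \<mapsto> (x, x + y)\<close>.\<close>

lemma mp_skew:
  assumes M: "prob_space M" and N: "prob_space N" and L: "prob_space L"
    and m: "(\<lambda>w. h (fst w) (snd w)) \<in> measurable (M \<Otimes>\<^sub>M N) L"
    and mp: "\<And>x. x \<in> space M \<Longrightarrow> measure_preserving_map N L (h x)"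
  shows "measure_preserving_map (M \<Otimes>\<^sub>M N) (M \<Otimes>\<^sub>M L) (\<lambda>w. (fst w, h (fst w) (snd w)))"
    (is "measure_preserving_map _ _ ?f")
proof -
  interpret M: prob_space M by fact
  interpret N: prob_space N by fact
  interpret L: prob_space L by fact
  have f: "?f \<in> measurable (M \<Otimes>\<^sub>M N) (M \<Otimes>\<^sub>M L)" using m by (intro measurable_Pair measurable_fst)
  have "distr (M \<Otimes>\<^sub>M N) (M \<Otimes>\<^sub>M L) ?f = M \<Otimes>\<^sub>M L"
  proof (rule measure_eqI)
    fix A assume "A \<in> sets (distr (M \<Otimes>\<^sub>M N) (M \<Otimes>\<^sub>M L) ?f)"
    then have A: "A \<in> sets (M \<Otimes>\<^sub>M L)" by simp
    have "emeasure (distr (M \<Otimes>\<^sub>M N) (M \<Otimes>\<^sub>M L) ?f) A = emeasure (M \<Otimes>\<^sub>M N) (?f -` A \<inter> space (M \<Otimes>\<^sub>M N))"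
      using A by (rule emeasure_distr[OF f])
    also have "\<dots> = (\<integral>\<^sup>+ x. emeasure N (Pair x -` (?f -` A \<inter> space (M \<Otimes>\<^sub>M N))) \<partial>M)"
      by (rule N.emeasure_pair_measure_alt[OF measurable_sets[OF f A]])
    also have "\<dots> = (\<integral>\<^sup>+ x. emeasure L (Pair x -` A) \<partial>M)"
    proof (rule nn_integral_cong)
      fix x assume x: "x \<in> space M"
      have "Pair x -` (?f -` A \<inter> space (M \<Otimes>\<^sub>M N)) = h x -` (Pair x -` A) \<inter> space N"
        using x by (auto simp: space_pair_measure)
      also have "emeasure N \<dots> = emeasure (distr N L (h x)) (Pair x -` A)"
        by (rule emeasure_distr[symmetric, OF mp_measurable[OF mp[OF x]] sets_Pair1[OF A]])
      also have "\<dots> = emeasure L (Pair x -` A)" using mp[OF x] by (simp add: measure_preserving_map_def)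
      finally show "emeasure N (Pair x -` (?f -` A \<inter> space (M \<Otimes>\<^sub>M N))) = emeasure L (Pair x -` A)" .
    qed
    also have "\<dots> = emeasure (M \<Otimes>\<^sub>M L) A" by (rule L.emeasure_pair_measure_alt[OF A, symmetric])
    finally show "emeasure (distr (M \<Otimes>\<^sub>M N) (M \<Otimes>\<^sub>M L) ?f) A = emeasure (M \<Otimes>\<^sub>M L) A" .
  qed simp
  with f show ?thesis by (simp add: measure_preserving_map_def)
qed

lemma mp_assoc:
  assumes M: "prob_space M" and N: "prob_space N" and L: "prob_space L"
  shows "measure_preserving_map ((M \<Otimes>\<^sub>M N) \<Otimes>\<^sub>M L) (M \<Otimes>\<^sub>M (N \<Otimes>\<^sub>M L)) (\<lambda>w. (fst (fst w), (snd (fst w), snd w)))"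
    (is "measure_preserving_map ?P ?Q ?f")
proof -
  interpret M: prob_space M by fact
  interpret N: prob_space N by fact
  interpret L: prob_space L by fact
  interpret NL: pair_prob_space N L ..
  interpret MN: pair_prob_space M N ..
  have f: "?f \<in> measurable ?P ?Q" by measurable
  have "distr ?P ?Q ?f = ?Q"
  proof (rule measure_eqI)
    fix A assume "A \<in> sets (distr ?P ?Q ?f)"
    then have A[measurable]: "A \<in> sets ?Q" by simp
    have "emeasure (distr ?P ?Q ?f) A = emeasure ?P (?f -` A \<inter> space ?P)"
      using A by (rule emeasure_distr[OF f])
    also have "\<dots> = (\<integral>\<^sup>+ w. emeasure L (Pair w -` (?f -` A \<inter> space ?P)) \<partial>(M \<Otimes>\<^sub>M N))"
      by (rule L.emeasure_pair_measure_alt[OF measurable_sets[OF f A]])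
    also have "\<dots> = (\<integral>\<^sup>+ x. (\<integral>\<^sup>+ y. emeasure L (Pair (x, y) -` (?f -` A \<inter> space ?P)) \<partial>N) \<partial>M)"
      by (rule N.nn_integral_fst[symmetric]) (rule L.measurable_emeasure_Pair[OF measurable_sets[OF f A]])
    also have "\<dots> = (\<integral>\<^sup>+ x. (\<integral>\<^sup>+ y. emeasure L (Pair y -` (Pair x -` A)) \<partial>N) \<partial>M)"
    proof (intro nn_integral_cong)
      fix x y assume "x \<in> space M" "y \<in> space N"
      then have "Pair (x, y) -` (?f -` A \<inter> space ?P) = Pair y -` (Pair x -` A)"
        using sets.sets_into_space[OF A] by (auto simp: space_pair_measure)
      then show "emeasure L (Pair (x, y) -` (?f -` A \<inter> space ?P)) = emeasure L (Pair y -` (Pair x -` A))" by simp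
    qed
    also have "\<dots> = (\<integral>\<^sup>+ x. emeasure (N \<Otimes>\<^sub>M L) (Pair x -` A) \<partial>M)"
      by (intro nn_integral_cong L.emeasure_pair_measure_alt[symmetric] sets_Pair1[OF A])
    also have "\<dots> = emeasure ?Q A" by (rule NL.P.emeasure_pair_measure_alt[OF A, symmetric])
    finally show "emeasure (distr ?P ?Q ?f) A = emeasure ?Q A" .
  qed simp
  with f show ?thesis by (simp add: measure_preserving_map_def)
qed

text \<open>For measure preserving \<open>h\<close> and circle valued \<open>a\<close> this is the
  intertwining relation U L = c L U, where U sends a function \<open>f\<close> to
  \<open>\<lambda>x. cnj (a x) * f (h x)\<close>, written on the level of kernels.\<close>

definition twisted :: "'a measure \<Rightarrow> ('a \<Rightarrow> 'a) \<Rightarrow> ('a \<Rightarrow> complex) \<Rightarrow> complex \<Rightarrow> ('a \<times> 'a \<Rightarrow> complex) \<Rightarrow> bool" where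
  "twisted M h a c L \<longleftrightarrow> (AE w in M \<Otimes>\<^sub>M M. L (h (fst w), h (snd w)) = c * L w * a (fst w) * cnj (a (snd w)))"

context kernel_space
begin

lemma AE_swap2: "AE w in M \<Otimes>\<^sub>M M. P (fst w) (snd w) \<Longrightarrow> AE t in M. AE x in M. P x t"
  using Q.AE_pair[OF mp_AE[OF mp_swap[OF prob_space_axioms prob_space_axioms]]] by fastforce

text \<open>Substituting \<open>h z\<close> for the inner integration variable creates the factor
  \<open>cnj (a z) * a z\<close>, which is 1.\<close>

lemma twisted_kcomp:
  assumes h: "measure_preserving_map M M h" and a: "\<And>x. a x \<in> circle"
    and K: "bounded_kernel M K B" "twisted M h a c K" and L: "bounded_kernel M L D" "twisted M h a d L"
  shows "twisted M h a (c * d) (kcomp M K L)"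
proof -
  note m = section_measurable[OF bounded_kernelD(1)[OF K(1)]] section_measurable[OF bounded_kernelD(1)[OF L(1)]]
  have k: "AE w in M \<Otimes>\<^sub>M M. AE z in M. K (h (fst w), h z) = c * K (fst w, z) * a (fst w) * cnj (a z)"
    using mp_AE[OF mp_fst[OF prob_space_axioms] Q.AE_pair[OF K(2)[unfolded twisted_def]]] by simp
  have "AE t in M. AE z in M. L (h z, h t) = d * L (z, t) * a z * cnj (a t)"
    using AE_swap2[of "\<lambda>z t. L (h z, h t) = d * L (z, t) * a z * cnj (a t)"] L(2) by (simp add: twisted_def)
  from mp_AE[OF mp_snd[OF prob_space_axioms prob_space_axioms] this]
  have l: "AE w in M \<Otimes>\<^sub>M M. AE z in M. L (h z, h (snd w)) = d * L (z, snd w) * a z * cnj (a (snd w))" by simp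
  show ?thesis unfolding twisted_def using k l
  proof eventually_elim
    case (elim w)
    have aa: "cnj (a z) * a z = 1" for z using a[of z] by (simp add: circle_cnj circle_simps(1))
    have "kcomp M K L (h (fst w), h (snd w)) = (\<integral>z. K (h (fst w), h z) * L (h z, h (snd w)) \<partial>M)"
      unfolding kcomp_def fst_conv snd_conv
      by (rule mp_integral[OF h, symmetric]) (intro borel_measurable_times m)
    also have "\<dots> = (\<integral>z. (c * d * a (fst w) * cnj (a (snd w))) * (K (fst w, z) * L (z, snd w)) \<partial>M)"
    proof (rule integral_cong_AE)
      show "(\<lambda>z. K (h (fst w), h z) * L (h z, h (snd w))) \<in> borel_measurable M"
        by (intro borel_measurable_times measurable_compose[OF mp_measurable[OF h] m(1)] measurable_compose[OF mp_measurable[OF h] m(5)])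
      show "(\<lambda>z. (c * d * a (fst w) * cnj (a (snd w))) * (K (fst w, z) * L (z, snd w))) \<in> borel_measurable M"
        by (intro borel_measurable_times m borel_measurable_const)
      show "AE z in M. K (h (fst w), h z) * L (h z, h (snd w)) = (c * d * a (fst w) * cnj (a (snd w))) * (K (fst w, z) * L (z, snd w))"
        using elim(1,2)
      proof eventually_elim
        case (elim z)
        have "K (h (fst w), h z) * L (h z, h (snd w)) = (cnj (a z) * a z) * ((c * d * a (fst w) * cnj (a (snd w))) * (K (fst w, z) * L (z, snd w)))"
          unfolding elim by (simp only: mult_ac)
        then show ?case by (simp add: aa)
      qed
    qed
    also have "\<dots> = (c * d * a (fst w) * cnj (a (snd w))) * kcomp M K L w"
      unfolding kcomp_def by (rule integral_mult_right_zero)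
    finally show ?case by (simp only: mult_ac)
  qed
qed

lemma twisted_adjoint:
  assumes "twisted M h a c T"
  shows "twisted M h a (cnj c) (\<lambda>w. cnj (T (snd w, fst w)))"
  using mp_AE[OF mp_swap[OF prob_space_axioms prob_space_axioms] assms[unfolded twisted_def]]
  unfolding twisted_def by eventually_elim (simp add: mult_ac)

lemma twisted_kpow:
  assumes "measure_preserving_map M M h" "\<And>x. a x \<in> circle" "bounded_kernel M K B" "twisted M h a 1 K"
  shows "twisted M h a 1 (kpow M K n)"
proof (induct n)
  case 0 then show ?case using assms by simp
next
  case (Suc n) then show ?case using twisted_kcomp[OF assms kpow_bounded[OF assms(3)] Suc] by simp
qed

lemma twisted_limit:
  assumes L: "\<And>n::nat. twisted M h a 1 (L n)" and lim: "\<And>w. (\<lambda>n. complex_of_real (s n) * L n w) \<longlonglongrightarrow> p w"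
  shows "twisted M h a 1 p"
proof -
  have "AE w in M \<Otimes>\<^sub>M M. \<forall>n. L n (h (fst w), h (snd w)) = 1 * L n w * a (fst w) * cnj (a (snd w))"
    using L unfolding twisted_def by (simp add: AE_all_countable)
  then show ?thesis unfolding twisted_def
  proof eventually_elim
    case (elim w)
    have "(\<lambda>n. complex_of_real (s n) * L n (h (fst w), h (snd w))) \<longlonglongrightarrow> p w * a (fst w) * cnj (a (snd w))"
      using elim tendsto_mult_right[OF tendsto_mult_right[OF lim[of w], of "a (fst w)"], of "cnj (a (snd w))"]
      by (simp add: mult_ac)
    then show ?case using LIMSEQ_unique[OF lim] by simp
  qed
qed

section \<open>Matrices of the twisted translations\<close>

text \<open>The matrix coefficients of the operator U of \<open>twisted\<close>. Row
  \<open>i\<close> holds the coordinates of the image of \<open>e i\<close>, so composing operators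
  multiplies the matrices in reverse order.\<close>

definition transition :: "('a \<Rightarrow> 'a) \<Rightarrow> ('a \<Rightarrow> complex) \<Rightarrow> (nat \<Rightarrow> 'a \<Rightarrow> complex) \<Rightarrow> nat \<Rightarrow> nat \<Rightarrow> complex" where
  "transition h a e i j = (\<integral>x. cnj (a x) * e i (h x) * cnj (e j x) \<partial>M)"

text \<open>\<open>p\<close> commutes with the twisted translation, so its range is invariant and
  the image of \<open>e i\<close> can be expanded in the basis again.\<close>

lemma transition_basis:
  fixes n :: nat
  assumes h: "measure_preserving_map M M h" and a: "\<And>x. a x \<in> circle" "a \<in> borel_measurable M"
    and e: "\<And>i. i < n \<Longrightarrow> e i \<in> borel_measurable M" "\<And>i x. i < n \<Longrightarrow> norm (e i x) \<le> B"
    and p: "p \<in> borel_measurable (M \<Otimes>\<^sub>M M)" "twisted M h a 1 p"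
    and pe: "\<And>i x. i < n \<Longrightarrow> (\<integral>t. p (x, t) * e i t \<partial>M) = e i x"
    and sum: "\<And>x t. p (x, t) = (\<Sum>i<n. e i x * cnj (e i t))"
    and i: "i < n"
  shows "AE x in M. e i (h x) = a x * (\<Sum>j<n. transition h a e i j * e j x)"
  using Q.AE_pair[OF p(2)[unfolded twisted_def]]
proof eventually_elim
  case (elim x)
  note em = e(1)
  note [measurable] = a(2) mp_measurable[OF h]
  have ehm: "(\<lambda>t. e i (h t)) \<in> borel_measurable M" using measurable_compose[OF mp_measurable[OF h] em[OF i]] .
  have "e i (h x) = (\<integral>t. p (h x, h t) * e i (h t) \<partial>M)"
    unfolding pe[OF i, of "h x", symmetric]
    by (rule mp_integral[OF h, symmetric]) (intro borel_measurable_times section_measurable[OF p(1)] em[OF i])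
  also have "\<dots> = (\<integral>t. (\<Sum>j<n. (a x * e j x) * (cnj (a t) * e i (h t) * cnj (e j t))) \<partial>M)"
  proof (rule integral_cong_AE)
    show "(\<lambda>t. p (h x, h t) * e i (h t)) \<in> borel_measurable M"
      by (intro borel_measurable_times measurable_compose[OF mp_measurable[OF h] section_measurable(1)[OF p(1)]] ehm)
    show "(\<lambda>t. (\<Sum>j<n. (a x * e j x) * (cnj (a t) * e i (h t) * cnj (e j t)))) \<in> borel_measurable M"
      by (intro borel_measurable_sum borel_measurable_times borel_measurable_const ehm measurable_compose[OF _ borel_measurable_cnj] a(2) em) auto
    show "AE t in M. p (h x, h t) * e i (h t) = (\<Sum>j<n. (a x * e j x) * (cnj (a t) * e i (h t) * cnj (e j t)))"
      using elim
      by eventually_elim (simp add: sum sum_distrib_left sum_distrib_right mult_ac)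
  qed
  also have "\<dots> = (\<Sum>j<n. (a x * e j x) * transition h a e i j)"
  proof (subst Bochner_Integration.integral_sum)
    fix j assume "j \<in> {..<n}"
    then have j: "j < n" by simp
    have B: "0 \<le> B" using e(2)[OF i] norm_ge_zero order_trans by blast
    show "integrable M (\<lambda>t. (a x * e j x) * (cnj (a t) * e i (h t) * cnj (e j t)))"
      by (rule bounded_integrable[where B="(1 * B) * (1 * B * B)"])
         (use e(2) i j B a(1) in \<open>auto simp: norm_mult circle_simps(2) intro!: mult_mono
            borel_measurable_times borel_measurable_const ehm measurable_compose[OF _ borel_measurable_cnj] a(2) em\<close>)
  qed (simp add: transition_def)
  finally show ?case by (simp add: sum_distrib_left mult_ac)
qed

lemma expansion_inner:
  fixes n :: nat
  assumes e: "\<And>i. i < n \<Longrightarrow> e i \<in> borel_measurable M" "\<And>i x. i < n \<Longrightarrow> norm (e i x) \<le> B"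
    and orth: "\<And>i j. i < n \<Longrightarrow> j < n \<Longrightarrow> (\<integral>x. e i x * cnj (e j x) \<partial>M) = (if i = j then 1 else 0)"
    and k: "k < n"
  shows "(\<integral>x. (\<Sum>j<n. m j * e j x) * cnj (e k x) \<partial>M) = m k"
    and "integrable M (\<lambda>x. (\<Sum>j<n. m j * e j x) * cnj (e k x))"
proof -
  have i: "integrable M (\<lambda>x. e i x * cnj (e j x))" if "i < n" "j < n" for i j
  proof -
    have B: "0 \<le> B" using e(2)[OF k] norm_ge_zero order_trans by blast
    show ?thesis
      by (rule bounded_integrable[where B="B * B"])
         (use e that B in \<open>auto simp: norm_mult intro!: mult_mono borel_measurable_times measurable_compose[OF _ borel_measurable_cnj]\<close>)
  qed
  have eq: "(\<lambda>x. (\<Sum>j<n. m j * e j x) * cnj (e k x)) = (\<lambda>x. \<Sum>j<n. m j * (e j x * cnj (e k x)))"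
    unfolding sum_distrib_right by (simp only: mult.assoc)
  show "integrable M (\<lambda>x. (\<Sum>j<n. m j * e j x) * cnj (e k x))"
    unfolding eq using i k by (intro Bochner_Integration.integrable_sum integrable_mult_right) auto
  have "(\<integral>x. (\<Sum>j<n. m j * e j x) * cnj (e k x) \<partial>M) = (\<Sum>j<n. m j * (\<integral>x. e j x * cnj (e k x) \<partial>M))"
    unfolding eq using i k by (subst Bochner_Integration.integral_sum) (auto intro!: integrable_mult_right)
  also have "\<dots> = (\<Sum>j<n. if j = k then m j else 0)" using orth k by (intro sum.cong) auto
  also have "\<dots> = m k" using k by simp
  finally show "(\<integral>x. (\<Sum>j<n. m j * e j x) * cnj (e k x) \<partial>M) = m k" .
qed

text \<open>The twisted translation is isometric: \<open>h\<close> preserves the measure and the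
  unimodular factor \<open>a\<close> cancels against its conjugate.\<close>

lemma transition_unitary:
  fixes n :: nat
  assumes h: "measure_preserving_map M M h" and a: "\<And>x. a x \<in> circle"
    and e: "\<And>i. i < n \<Longrightarrow> e i \<in> borel_measurable M" "\<And>i x. i < n \<Longrightarrow> norm (e i x) \<le> B"
    and orth: "\<And>i j. i < n \<Longrightarrow> j < n \<Longrightarrow> (\<integral>x. e i x * cnj (e j x) \<partial>M) = (if i = j then 1 else 0)"
    and tb: "\<And>i. i < n \<Longrightarrow> AE x in M. e i (h x) = a x * (\<Sum>j<n. m i j * e j x)"
    and i: "i < n" and j: "j < n"
  shows "(\<Sum>k<n. m i k * cnj (m j k)) = (if i = j then 1 else 0)"
proof -
  have em: "(\<lambda>x. \<Sum>k<n. m i k * e k x) \<in> borel_measurable M" for i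
    by (intro borel_measurable_sum borel_measurable_times borel_measurable_const e(1)) auto
  have "(if i = j then 1 else 0) = (\<integral>x. e i (h x) * cnj (e j (h x)) \<partial>M)"
    unfolding orth[OF i j, symmetric]
    by (rule mp_integral[OF h, symmetric]) (intro borel_measurable_times measurable_compose[OF _ borel_measurable_cnj] e i j)
  also have "\<dots> = (\<integral>x. (\<Sum>k<n. cnj (m j k) * ((\<Sum>l<n. m i l * e l x) * cnj (e k x))) \<partial>M)"
  proof (rule integral_cong_AE)
    show "(\<lambda>x. e i (h x) * cnj (e j (h x))) \<in> borel_measurable M"
      by (intro borel_measurable_times measurable_compose[OF _ borel_measurable_cnj] measurable_compose[OF mp_measurable[OF h]] e i j)
    show "(\<lambda>x. \<Sum>k<n. cnj (m j k) * ((\<Sum>l<n. m i l * e l x) * cnj (e k x))) \<in> borel_measurable M"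
      by (intro borel_measurable_sum borel_measurable_times borel_measurable_const em measurable_compose[OF _ borel_measurable_cnj] e) auto
    show "AE x in M. e i (h x) * cnj (e j (h x)) = (\<Sum>k<n. cnj (m j k) * ((\<Sum>l<n. m i l * e l x) * cnj (e k x)))"
      using tb[OF i] tb[OF j]
    proof eventually_elim
      case (elim x)
      have aa: "a x * cnj (a x) = 1" using a[of x] by (simp add: circle_cnj circle_simps(1))
      have "e i (h x) * cnj (e j (h x)) = (a x * cnj (a x)) * ((\<Sum>l<n. m i l * e l x) * cnj (\<Sum>k<n. m j k * e k x))"
        unfolding elim complex_cnj_mult by (simp only: mult_ac)
      also have "\<dots> = (\<Sum>k<n. cnj (m j k) * ((\<Sum>l<n. m i l * e l x) * cnj (e k x)))"
        unfolding aa cnj_sum complex_cnj_mult mult_1_left sum_distrib_left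
        by (intro sum.cong refl) (simp only: mult_ac)
      finally show ?case .
    qed
  qed
  also have "\<dots> = (\<Sum>k<n. cnj (m j k) * m i k)"
    using expansion_inner[OF e orth]
    by (subst Bochner_Integration.integral_sum) (auto intro!: integrable_mult_right)
  finally show ?thesis by (simp add: mult_ac)
qed

end

section \<open>Compact abelian groups\<close>

text \<open>A metric space need not be second countable, and then open sets of the square may fail
  to be product measurable. Compactness supplies finite nets at every scale, hence countably many
  balls from which all open sets are built.\<close>

lemma open_prod_in_sets:
  fixes W :: "('x::metric_space \<times> 'x) set"
  assumes X: "compact (UNIV :: 'x set)" and W: "open W"
  shows "W \<in> sets (borel \<Otimes>\<^sub>M borel)"
proof -
  have "\<exists>k. finite k \<and> (UNIV :: 'x set) \<subseteq> (\<Union>x\<in>k. ball x (1 / real (Suc n)))" for n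
    using X unfolding compact_eq_totally_bounded by simp
  then obtain k where k: "\<And>n. finite (k n)" "\<And>n. (UNIV :: 'x set) \<subseteq> (\<Union>x\<in>k n. ball x (1 / real (Suc n)))"
    by metis
  define I where "I = {i \<in> (SIGMA n:UNIV. k n \<times> k n). ball (fst (snd i)) (1 / real (Suc (fst i))) \<times> ball (snd (snd i)) (1 / real (Suc (fst i))) \<subseteq> W}"
  have "countable (SIGMA n:(UNIV::nat set). k n \<times> k n)"
    using k(1) by (intro countable_SIGMA) (auto intro: countable_finite)
  then have cI: "countable I" unfolding I_def by (rule countable_subset[rotated]) auto
  have "W = (\<Union>i\<in>I. ball (fst (snd i)) (1 / real (Suc (fst i))) \<times> ball (snd (snd i)) (1 / real (Suc (fst i))))"
  proof (intro equalityI subsetI)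
    fix w assume "w \<in> W"
    obtain a b where w: "w = (a, b)" by force
    obtain A B where "open A" "open B" "w \<in> A \<times> B" "A \<times> B \<subseteq> W"
      using open_prod_elim[OF W \<open>w \<in> W\<close>] by metis
    then have AB: "open A" "open B" "a \<in> A" "b \<in> B" "A \<times> B \<subseteq> W" by (auto simp: w)
    obtain e1 where e1: "e1 > 0" "ball a e1 \<subseteq> A" using AB open_contains_ball by blast
    obtain e2 where e2: "e2 > 0" "ball b e2 \<subseteq> B" using AB open_contains_ball by blast
    have "min e1 e2 / 2 > 0" using e1 e2 by simp
    \<comment> \<open>Half the radius leaves room for the distance to the net point plus the radius
      of the ball around it.\<close>
    then obtain n where n: "1 / real (Suc n) < min e1 e2 / 2" using nat_approx_posE by blast
    obtain x where x: "x \<in> k n" "dist x a < 1 / real (Suc n)" using k(2)[of n] by (auto simp: subset_eq)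
    obtain y where y: "y \<in> k n" "dist y b < 1 / real (Suc n)" using k(2)[of n] by (auto simp: subset_eq)
    have "ball x (1 / real (Suc n)) \<subseteq> ball a e1"
    proof
      fix z assume "z \<in> ball x (1 / real (Suc n))"
      then have "dist x z < 1 / real (Suc n)" by simp
      moreover have "dist a z \<le> dist x a + dist x z" using dist_triangle3[of a z x] by simp
      ultimately have "dist a z < e1" using n x(2) by linarith
      then show "z \<in> ball a e1" by simp
    qed
    moreover have "ball y (1 / real (Suc n)) \<subseteq> ball b e2"
    proof
      fix z assume "z \<in> ball y (1 / real (Suc n))"
      then have "dist y z < 1 / real (Suc n)" by simp
      moreover have "dist b z \<le> dist y b + dist y z" using dist_triangle3[of b z y] by simp
      ultimately have "dist b z < e2" using n y(2) by linarith
      then show "z \<in> ball b e2" by simp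
    qed
    ultimately have "ball x (1 / real (Suc n)) \<times> ball y (1 / real (Suc n)) \<subseteq> W"
      using e1(2) e2(2) AB(5) by blast
    then have "(n, (x, y)) \<in> I" using x(1) y(1) unfolding I_def by simp
    then show "w \<in> (\<Union>i\<in>I. ball (fst (snd i)) (1 / real (Suc (fst i))) \<times> ball (snd (snd i)) (1 / real (Suc (fst i))))"
      using x y w by (intro UN_I[of "(n, (x, y))"]) auto
  qed (auto simp: I_def)
  also have "\<dots> \<in> sets (borel \<Otimes>\<^sub>M borel)"
    using cI by (intro sets.countable_UN') (auto intro!: pair_measureI)
  finally show ?thesis .
qed

locale compact_haar =
  fixes \<nu> :: "'x::{metric_space, ab_group_add} measure"
  assumes top_group: "compact_abelian_top_group TYPE('x)" and haar: "haar_prob \<nu>"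
begin

lemma sets_nu [measurable_cong, simp]: "sets \<nu> = sets borel"
  using haar by (simp add: haar_prob_def)

lemma space_nu: "space \<nu> = UNIV"
  using sets_eq_imp_space_eq[OF sets_nu] by simp

sublocale kernel_space \<nu>
  by (rule kernel_space.intro) (use haar space_nu in \<open>auto simp: haar_prob_def kernel_space_axioms_def\<close>)

lemma compact_X: "compact (UNIV :: 'x set)"
  using top_group by (simp add: compact_abelian_top_group_def)

lemma plus_measurable_borel: "(\<lambda>w::'x \<times> 'x. fst w + snd w) \<in> measurable (borel \<Otimes>\<^sub>M borel) borel"
proof (rule borel_measurableI)
  fix S :: "'x set" assume "open S"
  moreover have "continuous_on UNIV (\<lambda>p::'x \<times> 'x. fst p + snd p)"
    using top_group by (simp add: compact_abelian_top_group_def)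
  ultimately have "open ((\<lambda>w::'x \<times> 'x. fst w + snd w) -` S)"
    by (rule open_vimage)
  then show "(\<lambda>w::'x \<times> 'x. fst w + snd w) -` S \<inter> space (borel \<Otimes>\<^sub>M borel) \<in> sets (borel \<Otimes>\<^sub>M borel)"
    using open_prod_in_sets[OF compact_X] by (simp add: space_pair_measure)
qed

lemma plus_measurable [measurable (raw)]:
  assumes "f \<in> measurable M \<nu>" "g \<in> measurable M \<nu>"
  shows "(\<lambda>x. f x + g x) \<in> measurable M \<nu>"
proof -
  have "(\<lambda>x. (f x, g x)) \<in> measurable M (borel \<Otimes>\<^sub>M borel)"
    using assms by (intro measurable_Pair) (simp_all cong: measurable_cong_sets)
  from measurable_compose[OF this plus_measurable_borel] show ?thesis
    by (simp cong: measurable_cong_sets)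
qed

lemma uminus_measurable [measurable (raw)]:
  assumes "f \<in> measurable M \<nu>"
  shows "(\<lambda>x. - f x) \<in> measurable M \<nu>"
proof -
  have "(uminus :: 'x \<Rightarrow> 'x) \<in> borel_measurable borel"
    using top_group by (intro borel_measurable_continuous_onI) (simp add: compact_abelian_top_group_def)
  then have "(uminus :: 'x \<Rightarrow> 'x) \<in> measurable \<nu> \<nu>" by (simp cong: measurable_cong_sets)
  from measurable_compose[OF assms this] show ?thesis .
qed

lemma mp_translate: "measure_preserving_map \<nu> \<nu> (\<lambda>x. a + x)"
proof -
  have m: "(\<lambda>x. a + x) \<in> measurable \<nu> \<nu>" by (intro plus_measurable) (simp_all add: space_nu)
  have "distr \<nu> \<nu> (\<lambda>x. a + x) = \<nu>"
  proof (rule measure_eqI)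
    fix A assume "A \<in> sets (distr \<nu> \<nu> (\<lambda>x. a + x))"
    then have A: "A \<in> sets \<nu>" by simp
    have "emeasure (distr \<nu> \<nu> (\<lambda>x. a + x)) A = emeasure \<nu> ((\<lambda>x. a + x) -` A \<inter> space \<nu>)"
      using A by (rule emeasure_distr[OF m])
    also have "(\<lambda>x. a + x) -` A \<inter> space \<nu> = (\<lambda>x. - a + x) ` A"
      by (auto simp: space_nu image_iff intro!: bexI[of _ "a + _"])
    also have "emeasure \<nu> ((\<lambda>x. - a + x) ` A) = emeasure \<nu> A"
    proof -
      have "\<forall>a. \<forall>A\<in>sets borel. emeasure \<nu> ((\<lambda>x. a + x) ` A) = emeasure \<nu> A"
        using haar unfolding haar_prob_def by blast
      from bspec[OF spec[OF this]] A show ?thesis by (simp only: sets_nu)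
    qed
    finally show "emeasure (distr \<nu> \<nu> (\<lambda>x. a + x)) A = emeasure \<nu> A" .
  qed simp
  with m show ?thesis by (simp add: measure_preserving_map_def)
qed

lemma mp_translate': "measure_preserving_map \<nu> \<nu> (\<lambda>x. x + a)"
  using mp_translate[of a] by (simp add: add.commute)

text \<open>A shear, which preserves the measure by translation invariance, followed by a
  projection.\<close>

lemma mp_add: "measure_preserving_map (\<nu> \<Otimes>\<^sub>M \<nu>) \<nu> (\<lambda>w. fst w + snd w)"
proof -
  have "measure_preserving_map (\<nu> \<Otimes>\<^sub>M \<nu>) (\<nu> \<Otimes>\<^sub>M \<nu>) (\<lambda>w. (fst w, fst w + snd w))"
    by (rule mp_skew[where h="\<lambda>x y. x + y"])
       (auto intro: prob_space_axioms mp_translate)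
  from mp_comp[OF this mp_snd[OF prob_space_axioms prob_space_axioms]] show ?thesis by simp
qed

lemma translate_AE:
  assumes "AE x in \<nu>. P (a + x)" shows "AE x in \<nu>. P x"
  using mp_AE[OF mp_translate[of "- a"] assms] by simp

section \<open>Characters from almost everywhere multiplicative functions\<close>

text \<open>The factor by which translation by \<open>x\<close> multiplies \<open>f\<close>. Unlike
  \<open>f x\<close> it is insensitive to changes of \<open>f\<close> on null sets, which makes it
  the candidate for an exact character.\<close>

definition eigenvalue :: "('x \<Rightarrow> complex) \<Rightarrow> 'x \<Rightarrow> complex" where
  "eigenvalue f x = (THE c. AE y in \<nu>. f (x + y) = c * f y)"

lemma eigenvalue_unique:
  assumes f: "\<And>x. f x \<in> circle" and c: "AE y in \<nu>. f (x + y) = c * f y" and d: "AE y in \<nu>. f (x + y) = d * f y"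
  shows "c = d"
proof -
  have "AE y in \<nu>. c = d" using c d
  proof eventually_elim
    case (elim y)
    have "c * f y = d * f y" unfolding elim(1)[symmetric] by (rule elim(2))
    then show ?case using circle_simps(1)[OF f, of y] by simp
  qed
  then show ?thesis using AE_exists by blast
qed

lemma eigenvalueI:
  assumes f: "\<And>x. f x \<in> circle" and c: "AE y in \<nu>. f (x + y) = c * f y"
  shows "eigenvalue f x = c"
  unfolding eigenvalue_def
proof (rule the_equality)
  show "d = c" if "AE y in \<nu>. f (x + y) = d * f y" for d using eigenvalue_unique[OF f that c] .
qed (rule c)

text \<open>Otherwise Lipschitz cutoffs of closed sets would force \<open>f\<close> to integrate to
  zero over every closed set, hence to vanish. The function found here serves to smooth
  \<open>f\<close> in \<open>AE_character\<close>.\<close>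

lemma exists_continuous_test:
  fixes f :: "'x \<Rightarrow> complex"
  assumes f: "f \<in> borel_measurable \<nu>" "\<And>x. f x \<in> circle"
  shows "\<exists>k :: 'x \<Rightarrow> real. continuous_on UNIV k \<and> (\<forall>x. \<bar>k x\<bar> \<le> 1) \<and> (\<integral>x. complex_of_real (k x) * f x \<partial>\<nu>) \<noteq> 0"
proof (rule ccontr)
  note [measurable] = f(1)
  have fi: "integrable \<nu> f" by (rule bounded_integrable[where B=1]) (use f circle_simps(2) in auto)
  assume "\<not> ?thesis"
  then have k0: "(\<integral>x. complex_of_real (k x) * f x \<partial>\<nu>) = 0" if "continuous_on UNIV k" "\<And>x. \<bar>k x\<bar> \<le> 1" for k :: "'x \<Rightarrow> real"
    using that by blast
  have cl: "(LINT x:F|\<nu>. f x) = 0" if F: "closed F" for F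
  proof (cases "F = {}")
    case True then show ?thesis by (simp add: set_lebesgue_integral_def)
  next
    case False
    define k where "k n x = max 0 (1 - real n * infdist x F)" for n x
    have kc: "continuous_on UNIV (k n)" for n unfolding k_def by (intro continuous_intros)
    have kb: "\<bar>k n x\<bar> \<le> 1" for n x using infdist_nonneg[of x F] by (auto simp: k_def max_def)
    have km[measurable]: "k n \<in> borel_measurable \<nu>" for n
      using borel_measurable_continuous_onI[OF kc] by (simp cong: measurable_cong_sets)
    have Fm[measurable]: "F \<in> sets \<nu>" using F by simp
    have "(\<lambda>n. (\<integral>x. complex_of_real (k n x) * f x \<partial>\<nu>)) \<longlonglongrightarrow> (\<integral>x. indicator F x *\<^sub>R f x \<partial>\<nu>)"
    proof (rule integral_dominated_convergence[where w="\<lambda>_. 1"])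
      show "AE x in \<nu>. norm (complex_of_real (k n x) * f x) \<le> 1" for n
        using kb f(2) circle_simps(2) by (auto simp: norm_mult)
      have "(\<lambda>n. k n x) \<longlonglongrightarrow> indicator F x" for x
      proof (cases "x \<in> F")
        case False
        then have d: "infdist x F > 0" using F \<open>F \<noteq> {}\<close> by (simp add: infdist_pos_not_in_closed)
        obtain N where N: "1 / infdist x F < real N" using reals_Archimedean2 by blast
        have "k n x = 0" if "N \<le> n" for n
        proof -
          have "1 / infdist x F \<le> real n" using N that by simp
          then have "1 \<le> real n * infdist x F" using d by (simp add: field_simps)
          then show ?thesis by (simp add: k_def)
        qed
        then have "\<forall>\<^sub>F n in sequentially. k n x = 0" by (auto simp: eventually_sequentially)
        then show ?thesis using False by (simp add: tendsto_eventually)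
      qed (simp add: k_def)
      then show "AE x in \<nu>. (\<lambda>n. complex_of_real (k n x) * f x) \<longlonglongrightarrow> indicator F x *\<^sub>R f x"
        unfolding scaleR_conv_of_real by (intro AE_I2 tendsto_intros)
    qed auto
    then show ?thesis using k0[OF kc kb] by (simp add: set_lebesgue_integral_def LIMSEQ_const_iff)
  qed
  have "AE x in \<nu>. f x = 0"
  proof (rule AE_zero_of_generator[OF fi, of "Collect closed"])
    show "Int_stable (Collect (closed :: 'x set \<Rightarrow> bool))" by (auto simp: Int_stable_def)
    show "sets \<nu> = sigma_sets (space \<nu>) (Collect closed)"
      unfolding sets_nu space_nu borel_eq_closed by simp
    show "integral\<^sup>L \<nu> f = 0" using cl[of UNIV] by (simp add: set_lebesgue_integral_def)
  qed (use cl space_nu in auto)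
  then show False using AE_exists f(2) circle_simps(1) by blast
qed

text \<open>The translation factor of \<open>f\<close> exists at every point, is exactly
  multiplicative and agrees with \<open>f\<close> almost everywhere; continuity comes from writing
  it as a convolution.\<close>

theorem AE_character:
  assumes f: "f \<in> borel_measurable \<nu>" "\<And>x. f x \<in> circle"
    and mult: "AE w in \<nu> \<Otimes>\<^sub>M \<nu>. f (fst w + snd w) = f (fst w) * f (snd w)"
  obtains ch where "ch \<in> pontryagin_dual" "AE x in \<nu>. ch x = f x"
proof -
  note nz = circle_simps(1)[OF f(2)]
  have good: "AE x in \<nu>. AE y in \<nu>. f (x + y) = f x * f y" using Q.AE_pair[OF mult] by simp
  have ex: "\<exists>c\<in>circle. AE y in \<nu>. f (x + y) = c * f y" for x
  proof -
    \<comment> \<open>Every \<open>x\<close> is a difference of two good points: for almost every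
      \<open>x2\<close> both \<open>x2\<close> and \<open>x + x2\<close> are good.\<close>
    have "AE x2 in \<nu>. (AE y in \<nu>. f (x2 + y) = f x2 * f y) \<and> (AE y in \<nu>. f ((x + x2) + y) = f (x + x2) * f y)"
      using good mp_AE[OF mp_translate[of x] good] by eventually_elim simp
    then obtain x2 where x2: "AE y in \<nu>. f (x2 + y) = f x2 * f y" "AE y in \<nu>. f ((x + x2) + y) = f (x + x2) * f y"
      using AE_exists by blast
    have "AE y in \<nu>. f (x + y) = (f (x + x2) / f x2) * f y"
    proof (rule translate_AE[where a=x2])
      show "AE y in \<nu>. f (x + (x2 + y)) = (f (x + x2) / f x2) * f (x2 + y)"
        using x2 by eventually_elim (simp add: add.assoc nz)
    qed
    then show ?thesis using circle_simps(5)[OF f(2) f(2)] by blast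
  qed
  define ch where "ch = eigenvalue f"
  have chi: "ch x \<in> circle \<and> (AE y in \<nu>. f (x + y) = ch x * f y)" for x
    using ex[of x] eigenvalueI[of f, OF f(2)] unfolding ch_def by metis
  have hom: "ch (a + b) = ch a * ch b" for a b
  proof -
    have "AE y in \<nu>. f (a + (b + y)) = ch a * f (b + y)" using mp_AE[OF mp_translate[of b]] chi[of a] by blast
    then have "AE y in \<nu>. f ((a + b) + y) = (ch a * ch b) * f y"
      using chi[of b, THEN conjunct2] by eventually_elim (simp add: add.assoc)
    then show ?thesis unfolding ch_def using eigenvalueI[of f, OF f(2)] by blast
  qed
  have ae: "AE x in \<nu>. ch x = f x"
    using good by eventually_elim (simp add: ch_def eigenvalueI[of f, OF f(2)])
  obtain k :: "'x \<Rightarrow> real" where k: "continuous_on UNIV k" "\<And>x. \<bar>k x\<bar> \<le> 1" "(\<integral>x. complex_of_real (k x) * cnj (f x) \<partial>\<nu>) \<noteq> 0"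
    using exists_continuous_test[of "\<lambda>x. cnj (f x)"] f circle_simps(6) measurable_compose[OF f(1) borel_measurable_cnj] by auto
  define I where "I = (\<integral>x. complex_of_real (k x) * cnj (f x) \<partial>\<nu>)"
  note [measurable] = f(1)
  have km[measurable]: "k \<in> borel_measurable \<nu>"
    using borel_measurable_continuous_onI[OF k(1)] by (simp cong: measurable_cong_sets)
  \<comment> \<open>Translating the integral \<open>I\<close> by \<open>x\<close> pulls out the
    conjugate of \<open>ch x\<close>. What remains depends on \<open>x\<close> only through the
    continuous function \<open>k\<close>.\<close>
  have chi_eq: "ch x = (\<integral>y. complex_of_real (k (x + y)) * cnj (f y) \<partial>\<nu>) / I" for x
  proof -
    have "I = (\<integral>y. complex_of_real (k (x + y)) * cnj (f (x + y)) \<partial>\<nu>)"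
      unfolding I_def by (rule mp_integral[OF mp_translate, symmetric]) measurable
    also have "\<dots> = (\<integral>y. cnj (ch x) * (complex_of_real (k (x + y)) * cnj (f y)) \<partial>\<nu>)"
    proof (rule integral_cong_AE)
      have [measurable]: "(\<lambda>y. x + y) \<in> measurable \<nu> \<nu>" by (rule mp_measurable[OF mp_translate])
      show "(\<lambda>y. complex_of_real (k (x + y)) * cnj (f (x + y))) \<in> borel_measurable \<nu>" by measurable
      show "(\<lambda>y. cnj (ch x) * (complex_of_real (k (x + y)) * cnj (f y))) \<in> borel_measurable \<nu>" by measurable
      show "AE y in \<nu>. complex_of_real (k (x + y)) * cnj (f (x + y)) = cnj (ch x) * (complex_of_real (k (x + y)) * cnj (f y))"
        using chi[of x, THEN conjunct2] by eventually_elim simp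
    qed
    also have "\<dots> = inverse (ch x) * (\<integral>y. complex_of_real (k (x + y)) * cnj (f y) \<partial>\<nu>)"
      using chi[of x] by (simp add: circle_cnj)
    finally show ?thesis using chi[of x] k(3) circle_simps(1)[of "ch x"] unfolding I_def by (simp add: field_simps)
  qed
  have cont_add: "continuous_on UNIV (\<lambda>x. x + y)" for y :: 'x
  proof -
    have "continuous_on UNIV (\<lambda>p::'x \<times> 'x. fst p + snd p)"
      using top_group by (simp add: compact_abelian_top_group_def)
    from continuous_on_compose2[OF this, of UNIV "\<lambda>x. (x, y)"] show ?thesis
      by (simp add: continuous_on_Pair)
  qed
  have "continuous_on UNIV (\<lambda>x. (\<integral>y. complex_of_real (k (x + y)) * cnj (f y) \<partial>\<nu>))"
    unfolding continuous_on_sequentially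
  proof (intro allI ballI impI)
    fix x :: "nat \<Rightarrow> 'x" and a assume "(\<forall>n. x n \<in> UNIV) \<and> x \<longlonglongrightarrow> a"
    then have x: "x \<longlonglongrightarrow> a" by simp
    have [measurable]: "(\<lambda>y. b + y) \<in> measurable \<nu> \<nu>" for b by (rule mp_measurable[OF mp_translate])
    have "(\<lambda>n. (\<integral>y. complex_of_real (k (x n + y)) * cnj (f y) \<partial>\<nu>)) \<longlonglongrightarrow> (\<integral>y. complex_of_real (k (a + y)) * cnj (f y) \<partial>\<nu>)"
    proof (rule integral_dominated_convergence[where w="\<lambda>_. 1"])
      show "AE y in \<nu>. norm (complex_of_real (k (x n + y)) * cnj (f y)) \<le> 1" for n
        using k(2) f(2) circle_simps(2) by (auto simp: norm_mult)
      have "(\<lambda>n. k (x n + y)) \<longlonglongrightarrow> k (a + y)" for y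
        using continuous_on_tendsto_compose[OF continuous_on_compose2[OF k(1) cont_add[of y]] x] by simp
      then show "AE y in \<nu>. (\<lambda>n. complex_of_real (k (x n + y)) * cnj (f y)) \<longlonglongrightarrow> complex_of_real (k (a + y)) * cnj (f y)"
        by (intro AE_I2 tendsto_intros)
    qed measurable
    then show "((\<lambda>x. (\<integral>y. complex_of_real (k (x + y)) * cnj (f y) \<partial>\<nu>)) \<circ> x) \<longlonglongrightarrow> (\<integral>y. complex_of_real (k (a + y)) * cnj (f y) \<partial>\<nu>)"
      by (simp add: o_def)
  qed
  then have "continuous_on UNIV (\<lambda>x. (\<integral>y. complex_of_real (k (x + y)) * cnj (f y) \<partial>\<nu>) / I)"
    using k(3) unfolding I_def by (intro continuous_intros) auto
  then have "continuous_on UNIV ch" unfolding chi_eq[symmetric] .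
  then have "ch \<in> pontryagin_dual" using chi hom by (simp add: pontryagin_dual_def)
  then show ?thesis using ae that by blast
qed

text \<open>Given \<open>x\<close>, some \<open>y\<close> has both \<open>y\<close> and
  \<open>x + y\<close> outside the exceptional set; multiplicativity then allows division by the
  value at \<open>y\<close>.\<close>

lemma hom_eq_of_AE:
  fixes f g :: "'x \<Rightarrow> complex"
  assumes f: "\<And>a b. f (a + b) = f a * f b" "\<And>x. f x \<in> circle"
    and g: "\<And>a b. g (a + b) = g a * g b" and ae: "AE x in \<nu>. f x = g x"
  shows "f x = g x"
proof -
  have "AE y in \<nu>. f (x + y) = g (x + y)" using mp_AE[OF mp_translate ae] .
  with ae have "AE y in \<nu>. f x = g x"
  proof eventually_elim
    case (elim y)
    have "f x * f y = g (x + y)" using elim(2) by (simp add: f(1))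
    then have "f x * f y = g x * f y" by (simp add: g elim(1))
    then show ?case using circle_simps(1)[OF f(2), of y] by simp
  qed
  then show ?thesis using AE_exists by blast
qed

text \<open>The kernel \<open>T(x,z) = cnj (u(z - x, x))\<close> intertwines the twisted translations
  \<open>f \<mapsto> cnj (u(-,y)) f(- + y)\<close>. A spectral projection of \<open>T T\<^sup>*\<close> has finite rank and commutes with
  them; the determinant of their restriction to its range trivialises a power of \<open>u\<close>.\<close>

theorem multiplier_power_trivial:
  assumes um: "u \<in> borel_measurable (\<nu> \<Otimes>\<^sub>M \<nu>)" and uc: "\<And>w. u w \<in> circle" and Cc: "C \<in> circle"
    and coc: "AE q in \<nu> \<Otimes>\<^sub>M (\<nu> \<Otimes>\<^sub>M \<nu>). u (fst q, fst (snd q)) * u (fst q + fst (snd q), snd (snd q))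
      = C * u (fst (snd q), snd (snd q)) * u (fst q, fst (snd q) + snd (snd q))"
  obtains n :: nat and D C' where "n > 0" "D \<in> borel_measurable \<nu>" "\<And>x. D x \<in> circle"
    "AE w in \<nu> \<Otimes>\<^sub>M \<nu>. u w ^ n = C' * D (fst w + snd w) * inverse (D (fst w)) * inverse (D (snd w))"
proof -
  note ps = prob_space_axioms Q.P.prob_space_axioms
  note [measurable] = um
  have unz: "u w \<noteq> 0" for w using uc circle_simps(1) by blast
  have unorm: "norm (u w) = 1" for w using uc circle_simps(2) by blast
  have ucm: "(\<lambda>x. u (x, y)) \<in> borel_measurable \<nu>" for y by (rule section_measurable(2)[OF um])
  \<comment> \<open>The cocycle identity at \<open>(z - x, x, y)\<close> reads
    \<open>u (z - x, x) * u (z, y) = C * u (x, y) * u (z - x, x + y)\<close>. Conjugated, it tells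
    how \<open>T\<close> changes when both variables are translated by \<open>y\<close>.\<close>
  define T where "T w = cnj (u (snd w + - fst w, fst w))" for w
  have Tm[measurable]: "T \<in> borel_measurable (\<nu> \<Otimes>\<^sub>M \<nu>)" unfolding T_def by measurable
  have Tb: "bounded_kernel \<nu> T 1" unfolding bounded_kernel_def using Tm by (auto simp: T_def unorm)
  have Tpos: "hs \<nu> T > 0" unfolding hs_def by (simp add: T_def unorm Q.P.prob_space)
  define K where "K = kcomp \<nu> T (\<lambda>w. cnj (T (snd w, fst w)))"
  have Kb: "bounded_kernel \<nu> K (1 * 1)" unfolding K_def by (rule kcomp_bounded[OF Tb adjoint_bounded[OF Tb]])
  have Kh: "hermitian K" unfolding K_def by (rule hermitian_kcomp_adjoint)
  have Kpos: "hs \<nu> K > 0" unfolding K_def by (rule hs_kcomp_adjoint_pos[OF Tb Tpos])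
  have Ttw: "AE y in \<nu>. twisted \<nu> (\<lambda>x. x + y) (\<lambda>x. u (x, y)) C T"
  proof -
    have s: "measure_preserving_map (\<nu> \<Otimes>\<^sub>M \<nu>) (\<nu> \<Otimes>\<^sub>M \<nu>) (\<lambda>w. (fst w, snd w + - fst w))"
    proof (rule mp_skew[where h="\<lambda>x z. z + - x"])
      show "measure_preserving_map \<nu> \<nu> (\<lambda>z. z + - x)" for x by (rule mp_translate')
      show "(\<lambda>w. snd w + - fst w) \<in> measurable (\<nu> \<Otimes>\<^sub>M \<nu>) \<nu>" by measurable
    qed (rule ps)+
    \<comment> \<open>The change of variables \<open>(y, x, z) \<mapsto> (z - x, x, y)\<close>,
      which carries the cocycle identity to the twisted invariance of \<open>T\<close>.\<close>
    have "measure_preserving_map (\<nu> \<Otimes>\<^sub>M (\<nu> \<Otimes>\<^sub>M \<nu>)) (\<nu> \<Otimes>\<^sub>M (\<nu> \<Otimes>\<^sub>M \<nu>))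
      (\<lambda>q. (snd (snd q) + - fst (snd q), (fst (snd q), fst q)))"
      using mp_comp[OF mp_comp[OF mp_swap[OF ps] mp_prod[OF ps(1) mp_comp[OF s mp_swap[OF ps(1) ps(1)]] mp_id]] mp_assoc[OF ps(1) ps(1) ps(1)]]
      by simp
    note mp = this
    interpret Q3: pair_prob_space \<nu> "\<nu> \<Otimes>\<^sub>M \<nu>" ..
    show ?thesis unfolding twisted_def
    proof -
      show "AE y in \<nu>. AE w in \<nu> \<Otimes>\<^sub>M \<nu>. T (fst w + y, snd w + y) = C * T w * u (fst w, y) * cnj (u (snd w, y))"
        using Q3.AE_pair[OF mp_AE[OF mp coc]]
      proof eventually_elim
        case (elim y)
        then show ?case
        proof eventually_elim
          case (elim w)
          define a1 a2 a3 a4 where "a1 = u (snd w - fst w, fst w)" and "a2 = u (snd w, y)" and "a3 = u (fst w, y)"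
            and "a4 = u (snd w - fst w, fst w + y)"
          have e: "a1 * a2 = C * a3 * a4" using elim by (simp add: a1_def a2_def a3_def a4_def)
          have nz: "a1 \<noteq> 0" "a2 \<noteq> 0" "a3 \<noteq> 0" "a4 \<noteq> 0" "C \<noteq> 0"
            unfolding a1_def a2_def a3_def a4_def using unz circle_simps(1)[OF Cc] by auto
          have "inverse a4 = C * inverse a1 * a3 * inverse a2"
          proof -
            have "C * inverse a1 * a3 * inverse a2 = (C * a3 * a4) * inverse a4 * inverse (a1 * a2)" using nz by simp
            also have "\<dots> = inverse a4 * ((a1 * a2) * inverse (a1 * a2))" unfolding e[symmetric] by (simp only: mult_ac)
            also have "(a1 * a2) * inverse (a1 * a2) = 1" using nz by (intro right_inverse) simp
            finally show ?thesis by simp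
          qed
          then have "cnj a4 = C * cnj a1 * a3 * cnj a2"
            unfolding a1_def a2_def a3_def a4_def circle_cnj[OF uc] .
          moreover have "snd w + y + - (fst w + y) = snd w - fst w" by simp
          ultimately show ?case
            unfolding T_def fst_conv snd_conv by (simp add: a1_def a2_def a3_def a4_def)
        qed
      qed
    qed
  qed
  obtain p B a k where pb: "bounded_kernel \<nu> p B" and ph: "hermitian p" and pp: "kcomp \<nu> p p = p" and ppos: "hs \<nu> p > 0"
    and plim: "\<And>w. (\<lambda>n::nat. complex_of_real (a n) * kpow \<nu> K (k n) w) \<longlonglongrightarrow> p w"
    using spectral_projection[OF Kb Kh Kpos] by blast
  have ptw: "AE y in \<nu>. twisted \<nu> (\<lambda>x. x + y) (\<lambda>x. u (x, y)) 1 p"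
    using Ttw
  proof eventually_elim
    case (elim y)
    \<comment> \<open>\<open>T\<close> intertwines up to the scalar \<open>C\<close> and its adjoint
      up to the conjugate scalar, so their product \<open>K\<close> commutes exactly with the
      twisted translations.\<close>
    have "C * cnj C = 1" using Cc by (simp add: circle_cnj circle_simps(1))
    then have "twisted \<nu> (\<lambda>x. x + y) (\<lambda>x. u (x, y)) 1 K"
      unfolding K_def using twisted_kcomp[OF mp_translate' uc Tb elim adjoint_bounded[OF Tb] twisted_adjoint[OF elim]] by simp
    then show ?case by (intro twisted_limit[OF _ plim] twisted_kpow[OF mp_translate' uc Kb])
  qed
  obtain n :: nat and e where
    e: "\<forall>i<n. e i \<in> borel_measurable \<nu> \<and> (\<exists>B. \<forall>x. norm (e i x) \<le> B)"
    and orth: "\<forall>i<n. \<forall>j<n. (\<integral>x. e i x * cnj (e j x) \<partial>\<nu>) = (if i = j then 1 else 0)"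
    and pe: "\<forall>i<n. \<forall>x. (\<integral>t. p (x, t) * e i t \<partial>\<nu>) = e i x"
    and sum: "\<forall>x t. p (x, t) = (\<Sum>i<n. e i x * cnj (e i t))"
    using idempotent_finite_rank[OF pb ph pp] by (elim exE conjE) (rule that)
  note orth = orth[rule_format] and pe = pe[rule_format] and sum = sum[rule_format]
  have em: "i < n \<Longrightarrow> e i \<in> borel_measurable \<nu>" for i using e by blast
  obtain Be where Be: "\<And>i x. i < n \<Longrightarrow> norm (e i x) \<le> Be"
  proof -
    obtain b where b: "\<And>i x. i < n \<Longrightarrow> norm (e i x) \<le> b i" using e by metis
    have "norm (e i x) \<le> (\<Sum>j<n. \<bar>b j\<bar>)" if "i < n" for i x
    proof -
      have "norm (e i x) \<le> \<bar>b i\<bar>" using b[OF that, of x] by linarith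
      also have "\<dots> \<le> (\<Sum>j<n. \<bar>b j\<bar>)" using that by (intro member_le_sum) auto
      finally show ?thesis .
    qed
    then show ?thesis using that by blast
  qed
  have npos: "n > 0"
  proof (rule ccontr)
    assume "\<not> n > 0"
    then have "p w = 0" for w using sum[of "fst w" "snd w"] by simp
    then show False using ppos by (simp add: hs_def)
  qed
  define m where "m y = transition (\<lambda>x. x + y) (\<lambda>x. u (x, y)) e" for y
  \<comment> \<open>The expansion in the basis is available for almost every translation only;
    \<open>good\<close> singles these out, and both arguments and their sum must qualify before
    determinants are compared.\<close>
  define good where "good y \<longleftrightarrow> (\<forall>i<n. AE x in \<nu>. e i (x + y) = u (x, y) * (\<Sum>j<n. m y i j * e j x))" for y
  have good: "AE y in \<nu>. good y"
    using ptw
  proof eventually_elim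
    case (elim y)
    show ?case unfolding good_def m_def
      using transition_basis[OF mp_translate' uc ucm em Be bounded_kernelD(1)[OF pb] elim pe sum] by blast
  qed
  define A where "A y = mat n n (\<lambda>(i, j). m y i j)" for y
  define D0 where "D0 y = Determinant.det (A y)" for y
  have Ac: "A y \<in> carrier_mat n n" for y by (simp add: A_def)
  interpret cnj: comm_ring_hom cnj by unfold_locales auto
  have D0c: "D0 y \<in> circle" if y: "good y" for y
  proof -
    let ?H = "transpose_mat (map_mat cnj (A y))"
    have H: "?H \<in> carrier_mat n n" by (simp add: A_def)
    have "A y * ?H = 1\<^sub>m n"
    proof (rule eq_matI)
      fix i j assume "i < dim_row (1\<^sub>m n :: complex mat)" "j < dim_col (1\<^sub>m n :: complex mat)"
      then have i: "i < n" and j: "j < n" by auto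
      have "(A y * ?H) $$ (i, j) = (\<Sum>k<n. m y i k * cnj (m y j k))"
        using i j by (simp add: A_def scalar_prod_def atLeast0LessThan)
      also have "\<dots> = (if i = j then 1 else 0)"
        using y unfolding good_def by (intro transition_unitary[OF mp_translate' uc em Be orth _ i j]) auto
      finally show "(A y * ?H) $$ (i, j) = 1\<^sub>m n $$ (i, j)" using i j by simp
    qed (auto simp: A_def)
    then have "D0 y * Determinant.det ?H = 1" using det_mult[OF Ac H, of y] by (simp add: D0_def)
    moreover have "Determinant.det ?H = cnj (D0 y)"
      using Determinant.det_transpose[of "map_mat cnj (A y)" n] Ac by (simp add: D0_def)
    ultimately have "complex_of_real ((norm (D0 y))\<^sup>2) = 1" unfolding complex_norm_square by simp
    then have "(norm (D0 y))\<^sup>2 = 1" unfolding of_real_eq_1_iff .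
    then have "norm (D0 y) = 1" using norm_ge_zero[of "D0 y"] by (simp add: power2_eq_1_iff)
    then show ?thesis by (simp add: circle_def)
  qed
  have mult: "D0 (y + z) = (C * u (y, z)) ^ n * (D0 z * D0 y)"
    if gy: "good y" and gz: "good z" and gyz: "good (y + z)"
      and cc: "AE x in \<nu>. u (x, y) * u (x + y, z) = C * u (y, z) * u (x, y + z)" for y z
  proof -
    \<comment> \<open>Translating \<open>e i\<close> by \<open>y + z\<close> in one go or in two
      steps gives two expansions; orthonormality identifies their coefficients.\<close>
    have me: "m (y + z) i k = C * u (y, z) * (\<Sum>j<n. m z i j * m y j k)" if i: "i < n" and k: "k < n" for i k
    proof -
      have "AE x in \<nu>. \<forall>j\<in>{..<n}. e j (x + y) = u (x, y) * (\<Sum>k<n. m y j k * e k x)"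
        using gy unfolding good_def by (subst AE_ball_countable) (auto intro: countable_finite)
      moreover have "AE x in \<nu>. e i (x + y + z) = u (x + y, z) * (\<Sum>j<n. m z i j * e j (x + y))"
        using gz i unfolding good_def by (intro mp_AE[OF mp_translate']) blast
      moreover have "AE x in \<nu>. e i (x + (y + z)) = u (x, y + z) * (\<Sum>k<n. m (y + z) i k * e k x)"
        using gyz i unfolding good_def by blast
      ultimately have ae: "AE x in \<nu>. (\<Sum>k<n. m (y + z) i k * e k x) = (\<Sum>k<n. (C * u (y, z) * (\<Sum>j<n. m z i j * m y j k)) * e k x)"
        using cc
      proof eventually_elim
        case (elim x)
        have "u (x, y + z) * (\<Sum>k<n. m (y + z) i k * e k x) = e i (x + y + z)"
          using elim(3) by (simp add: add.assoc)
        also have "\<dots> = u (x + y, z) * (\<Sum>j<n. m z i j * (u (x, y) * (\<Sum>k<n. m y j k * e k x)))"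
          unfolding elim(2) using elim(1) by simp
        also have "\<dots> = (u (x, y) * u (x + y, z)) * (\<Sum>j<n. \<Sum>k<n. m z i j * m y j k * e k x)"
          by (simp add: sum_distrib_left mult_ac)
        also have "\<dots> = u (x, y + z) * (C * u (y, z) * (\<Sum>k<n. \<Sum>j<n. m z i j * m y j k * e k x))"
          unfolding elim(4) by (subst sum.swap) (simp only: mult_ac)
        also have "(C * u (y, z) * (\<Sum>k<n. \<Sum>j<n. m z i j * m y j k * e k x)) = (\<Sum>k<n. (C * u (y, z) * (\<Sum>j<n. m z i j * m y j k)) * e k x)"
          by (simp add: sum_distrib_left sum_distrib_right mult_ac)
        finally show ?case using unz by simp
      qed
      have "m (y + z) i k = (\<integral>x. (\<Sum>k<n. m (y + z) i k * e k x) * cnj (e k x) \<partial>\<nu>)"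
        by (rule expansion_inner(1)[OF em Be orth k, symmetric])
      also have "\<dots> = (\<integral>x. (\<Sum>k<n. (C * u (y, z) * (\<Sum>j<n. m z i j * m y j k)) * e k x) * cnj (e k x) \<partial>\<nu>)"
        by (rule integral_cong_AE[OF borel_measurable_integrable borel_measurable_integrable], rule expansion_inner(2)[OF em Be orth k], assumption+,
            rule expansion_inner(2)[OF em Be orth k], assumption+) (use ae in eventually_elim, simp)
      also have "\<dots> = C * u (y, z) * (\<Sum>j<n. m z i j * m y j k)"
        by (rule expansion_inner(1)[OF em Be orth k])
      finally show ?thesis .
    qed
    \<comment> \<open>The determinant of a scalar multiple of an n by n matrix carries the scalar to
      the power n.\<close>
    have "A (y + z) = (C * u (y, z)) \<cdot>\<^sub>m (A z * A y)"
      by (rule eq_matI) (auto simp: A_def me scalar_prod_def atLeast0LessThan)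
    then show ?thesis using det_mult[OF Ac Ac, of z y] by (simp add: D0_def A_def)
  qed
  \<comment> \<open>At points that are not good the determinant may leave the circle; there 1 is a
    filler on a null set.\<close>
  define D where "D y = (if D0 y \<in> circle then D0 y else 1)" for y
  have D0m[measurable]: "D0 \<in> borel_measurable \<nu>"
  proof -
    have [measurable]: "(\<lambda>y. m y i j) \<in> borel_measurable \<nu>" if "i < n" "j < n" for i j
    proof -
      note [measurable] = em[OF that(1)] em[OF that(2)]
      show ?thesis unfolding m_def transition_def by measurable
    qed
    \<comment> \<open>The Leibniz formula reduces measurability of the determinant to that of the
      matrix entries.\<close>
    have "D0 = (\<lambda>y. \<Sum>\<pi> | \<pi> permutes {0..<n}. signof \<pi> * (\<Prod>i = 0..<n. m y i (\<pi> i)))"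
      unfolding D0_def det_def'[OF Ac]
      by (intro ext sum.cong prod.cong arg_cong2[where f="(*)"] refl) (auto simp: A_def permutes_in_image)
    also have "\<dots> \<in> borel_measurable \<nu>"
      by (intro borel_measurable_sum borel_measurable_times borel_measurable_const borel_measurable_prod)
         (auto simp: permutes_in_image)
    finally show ?thesis .
  qed
  have circ: "circle \<in> sets (borel :: complex measure)"
    unfolding circle_def by measurable
  have Dm: "D \<in> borel_measurable \<nu>"
    unfolding D_def using circ by measurable
  have Dc: "D x \<in> circle" for x by (simp add: D_def circle_simps)
  have final: "AE w in \<nu> \<Otimes>\<^sub>M \<nu>. u w ^ n = inverse (C ^ n) * D (fst w + snd w) * inverse (D (fst w)) * inverse (D (snd w))"
  proof -
    interpret Q3: pair_prob_space "\<nu> \<Otimes>\<^sub>M \<nu>" \<nu> ..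
    have "AE v in \<nu> \<Otimes>\<^sub>M \<nu>. AE x in \<nu>. u (x, fst v) * u (x + fst v, snd v) = C * u v * u (x, fst v + snd v)"
      using Q3.AE_pair[OF mp_AE[OF mp_swap[OF ps(2) ps(1)] coc]] by simp
    then show ?thesis
      using mp_AE[OF mp_fst[OF ps(1)] good] mp_AE[OF mp_snd[OF ps(1) ps(1)] good] mp_AE[OF mp_add good]
    proof eventually_elim
      case (elim v)
      have eq: "D0 (fst v + snd v) = (C * u v) ^ n * (D0 (snd v) * D0 (fst v))"
        using mult[of "fst v" "snd v"] elim by simp
      have D: "D (fst v) = D0 (fst v)" "D (snd v) = D0 (snd v)" "D (fst v + snd v) = D0 (fst v + snd v)"
        using D0c elim by (simp_all add: D_def)
      have nz: "D0 (fst v) \<noteq> 0" "D0 (snd v) \<noteq> 0" "C \<noteq> 0"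
        using D0c elim Cc circle_simps(1) by blast+
      have "inverse (C ^ n) * ((C * u v) ^ n * (D0 (snd v) * D0 (fst v))) * inverse (D0 (fst v)) * inverse (D0 (snd v))
        = (C ^ n * inverse (C ^ n)) * u v ^ n * (D0 (snd v) * inverse (D0 (snd v))) * (D0 (fst v) * inverse (D0 (fst v)))"
        by (simp only: power_mult_distrib mult_ac)
      also have "\<dots> = u v ^ n" using nz by simp
      finally show ?case unfolding D eq ..
    qed
  qed
  show ?thesis by (rule that[OF npos Dm Dc final])
qed

end

section \<open>Cohomology of algebraic actions\<close>

text \<open>The scalar occurs once on the left and twice on the right, so exactly one factor
  \<open>d\<close> survives in the multiplicative defect.\<close>

lemma defect_algebra:
  fixes d b1 b1' b1'' b2 b2' b2'' bs bs' bs'' :: complex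
  assumes "d * bs * bs' * inverse bs'' = (d * b1 * b1' * inverse b1'') * (d * b2 * b2' * inverse b2'')"
    and nz: "d \<noteq> 0" "b1 \<noteq> 0" "b1' \<noteq> 0" "b1'' \<noteq> 0" "b2 \<noteq> 0" "b2' \<noteq> 0" "b2'' \<noteq> 0"
  shows "d = (bs * inverse b1 * inverse b2) * (bs' * inverse b1' * inverse b2') * inverse (bs'' * inverse b1'' * inverse b2'')"
proof -
  define p where "p = b1 * b1' * inverse b1''"
  define q where "q = b2 * b2' * inverse b2''"
  have "d * (bs * bs' * inverse bs'') = d * (d * p * q)" using assms(1) by (simp add: p_def q_def mult_ac)
  then have "bs * bs' * inverse bs'' = d * p * q" using nz(1) by simp
  moreover have "p \<noteq> 0" "q \<noteq> 0" using nz by (auto simp: p_def q_def)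
  ultimately have "(bs * bs' * inverse bs'') * inverse p * inverse q = d * (p * inverse p) * (q * inverse q)"
    by (simp only: mult_ac)
  with \<open>p \<noteq> 0\<close> \<open>q \<noteq> 0\<close> have "d = (bs * bs' * inverse bs'') * inverse p * inverse q" by simp
  then show ?thesis by (simp add: p_def q_def mult_ac)
qed

text \<open>A coboundary on the group X is a cocycle, so multiplying a function by it leaves the
  cocycle defect unchanged.\<close>

lemma cocycle_defect_algebra:
  fixes a1 a2 a3 a4 x y z xy yz xyz :: complex
  assumes nz: "x \<noteq> 0" "y \<noteq> 0" "z \<noteq> 0" "xy \<noteq> 0" "yz \<noteq> 0" "xyz \<noteq> 0"
  shows "(x * y * a1 * inverse xy) * (xy * z * a2 * inverse xyz) * inverse (y * z * a3 * inverse yz) * inverse (x * yz * a4 * inverse xyz)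
    = a1 * a2 * inverse a3 * inverse a4"
  using nz by (simp add: field_simps)

lemma pontryagin_dualD:
  assumes "f \<in> pontryagin_dual"
  shows "continuous_on UNIV f" "f x \<in> circle" "f (a + b) = f a * f b"
  using assms by (auto simp: pontryagin_dual_def)

lemma pontryagin_dual_nonzero: "f \<in> pontryagin_dual \<Longrightarrow> f x \<noteq> 0"
  by (rule circle_simps(1)[OF pontryagin_dualD(2)])

lemma (in compact_haar) pontryagin_measurable:
  assumes "f \<in> pontryagin_dual"
  shows "f \<in> borel_measurable \<nu>"
  using borel_measurable_continuous_onI[OF pontryagin_dualD(1)[OF assms]] by (simp cong: measurable_cong_sets)

lemma pontryagin_divide:
  assumes "f \<in> pontryagin_dual" "g \<in> pontryagin_dual"
  shows "(\<lambda>x. f x / g x) \<in> pontryagin_dual"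
  using assms pontryagin_dual_nonzero[OF assms(2)]
  by (auto simp: pontryagin_dual_def circle_simps intro!: continuous_intros)

lemma Z2_dual_divide:
  assumes "c \<in> Z2_dual G \<sigma>" "c' \<in> Z2_dual G \<sigma>"
  shows "(\<lambda>g h x. c g h x / c' g h x) \<in> Z2_dual G \<sigma>"
  unfolding Z2_dual_def mem_Collect_eq
proof (intro conjI ballI allI)
  fix g h assume "g \<in> carrier G" "h \<in> carrier G"
  then show "(\<lambda>x. c g h x / c' g h x) \<in> pontryagin_dual"
    using assms by (intro pontryagin_divide) (auto simp: Z2_dual_def)
next
  fix g h k x assume "g \<in> carrier G" "h \<in> carrier G" "k \<in> carrier G"
  then have "dual_act G \<sigma> g (c h k) x * inverse (c (g \<otimes>\<^bsub>G\<^esub> h) k x) * c g (h \<otimes>\<^bsub>G\<^esub> k) x * inverse (c g h x) = 1"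
    "dual_act G \<sigma> g (c' h k) x * inverse (c' (g \<otimes>\<^bsub>G\<^esub> h) k x) * c' g (h \<otimes>\<^bsub>G\<^esub> k) x * inverse (c' g h x) = 1"
    using assms unfolding Z2_dual_def by auto
  then have "(dual_act G \<sigma> g (c h k) x * inverse (c (g \<otimes>\<^bsub>G\<^esub> h) k x) * c g (h \<otimes>\<^bsub>G\<^esub> k) x * inverse (c g h x))
    * inverse (dual_act G \<sigma> g (c' h k) x * inverse (c' (g \<otimes>\<^bsub>G\<^esub> h) k x) * c' g (h \<otimes>\<^bsub>G\<^esub> k) x * inverse (c' g h x)) = 1"
    by (simp only: inverse_1 mult_1_left)
  then show "dual_act G \<sigma> g (\<lambda>x. c h k x / c' h k x) x * inverse (c (g \<otimes>\<^bsub>G\<^esub> h) k x / c' (g \<otimes>\<^bsub>G\<^esub> h) k x) *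
      (c g (h \<otimes>\<^bsub>G\<^esub> k) x / c' g (h \<otimes>\<^bsub>G\<^esub> k) x) * inverse (c g h x / c' g h x) = 1"
    by (simp add: dual_act_def divide_inverse mult_ac)
qed

locale algebraic_system = compact_haar \<nu> + group G
  for G :: "('g, 'b) monoid_scheme" (structure) and \<nu> :: "'x::{metric_space, ab_group_add} measure"
  and \<sigma> :: "'g \<Rightarrow> 'x \<Rightarrow> 'x" +
  assumes countable: "countable (carrier G)"
  and algebraic: "algebraic_action G \<sigma>"
  and pmp: "pmp_action G \<nu> \<sigma>"
  and sr2: "T_cocycle_superrigid G (\<nu> \<Otimes>\<^sub>M \<nu>) (diag2 \<sigma>)"
  and sr4: "T_cocycle_superrigid G ((\<nu> \<Otimes>\<^sub>M \<nu>) \<Otimes>\<^sub>M (\<nu> \<Otimes>\<^sub>M \<nu>)) (diag2 (diag2 \<sigma>))"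
begin

lemma sigma_add: "g \<in> carrier G \<Longrightarrow> \<sigma> g (a + b) = \<sigma> g a + \<sigma> g b"
  using algebraic by (simp add: algebraic_action_def)

lemma sigma_mult: "g \<in> carrier G \<Longrightarrow> h \<in> carrier G \<Longrightarrow> \<sigma> (g \<otimes> h) x = \<sigma> g (\<sigma> h x)"
  using algebraic by (simp add: algebraic_action_def)

lemma mp_sigma: "g \<in> carrier G \<Longrightarrow> measure_preserving_map \<nu> \<nu> (\<sigma> g)"
  using pmp by (rule pmp_mp)

lemma space_nu2: "space (\<nu> \<Otimes>\<^sub>M \<nu>) = UNIV"
  by (simp add: space_pair_measure space_nu)

theorem cocycle_power_trivial:
  assumes c: "\<And>g h. g \<in> carrier G \<Longrightarrow> h \<in> carrier G \<Longrightarrow> c g h \<in> pontryagin_dual"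
    and dc: "\<And>g h. g \<in> carrier G \<Longrightarrow> h \<in> carrier G \<Longrightarrow> d g h \<in> circle"
    and b: "\<And>g. g \<in> carrier G \<Longrightarrow> b g \<in> borel_measurable \<nu>" "\<And>g x. g \<in> carrier G \<Longrightarrow> b g x \<in> circle"
    and cb: "\<And>g h. g \<in> carrier G \<Longrightarrow> h \<in> carrier G \<Longrightarrow>
      AE x in \<nu>. c g h x = d g h * b g x * b h (\<sigma> (inv g) x) * inverse (b (g \<otimes> h) x)"
  shows "\<exists>n::nat>0. B2_dual G \<sigma> (\<lambda>g h x. c g h x ^ n)"
proof -
  note ps = prob_space_axioms Q.P.prob_space_axioms
  have bnz: "g \<in> carrier G \<Longrightarrow> b g x \<noteq> 0" for g x using b(2) circle_simps(1) by blast
  define B where "B g w = b g (fst w + snd w) * inverse (b g (fst w)) * inverse (b g (snd w))" for g w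
  have Bm: "B g \<in> borel_measurable (\<nu> \<Otimes>\<^sub>M \<nu>)" if g: "g \<in> carrier G" for g
  proof -
    note [measurable] = b(1)[OF g]
    show ?thesis unfolding B_def by measurable
  qed
  have Bc: "B g w \<in> circle" if "g \<in> carrier G" for g w
    unfolding B_def using that by (intro circle_simps b)
  have Bd: "AE w in \<nu> \<Otimes>\<^sub>M \<nu>. d g h = B g w * B h (diag2 \<sigma> (inv g) w) * inverse (B (g \<otimes> h) w)"
    if g: "g \<in> carrier G" and h: "h \<in> carrier G" for g h
    using mp_AE[OF mp_add cb[OF g h]] mp_AE[OF mp_fst[OF ps(1)] cb[OF g h]] mp_AE[OF mp_snd[OF ps(1) ps(1)] cb[OF g h]]
  proof eventually_elim
    case (elim w)
    have gh: "g \<otimes> h \<in> carrier G" and g': "inv g \<in> carrier G" using g h by auto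
    have s: "\<sigma> (inv g) (fst w + snd w) = \<sigma> (inv g) (fst w) + \<sigma> (inv g) (snd w)" by (rule sigma_add[OF g'])
    show ?case
      unfolding B_def diag2_eq prod_act_def fst_conv snd_conv
      by (rule defect_algebra, unfold s[symmetric] elim[symmetric], rule pontryagin_dualD(3)[OF c[OF g h]])
         (auto intro!: bnz g h gh simp: circle_simps(1)[OF dc[OF g h]])
  qed
  have pmp2: "pmp_action G (\<nu> \<Otimes>\<^sub>M \<nu>) (diag2 \<sigma>)" unfolding diag2_eq by (rule pmp_prod[OF pmp pmp])
  \<comment> \<open>Here X^2 takes the place of the base space, so the doubled space is X^4.\<close>
  obtain \<rho> \<phi> where \<rho>: "\<And>g. g \<in> carrier G \<Longrightarrow> \<rho> g \<in> circle" and \<phi>m: "\<phi> \<in> borel_measurable (\<nu> \<Otimes>\<^sub>M \<nu>)"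
    and \<phi>: "\<And>w. w \<in> space (\<nu> \<Otimes>\<^sub>M \<nu>) \<Longrightarrow> \<phi> w \<in> circle"
    and B\<phi>: "\<And>g. g \<in> carrier G \<Longrightarrow> AE w in \<nu> \<Otimes>\<^sub>M \<nu>. B g w = \<rho> g * \<phi> w * inverse (\<phi> (diag2 \<sigma> (inv g) w))"
    and d\<rho>: "\<And>g h. g \<in> carrier G \<Longrightarrow> h \<in> carrier G \<Longrightarrow> d g h = \<rho> g * \<rho> h * inverse (\<rho> (g \<otimes> h))"
    by (rule untwist[OF group_axioms countable pmp2 sr4, of B d]) (rule Bm Bc Bd that; assumption)+
  have \<phi>c: "\<phi> w \<in> circle" for w using \<phi> space_nu2 by simp
  have \<phi>nz: "\<phi> w \<noteq> 0" for w using \<phi>c circle_simps(1) by blast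
  have \<rho>nz: "g \<in> carrier G \<Longrightarrow> \<rho> g \<noteq> 0" for g using \<rho> circle_simps(1) by blast
  define \<beta> where "\<beta> g x = b g x * \<rho> g" for g x
  have \<beta>c: "g \<in> carrier G \<Longrightarrow> \<beta> g x \<in> circle" for g x unfolding \<beta>_def by (intro circle_simps b \<rho>)
  have \<beta>nz: "g \<in> carrier G \<Longrightarrow> \<beta> g x \<noteq> 0" for g x using \<beta>c circle_simps(1) by blast
  have \<beta>m: "g \<in> carrier G \<Longrightarrow> \<beta> g \<in> borel_measurable \<nu>" for g unfolding \<beta>_def using b(1) by simp
  have c\<beta>: "AE x in \<nu>. c g h x = \<beta> g x * \<beta> h (\<sigma> (inv g) x) * inverse (\<beta> (g \<otimes> h) x)"
    if g: "g \<in> carrier G" and h: "h \<in> carrier G" for g h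
    using cb[OF g h] by eventually_elim (simp add: d\<rho>[OF g h] \<beta>_def mult_ac)
  \<comment> \<open>Moving the argument by the inverse of \<open>g\<close> multiplies
    \<open>\<phi>\<close> by a coboundary of the group X, the one given by
    \<open>\<beta> g\<close>.\<close>
  have \<beta>\<phi>: "AE w in \<nu> \<Otimes>\<^sub>M \<nu>. \<phi> (\<sigma> (inv g) (fst w), \<sigma> (inv g) (snd w))
      = \<beta> g (fst w) * \<beta> g (snd w) * \<phi> w * inverse (\<beta> g (fst w + snd w))" if g: "g \<in> carrier G" for g
    using B\<phi>[OF g]
  proof eventually_elim
    case (elim w)
    define p where "p = \<phi> (\<sigma> (inv g) (fst w), \<sigma> (inv g) (snd w))"
    have e: "b g (fst w + snd w) * inverse (b g (fst w)) * inverse (b g (snd w)) = \<rho> g * \<phi> w * inverse p"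
      using elim by (simp add: B_def diag2_eq prod_act_def p_def)
    have nz: "b g (fst w) \<noteq> 0" "b g (snd w) \<noteq> 0" "b g (fst w + snd w) \<noteq> 0" "\<rho> g \<noteq> 0" "p \<noteq> 0"
      using bnz[OF g] \<rho>nz[OF g] \<phi>nz by (auto simp: p_def)
    have "b g (fst w + snd w) * p = \<rho> g * \<phi> w * b g (fst w) * b g (snd w)"
      using e nz by (simp add: field_simps)
    then have "p = \<rho> g * \<phi> w * b g (fst w) * b g (snd w) * inverse (b g (fst w + snd w))"
      using nz by (simp add: field_simps)
    then show ?case unfolding p_def[symmetric] \<beta>_def using nz by (simp add: field_simps)
  qed
  have erg2: "ergodic_action G (\<nu> \<Otimes>\<^sub>M \<nu>) (prod_act \<sigma> \<sigma>)"
    using sr2 unfolding T_cocycle_superrigid_def diag2_eq by blast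
  have erg3: "ergodic_action G (\<nu> \<Otimes>\<^sub>M (\<nu> \<Otimes>\<^sub>M \<nu>)) (prod_act \<sigma> (prod_act \<sigma> \<sigma>))"
    by (rule ergodic_prod[OF group_axioms countable pmp erg2 erg2])
  interpret Q3: pair_prob_space \<nu> "\<nu> \<Otimes>\<^sub>M \<nu>" ..
  let ?Q = "\<nu> \<Otimes>\<^sub>M (\<nu> \<Otimes>\<^sub>M \<nu>)"
  \<comment> \<open>The cocycle defect of \<open>\<phi>\<close>. It ignores coboundaries, hence is
    invariant under the diagonal action on X^3.\<close>
  define V where "V q = \<phi> (fst q, fst (snd q)) * \<phi> (fst q + fst (snd q), snd (snd q))
    * inverse (\<phi> (fst (snd q), snd (snd q))) * inverse (\<phi> (fst q, fst (snd q) + snd (snd q)))" for q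
  have Vm: "V \<in> borel_measurable ?Q"
  proof -
    note [measurable] = \<phi>m
    show ?thesis unfolding V_def by measurable
  qed
  have Vc: "V q \<in> circle" for q unfolding V_def by (intro circle_simps \<phi>c)
  have Vinv: "AE q in ?Q. V (prod_act \<sigma> (prod_act \<sigma> \<sigma>) g q) = V q" if g: "g \<in> carrier G" for g
  proof -
    have g': "inv g \<in> carrier G" using g by simp
    have P: "AE w in \<nu> \<Otimes>\<^sub>M \<nu>. \<phi> (\<sigma> g (fst w), \<sigma> g (snd w))
      = \<beta> (inv g) (fst w) * \<beta> (inv g) (snd w) * \<phi> w * inverse (\<beta> (inv g) (fst w + snd w))"
      using \<beta>\<phi>[OF g'] g by simp
    have m1: "measure_preserving_map ?Q (\<nu> \<Otimes>\<^sub>M \<nu>) (\<lambda>q. (fst q, fst (snd q)))"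
      by (rule mp_prod[OF ps(1) mp_id mp_fst[OF ps(1)]])
    have m2: "measure_preserving_map ?Q (\<nu> \<Otimes>\<^sub>M \<nu>) (\<lambda>q. (fst q + fst (snd q), snd (snd q)))"
    proof -
      have "measure_preserving_map ?Q ?Q (\<lambda>q. (fst q, (fst q + fst (snd q), snd (snd q))))"
      proof (rule mp_skew[where h="\<lambda>x r. (x + fst r, snd r)"])
        show "measure_preserving_map (\<nu> \<Otimes>\<^sub>M \<nu>) (\<nu> \<Otimes>\<^sub>M \<nu>) (\<lambda>r. (x + fst r, snd r))" for x
          by (rule mp_prod[OF ps(1) mp_translate mp_id])
      qed (use ps in measurable)
      from mp_comp[OF this mp_snd[OF ps]] show ?thesis by simp
    qed
    have m3: "measure_preserving_map ?Q (\<nu> \<Otimes>\<^sub>M \<nu>) (\<lambda>q. (fst (snd q), snd (snd q)))"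
      using mp_snd[OF ps] by simp
    have m4: "measure_preserving_map ?Q (\<nu> \<Otimes>\<^sub>M \<nu>) (\<lambda>q. (fst q, fst (snd q) + snd (snd q)))"
      by (rule mp_prod[OF ps(1) mp_id mp_add])
    show ?thesis
      using mp_AE[OF m1 P] mp_AE[OF m2 P] mp_AE[OF m3 P] mp_AE[OF m4 P]
    proof eventually_elim
      case (elim q)
      have Vg: "V (prod_act \<sigma> (prod_act \<sigma> \<sigma>) g q) = \<phi> (\<sigma> g (fst q), \<sigma> g (fst (snd q)))
        * \<phi> (\<sigma> g (fst q + fst (snd q)), \<sigma> g (snd (snd q)))
        * inverse (\<phi> (\<sigma> g (fst (snd q)), \<sigma> g (snd (snd q))))
        * inverse (\<phi> (\<sigma> g (fst q), \<sigma> g (fst (snd q) + snd (snd q))))"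
        by (simp add: V_def prod_act_def sigma_add[OF g])
      show ?case
        unfolding Vg unfolding elim[unfolded fst_conv snd_conv add.assoc] unfolding V_def
        by (rule cocycle_defect_algebra) (rule \<beta>nz[OF g'])+
    qed
  qed
  define C where "C = (\<integral>q. V q \<partial>?Q)"
  have VC: "AE q in ?Q. V q = C"
    unfolding C_def by (rule ergodic_invariant_complex[OF group_axioms countable erg3 Vm _ Vinv, of 1]) (use Vc circle_simps(2) in auto)
  obtain q0 where "V q0 = C" using Q3.P.AE_exists[OF VC] by blast
  then have Cc: "C \<in> circle" using Vc by blast
  have coc: "AE q in ?Q. \<phi> (fst q, fst (snd q)) * \<phi> (fst q + fst (snd q), snd (snd q))
      = C * \<phi> (fst (snd q), snd (snd q)) * \<phi> (fst q, fst (snd q) + snd (snd q))"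
    using VC
  proof eventually_elim
    case (elim q)
    have "a * b = (a * b * inverse c * inverse d) * c * d" if "c \<noteq> 0" "d \<noteq> 0" for a b c d :: complex
      using that by (simp add: field_simps)
    then show ?case unfolding elim[symmetric] V_def using \<phi>nz by blast
  qed
  obtain n :: nat and D C' where n: "n > 0" and Dm: "D \<in> borel_measurable \<nu>" and Dc: "\<And>x. D x \<in> circle"
    and \<phi>D: "AE w in \<nu> \<Otimes>\<^sub>M \<nu>. \<phi> w ^ n = C' * D (fst w + snd w) * inverse (D (fst w)) * inverse (D (snd w))"
    by (rule multiplier_power_trivial[OF \<phi>m \<phi>c Cc coc]) (rule that)
  have Dnz: "D x \<noteq> 0" for x using Dc circle_simps(1) by blast
  \<comment> \<open>The multiplicative defect of \<open>\<beta> g\<close> is the quotient of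
    \<open>\<phi>\<close> by its translate. In the n-th power \<open>D\<close> expresses this
    quotient as a coboundary, which the two factors of \<open>D\<close> remove; the constant
    \<open>C'\<close> cancels.\<close>
  define f where "f g x = \<beta> g x ^ n * D (\<sigma> (inv g) x) * inverse (D x)" for g x
  have fc: "f g x \<in> circle" if "g \<in> carrier G" for g x unfolding f_def by (intro circle_simps \<beta>c Dc that)
  have fm: "f g \<in> borel_measurable \<nu>" if g: "g \<in> carrier G" for g
  proof -
    have g': "inv g \<in> carrier G" using g by simp
    note [measurable] = \<beta>m[OF g] Dm mp_measurable[OF mp_sigma[OF g']]
    show ?thesis unfolding f_def by measurable
  qed
  have fmult: "AE w in \<nu> \<Otimes>\<^sub>M \<nu>. f g (fst w + snd w) = f g (fst w) * f g (snd w)" if g: "g \<in> carrier G" for g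
  proof -
    have g': "inv g \<in> carrier G" using g by simp
    show ?thesis
      using \<beta>\<phi>[OF g] \<phi>D mp_AE[OF mp_prod[OF ps(1) mp_sigma[OF g'] mp_sigma[OF g']] \<phi>D]
    proof eventually_elim
      case (elim w)
      define x y xy where "x = \<beta> g (fst w) ^ n" and "y = \<beta> g (snd w) ^ n" and "xy = \<beta> g (fst w + snd w) ^ n"
      define p q r where "p = D (fst w)" and "q = D (snd w)" and "r = D (fst w + snd w)"
      define p' q' r' where "p' = D (\<sigma> (inv g) (fst w))" and "q' = D (\<sigma> (inv g) (snd w))"
        and "r' = D (\<sigma> (inv g) (fst w + snd w))"
      note defs = x_def y_def xy_def p_def q_def r_def p'_def q'_def r'_def
      have nz: "x \<noteq> 0" "y \<noteq> 0" "xy \<noteq> 0" "p \<noteq> 0" "q \<noteq> 0" "r \<noteq> 0" "p' \<noteq> 0" "q' \<noteq> 0" "r' \<noteq> 0"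
        using \<beta>nz[OF g] Dnz by (auto simp: defs)
      \<comment> \<open>\<open>multiplier_power_trivial\<close> makes no claim about
        \<open>C'\<close>, but \<open>\<phi>\<close> has no zeros.\<close>
      have C': "C' \<noteq> 0" using elim(2) \<phi>nz[of w] by auto
      have "C' * r' * inverse p' * inverse q' = x * y * (C' * r * inverse p * inverse q) * inverse xy"
        using arg_cong[OF elim(1), of "\<lambda>z. z ^ n"] elim(2,3)
        by (simp add: defs power_mult_distrib power_inverse sigma_add[OF g'])
      then have "C' * (r' * inverse p' * inverse q') = C' * (x * y * (r * inverse p * inverse q) * inverse xy)"
        by (simp only: mult_ac)
      then have e: "r' * inverse p' * inverse q' = x * y * (r * inverse p * inverse q) * inverse xy" using C' by simp
      have "xy * r' * inverse r = xy * (r' * inverse p' * inverse q') * p' * q' * inverse r" using nz by (simp add: field_simps)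
      also have "\<dots> = (x * p' * inverse p) * (y * q' * inverse q)" unfolding e using nz by (simp add: field_simps)
      finally show ?case by (simp add: f_def defs)
    qed
  qed
  have "\<exists>k. k \<in> pontryagin_dual \<and> (AE x in \<nu>. k x = f g x)" if g: "g \<in> carrier G" for g
    using AE_character[OF fm[OF g] fc[OF g] fmult[OF g]] by blast
  then obtain k where k: "\<And>g. g \<in> carrier G \<Longrightarrow> k g \<in> pontryagin_dual" "\<And>g. g \<in> carrier G \<Longrightarrow> AE x in \<nu>. k g x = f g x"
    by metis
  have "c g h x ^ n = dual_act G \<sigma> g (k h) x * inverse (k (g \<otimes> h) x) * k g x"
    if g: "g \<in> carrier G" and h: "h \<in> carrier G" for g h x
  \<comment> \<open>\<open>B2_dual\<close> asks for equality at every point; both sides are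
    multiplicative, so almost everywhere equality is enough.\<close>
  proof (rule hom_eq_of_AE[where f="\<lambda>x. c g h x ^ n" and g="\<lambda>x. dual_act G \<sigma> g (k h) x * inverse (k (g \<otimes> h) x) * k g x"])
    have gh: "g \<otimes> h \<in> carrier G" and g': "inv g \<in> carrier G" and h': "inv h \<in> carrier G" using g h by auto
    show "c g h (a + b) ^ n = c g h a ^ n * c g h b ^ n" for a b
      by (simp add: pontryagin_dualD(3)[OF c[OF g h]] power_mult_distrib)
    show "c g h x ^ n \<in> circle" for x by (intro circle_simps pontryagin_dualD(2)[OF c[OF g h]])
    show "dual_act G \<sigma> g (k h) (a + b) * inverse (k (g \<otimes> h) (a + b)) * k g (a + b) =
      (dual_act G \<sigma> g (k h) a * inverse (k (g \<otimes> h) a) * k g a) * (dual_act G \<sigma> g (k h) b * inverse (k (g \<otimes> h) b) * k g b)" for a b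
      by (simp add: dual_act_def sigma_add[OF g'] pontryagin_dualD(3)[OF k(1)] g h gh mult_ac)
    show "AE x in \<nu>. c g h x ^ n = dual_act G \<sigma> g (k h) x * inverse (k (g \<otimes> h) x) * k g x"
      using c\<beta>[OF g h] k(2)[OF g] k(2)[OF gh] mp_AE[OF mp_sigma[OF g'] k(2)[OF h]]
    proof eventually_elim
      case (elim x)
      have s: "\<sigma> (inv (g \<otimes> h)) x = \<sigma> (inv h) (\<sigma> (inv g) x)"
        using g h by (simp add: inv_mult_group sigma_mult)
      have nz: "D x \<noteq> 0" "D (\<sigma> (inv g) x) \<noteq> 0" "D (\<sigma> (inv h) (\<sigma> (inv g) x)) \<noteq> 0" using Dnz by auto
      \<comment> \<open>The corrections by \<open>D\<close> sit at the three points
        \<open>x\<close>, its translate by the inverse of \<open>g\<close>, and its translate by the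
        inverse of \<open>g \<otimes> h\<close>; each occurs once above and once below.\<close>
      have "dual_act G \<sigma> g (k h) x * inverse (k (g \<otimes> h) x) * k g x
        = (\<beta> g x * \<beta> h (\<sigma> (inv g) x) * inverse (\<beta> (g \<otimes> h) x)) ^ n
          * (D x * inverse (D x)) * (D (\<sigma> (inv g) x) * inverse (D (\<sigma> (inv g) x)))
          * (D (\<sigma> (inv h) (\<sigma> (inv g) x)) * inverse (D (\<sigma> (inv h) (\<sigma> (inv g) x))))"
        unfolding dual_act_def elim(2-4) f_def s
        by (simp add: power_mult_distrib power_inverse mult_ac)
      also have "\<dots> = c g h x ^ n" unfolding elim(1) using nz by simp
      finally show ?case by simp
    qed
  qed
  then have "B2_dual G \<sigma> (\<lambda>g h x. c g h x ^ n)" using k(1) unfolding B2_dual_def by blast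
  then show ?thesis using n by blast
qed

section \<open>The maps on second cohomology\<close>

lemma one_Z2_T: "(\<lambda>_ _. 1) \<in> Z2_T G"
  by (simp add: Z2_T_def circle_simps)

text \<open>The quotient of the two scalar cocycles is the coboundary of a function on X;
  \<open>untwist\<close> with base X replaces that function by scalars
  \<open>\<rho>\<close>.\<close>

lemma Psi2_injective:
  assumes "d \<in> Z2_T G" "d' \<in> Z2_T G"
    and "B2_act G \<nu> \<sigma> (\<lambda>g h x. Psi2 d g h x / Psi2 d' g h x)"
  shows "B2_T G (\<lambda>g h. d g h / d' g h)"
proof -
  obtain b where b: "\<And>g. g \<in> carrier G \<Longrightarrow> b g \<in> borel_measurable \<nu>" "\<And>g x. g \<in> carrier G \<Longrightarrow> x \<in> space \<nu> \<Longrightarrow> b g x \<in> circle"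
    "\<And>g h. g \<in> carrier G \<Longrightarrow> h \<in> carrier G \<Longrightarrow>
      AE x in \<nu>. d g h / d' g h = b g x * b h (\<sigma> (inv g) x) * inverse (b (g \<otimes> h) x)"
    using assms(3) unfolding B2_act_def Psi2_def by blast
  obtain \<rho> where "\<And>g. g \<in> carrier G \<Longrightarrow> \<rho> g \<in> circle"
    "\<And>g h. g \<in> carrier G \<Longrightarrow> h \<in> carrier G \<Longrightarrow> d g h / d' g h = \<rho> g * \<rho> h * inverse (\<rho> (g \<otimes> h))"
    by (rule untwist[OF group_axioms countable pmp sr2, of b "\<lambda>g h. d g h / d' g h"]) (use b in blast)+
  then show ?thesis unfolding B2_T_def by (intro exI[of _ \<rho>]) (simp add: mult_ac)
qed

lemma tilde2_cocycle:
  assumes "c \<in> Z2_dual G \<sigma>"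
  shows "tilde2 c \<in> Z2_act G \<nu> \<sigma>"
proof -
  have p: "c g h \<in> pontryagin_dual" if "g \<in> carrier G" "h \<in> carrier G" for g h
    using assms that by (simp add: Z2_dual_def)
  show ?thesis
    using assms unfolding Z2_dual_def Z2_act_def tilde2_def dual_act_def
    by (simp add: pontryagin_measurable[OF p] pontryagin_dualD(2)[OF p])
qed

text \<open>The characters trivialising the quotient serve as transfer functions, with the trivial
  scalar cocycle.\<close>

lemma Phi2_well_defined:
  assumes "B2_dual G \<sigma> (\<lambda>g h x. c g h x / c' g h x)"
  shows "eq_mod_Psi2 G \<nu> \<sigma> (tilde2 c) (tilde2 c')"
proof -
  obtain b where b: "\<And>g. g \<in> carrier G \<Longrightarrow> b g \<in> pontryagin_dual"
    "\<And>g h x. g \<in> carrier G \<Longrightarrow> h \<in> carrier G \<Longrightarrow>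
      c g h x / c' g h x = dual_act G \<sigma> g (b h) x * inverse (b (g \<otimes> h) x) * b g x"
    using assms unfolding B2_dual_def by blast
  have "B2_act G \<nu> \<sigma> (\<lambda>g h y. tilde2 c g h y / (tilde2 c' g h y * Psi2 (\<lambda>_ _. 1) g h y))"
    unfolding B2_act_def tilde2_def Psi2_def
    using b(2)
    by (intro exI[of _ b]) (simp add: pontryagin_measurable[OF b(1)] pontryagin_dualD(2)[OF b(1)] dual_act_def mult_ac)
  then show ?thesis unfolding eq_mod_Psi2_def using one_Z2_T by blast
qed

lemma Phi2_hom:
  assumes "c \<in> Z2_dual G \<sigma>" "c' \<in> Z2_dual G \<sigma>"
  shows "eq_mod_Psi2 G \<nu> \<sigma> (tilde2 (\<lambda>g h x. c g h x * c' g h x)) (\<lambda>g h x. tilde2 c g h x * tilde2 c' g h x)"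
proof -
  have nz: "c g h x \<noteq> 0" "c' g h x \<noteq> 0" if "g \<in> carrier G" "h \<in> carrier G" for g h x
    using assms that by (simp_all add: Z2_dual_def pontryagin_dual_nonzero)
  have "B2_act G \<nu> \<sigma> (\<lambda>g h y. tilde2 (\<lambda>g h x. c g h x * c' g h x) g h y / ((tilde2 c g h y * tilde2 c' g h y) * Psi2 (\<lambda>_ _. 1) g h y))"
    unfolding B2_act_def tilde2_def Psi2_def
    by (intro exI[of _ "\<lambda>_ _. 1"]) (simp add: nz circle_simps)
  then show ?thesis unfolding eq_mod_Psi2_def using one_Z2_T by blast
qed

text \<open>The quotient of the two cocycles is a scalar cocycle times a coboundary, so
  \<open>cocycle_power_trivial\<close> makes its class torsion and \<open>tf\<close> makes it
  zero.\<close>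

lemma Phi2_injective:
  assumes tf: "\<forall>c \<in> Z2_dual G \<sigma>. \<forall>n::nat. n > 0 \<longrightarrow> B2_dual G \<sigma> (\<lambda>g h x. c g h x ^ n) \<longrightarrow> B2_dual G \<sigma> c"
    and c: "c \<in> Z2_dual G \<sigma>" "c' \<in> Z2_dual G \<sigma>"
    and eq: "eq_mod_Psi2 G \<nu> \<sigma> (tilde2 c) (tilde2 c')"
  shows "B2_dual G \<sigma> (\<lambda>g h x. c g h x / c' g h x)"
proof -
  obtain d b where d: "d \<in> Z2_T G"
    and b: "\<forall>g\<in>carrier G. b g \<in> borel_measurable \<nu> \<and> (\<forall>x\<in>space \<nu>. b g x \<in> circle)"
    and ae: "\<forall>g\<in>carrier G. \<forall>h\<in>carrier G.
      AE x in \<nu>. c g h x / (c' g h x * d g h) = b g x * b h (\<sigma> (inv g) x) * inverse (b (g \<otimes> h) x)"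
    using eq unfolding eq_mod_Psi2_def B2_act_def tilde2_def Psi2_def by (elim bexE exE conjE) (rule that)
  have bm: "b g \<in> borel_measurable \<nu>" and bc: "b g x \<in> circle" if "g \<in> carrier G" for g x
    using b that by (simp_all add: space_nu)
  have cc: "(\<lambda>g h x. c g h x / c' g h x) \<in> Z2_dual G \<sigma>" using c by (rule Z2_dual_divide)
  have dc: "d g h \<in> circle" if "g \<in> carrier G" "h \<in> carrier G" for g h
    using d that by (simp add: Z2_T_def)
  have "\<exists>n::nat>0. B2_dual G \<sigma> (\<lambda>g h x. (c g h x / c' g h x) ^ n)"
  proof (rule cocycle_power_trivial[where d=d and b=b])
    fix g h assume g: "g \<in> carrier G" and h: "h \<in> carrier G"
    show "(\<lambda>x. c g h x / c' g h x) \<in> pontryagin_dual" using cc g h by (simp add: Z2_dual_def)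
    show "AE x in \<nu>. c g h x / c' g h x = d g h * b g x * b h (\<sigma> (inv g) x) * inverse (b (g \<otimes> h) x)"
      using bspec[OF bspec[OF ae g] h]
    proof eventually_elim
      case (elim x)
      have "c g h x / c' g h x = d g h * (c g h x / (c' g h x * d g h))"
        using circle_simps(1)[OF dc[OF g h]] by simp
      then show ?case unfolding elim by (simp only: mult_ac)
    qed
  qed (rule dc bm bc; assumption)+
  then obtain n :: nat where "n > 0" "B2_dual G \<sigma> (\<lambda>g h x. (c g h x / c' g h x) ^ n)" by blast
  then show ?thesis using bspec[OF tf cc] by simp
qed

end

theorem theorem1p1:
  fixes G :: "('g, 'b) monoid_scheme"
    and \<sigma> :: "'g \<Rightarrow> 'x::{metric_space, ab_group_add} \<Rightarrow> 'x"
    and \<nu> :: "'x measure"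
  assumes grp: "group G"
    and cnt: "countable (carrier G)"
    and inf: "infinite (carrier G)"
    and X: "compact_abelian_top_group TYPE('x)"
    and haar: "haar_prob \<nu>"
    and alg: "algebraic_action G \<sigma>"
    and wm: "weakly_mixing G \<nu> \<sigma>"
    and sr2: "T_cocycle_superrigid G (\<nu> \<Otimes>\<^sub>M \<nu>) (diag2 \<sigma>)"
    and sr4: "T_cocycle_superrigid G ((\<nu> \<Otimes>\<^sub>M \<nu>) \<Otimes>\<^sub>M (\<nu> \<Otimes>\<^sub>M \<nu>)) (diag2 (diag2 \<sigma>))"
    and tf: "\<forall>c \<in> Z2_dual G \<sigma>. \<forall>n::nat. n > 0 \<longrightarrow>
               B2_dual G \<sigma> (\<lambda>g h x. c g h x ^ n) \<longrightarrow> B2_dual G \<sigma> c"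
  shows
    \<comment> \<open>\<Psi>_2 is injective\<close>
    "(\<forall>d \<in> Z2_T G. \<forall>d' \<in> Z2_T G.
        B2_act G \<nu> \<sigma> (\<lambda>g h x. Psi2 d g h x / Psi2 d' g h x) \<longrightarrow>
        B2_T G (\<lambda>g h. d g h / d' g h))
     \<comment> \<open>\<Phi>_2 maps cocycles to cocycles\<close>
     \<and> (\<forall>c \<in> Z2_dual G \<sigma>. tilde2 c \<in> Z2_act G \<nu> \<sigma>)
     \<comment> \<open>\<Phi>_2 is well defined on cohomology classes\<close>
     \<and> (\<forall>c \<in> Z2_dual G \<sigma>. \<forall>c' \<in> Z2_dual G \<sigma>.
          B2_dual G \<sigma> (\<lambda>g h x. c g h x / c' g h x) \<longrightarrow>
          eq_mod_Psi2 G \<nu> \<sigma> (tilde2 c) (tilde2 c'))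
     \<comment> \<open>\<Phi>_2 is a homomorphism\<close>
     \<and> (\<forall>c \<in> Z2_dual G \<sigma>. \<forall>c' \<in> Z2_dual G \<sigma>.
          eq_mod_Psi2 G \<nu> \<sigma> (tilde2 (\<lambda>g h x. c g h x * c' g h x))
                             (\<lambda>g h x. tilde2 c g h x * tilde2 c' g h x))
     \<comment> \<open>\<Phi>_2 is injective\<close>
     \<and> (\<forall>c \<in> Z2_dual G \<sigma>. \<forall>c' \<in> Z2_dual G \<sigma>.
          eq_mod_Psi2 G \<nu> \<sigma> (tilde2 c) (tilde2 c') \<longrightarrow>
          B2_dual G \<sigma> (\<lambda>g h x. c g h x / c' g h x))"
proof -
  interpret algebraic_system G \<nu> \<sigma>
    by (intro algebraic_system.intro compact_haar.intro algebraic_system_axioms.intro grp cnt X haar alg sr2 sr4)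
       (use wm in \<open>simp add: weakly_mixing_def\<close>)
  show ?thesis
    using Psi2_injective tilde2_cocycle Phi2_well_defined Phi2_hom Phi2_injective[OF tf] by blast
qed

end
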